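(* Let $M$ be a space-like self-shrinker of dimension $n$ in $\mathbb{R}^{m+n}_m$ (with $0\in M$) which is closed with respect to the Euclidean topology. Let $z=\langle F,F\rangle$ be the pseudo-distance function on $M$, where $F$ is the position vector. If there is a constant $\alpha<\frac18$ such that $|H|^2\le e^{\alpha z}$ on $M$, then $M$ is an affine $n$-plane.
   Context: $\mathbb{R}^{m+n}_m$ is the pseudo-Euclidean space $\mathbb{R}^{m+n}$ with the indefinite flat metric $\langle\cdot,\cdot\rangle$ given by $ds^2=\sum_{i=1}^n (dx^i)^2-\sum_{\alpha=n+1}^{m+n}(dx^\alpha)^2$. A space-like $n$-dimensional submanifold $F:M\to\mathbb{R}^{m+n}_m$ (smooth, connected, identified with its image; $F$ is the position vector) is one whose induced metric is positive definite (Riemannian). Let $\bar\nabla$ be the flat connection of $\mathbb{R}^{m+n}_m$, and $(\cdot)^T,(\cdot)^N$ the orthogonal projections onto the tangent bundle $TM$ and the normal bundle $NM$. The second fundamental form is $B_{XY}=(\bar\nabla_XY)^N$ for tangent fields $X,Y$, and the mean curvature vector is $H=\sum_i B_{e_ie_i}$ for a local orthonormal tangent frame $\{e_i\}$. Since $H$ is a section of the normal bundle, on which the metric is negative definite, one sets $|H|^2=-\langle H,H\rangle\ge 0$. $M$ is a space-like self-shrinker if $H=-\frac{1}{2}F^N$ on $M$. The origin $0$ of $\mathbb{R}^{m+n}_m$ is assumed to lie on $M$. "Closed with respect to the Euclidean topology" means that $M$ is a closed subset of $\mathbb{R}^{m+n}$ in its usual topology. *)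

theory Defs
  imports "HOL-Analysis.Analysis"
begin

text \<open>The pseudo-Euclidean space with \<open>n = CARD('n)\<close> positive and \<open>m = CARD('m)\<close> negative directions;
  its topology and smooth structure are those of the Euclidean product space.\<close>

type_synonym ('n, 'm) pseudo_space = "(real, 'n) vec \<times> (real, 'm) vec"

definition pseudo_inner ::
  "('n::finite, 'm::finite) pseudo_space \<Rightarrow> ('n, 'm) pseudo_space \<Rightarrow> real" where
  "pseudo_inner x y = fst x \<bullet> fst y - snd x \<bullet> snd y"

text \<open>Smoothness is only meant for open domains: all derivatives are unrestricted ones.\<close>

primrec Ck_on :: "nat \<Rightarrow> 'a::euclidean_space set \<Rightarrow> ('a \<Rightarrow> 'b::euclidean_space) \<Rightarrow> bool" where
  "Ck_on 0 S f \<longleftrightarrow> continuous_on S f"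
| "Ck_on (Suc k) S f \<longleftrightarrow> (\<forall>x\<in>S. f differentiable (at x)) \<and>
     (\<forall>v. Ck_on k S (\<lambda>x. frechet_derivative f (at x) v))"

definition smooth_on :: "'a::euclidean_space set \<Rightarrow> ('a \<Rightarrow> 'b::euclidean_space) \<Rightarrow> bool" where
  "smooth_on S f \<longleftrightarrow> (\<forall>k. Ck_on k S f)"

definition smooth_submanifold :: "('n::finite, 'm::finite) pseudo_space set \<Rightarrow> bool" where
  "smooth_submanifold M \<longleftrightarrow> (\<forall>p\<in>M. \<exists>U W (\<phi> :: real^'n \<Rightarrow> ('n, 'm) pseudo_space) \<psi>.
     open U \<and> p \<in> U \<and> open W \<and> smooth_on W \<phi> \<and>
     (\<forall>u\<in>W. inj (frechet_derivative \<phi> (at u))) \<and>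
     homeomorphism W (M \<inter> U) \<phi> \<psi>)"

definition tangent_space ::
  "('n::finite, 'm::finite) pseudo_space set \<Rightarrow> ('n, 'm) pseudo_space \<Rightarrow> ('n, 'm) pseudo_space set" where
  "tangent_space M p = {v. \<exists>\<epsilon>>0. \<exists>\<gamma> :: real \<Rightarrow> ('n, 'm) pseudo_space.
     smooth_on {-\<epsilon><..<\<epsilon>} \<gamma> \<and> \<gamma> ` {-\<epsilon><..<\<epsilon>} \<subseteq> M \<and> \<gamma> 0 = p \<and>
     (\<gamma> has_vector_derivative v) (at 0)}"

definition normal_space ::
  "('n::finite, 'm::finite) pseudo_space set \<Rightarrow> ('n, 'm) pseudo_space \<Rightarrow> ('n, 'm) pseudo_space set" where
  "normal_space M p = {w. \<forall>v\<in>tangent_space M p. pseudo_inner v w = 0}"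

definition spacelike_submanifold :: "('n::finite, 'm::finite) pseudo_space set \<Rightarrow> bool" where
  "spacelike_submanifold M \<longleftrightarrow> smooth_submanifold M \<and> connected M \<and>
     (\<forall>p\<in>M. \<forall>v\<in>tangent_space M p. v \<noteq> 0 \<longrightarrow> pseudo_inner v v > 0)"

text \<open>On a space-like submanifold the tangent and normal spaces are complementary,
  so the description below is unique.\<close>

definition normal_part ::
  "('n::finite, 'm::finite) pseudo_space set \<Rightarrow> ('n, 'm) pseudo_space \<Rightarrow>
   ('n, 'm) pseudo_space \<Rightarrow> ('n, 'm) pseudo_space" where
  "normal_part M p x = (THE w. w \<in> normal_space M p \<and> x - w \<in> tangent_space M p)"

text \<open>Local tangent fields are represented by smooth fields on an open subset \<open>U\<close> of the ambient space
  that are tangent to \<open>M\<close> along \<open>M \<inter> U\<close>; the values off \<open>M\<close> do not affect derivatives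
  in tangent directions.\<close>

definition tangent_field ::
  "('n::finite, 'm::finite) pseudo_space set \<Rightarrow> ('n, 'm) pseudo_space set \<Rightarrow>
   (('n, 'm) pseudo_space \<Rightarrow> ('n, 'm) pseudo_space) \<Rightarrow> bool" where
  "tangent_field M U X \<longleftrightarrow> open U \<and> smooth_on U X \<and> (\<forall>q\<in>M \<inter> U. X q \<in> tangent_space M q)"

definition second_fundamental_form ::
  "('n::finite, 'm::finite) pseudo_space set \<Rightarrow>
   (('n, 'm) pseudo_space \<Rightarrow> ('n, 'm) pseudo_space) \<Rightarrow>
   (('n, 'm) pseudo_space \<Rightarrow> ('n, 'm) pseudo_space) \<Rightarrow>
   ('n, 'm) pseudo_space \<Rightarrow> ('n, 'm) pseudo_space" where
  "second_fundamental_form M X Y p = normal_part M p (frechet_derivative Y (at p) (X p))"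

definition orthonormal_frame ::
  "('n::finite, 'm::finite) pseudo_space set \<Rightarrow> ('n, 'm) pseudo_space set \<Rightarrow>
   ('n \<Rightarrow> ('n, 'm) pseudo_space \<Rightarrow> ('n, 'm) pseudo_space) \<Rightarrow> bool" where
  "orthonormal_frame M U e \<longleftrightarrow> (\<forall>i. tangent_field M U (e i)) \<and>
     (\<forall>q\<in>M \<inter> U. \<forall>i j. pseudo_inner (e i q) (e j q) = (if i = j then 1 else 0))"

text \<open>The sum does not depend on the chosen frame, hence the definite description.\<close>

definition mean_curvature ::
  "('n::finite, 'm::finite) pseudo_space set \<Rightarrow> ('n, 'm) pseudo_space \<Rightarrow> ('n, 'm) pseudo_space" where
  "mean_curvature M p = (THE h. \<exists>U e. p \<in> U \<and> orthonormal_frame M U e \<and>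
     h = (\<Sum>i\<in>UNIV. second_fundamental_form M (e i) (e i) p))"

definition spacelike_self_shrinker :: "('n::finite, 'm::finite) pseudo_space set \<Rightarrow> bool" where
  "spacelike_self_shrinker M \<longleftrightarrow> spacelike_submanifold M \<and>
     (\<forall>p\<in>M. mean_curvature M p = - (1/2) *\<^sub>R normal_part M p p)"

text \<open>The metric is negative definite on normal spaces, whence the sign.\<close>

definition mean_curvature_norm_sq ::
  "('n::finite, 'm::finite) pseudo_space set \<Rightarrow> ('n, 'm) pseudo_space \<Rightarrow> real" where
  "mean_curvature_norm_sq M p = - pseudo_inner (mean_curvature M p) (mean_curvature M p)"

definition pseudo_distance :: "('n::finite, 'm::finite) pseudo_space \<Rightarrow> real" where
  "pseudo_distance p = pseudo_inner p p"

end

(*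
On a self-shrinker put u = |F^N|^2 = 4|H|^2 and w = weight(z), a convex function of the
pseudo-distance whose slope grows from 0 to 1/8.  Since alpha < 1/8 and z is proper, u e^(-w)
attains its maximum K.  If K = 0, every position vector is tangent, so M is a cone that is smooth at
the origin, hence a linear subspace.  If K > 0, let p be a maximum point and nu the unit normal in the
direction of F^N(p).  A boost turns the tangent space at p into R^n x 0; M is an entire graph of
height functions also after the boost, and with P the component of the height in the direction nu,
  (P - x.DP)^2 - K (1 - |DP|^2) e^w
has its maximum 0 at p.  There DP = 0, the self-shrinker equation has no first-order error, and the
first-order condition makes x an eigenvector of D^2 P.  The lower bound for |D^2 P|^2 from this
eigenvector cancels the gradient terms exactly, and what is left contradicts the second-order
condition by the choice of w.
*)

theory Submission
  imports Defs
begin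

text \<open>In codimension m the direction of F^N turns from point to point, and differentiating
  |F^N|^2 would bring in the normal connection. Instead the weighted quotient is maximised over
  points and normal directions together. At the maximum the coordinate vector c of the normal is
  frozen: over every x it still determines a normal vector \<open>S (conormal x c, c)\<close>, of
  square -(1 - |DP|^2) if |c| = 1. So the bound becomes an inequality between scalar functions on
  R^n that touch at p, and one-variable tests along the coordinate axes suffice. The induced metric
  in graph coordinates is the identity minus a term quadratic in the derivative of the height. This
  is why a horizontal tangent space removes first-order errors, and why heights are developed for an
  arbitrary linear isometry \<open>T\<close>. A weight linear in z would fail: the Laplacian of z
  contributes -2 n w'(z), which the constant 1 alone must beat when z and the height at p are small.
  The slope is therefore small there, while its limit 1/8 lets w outgrow
  \<open>\<alpha> * z\<close>. The choice k = 2 n^2 keeps w'' small against 1/n.\<close>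

section \<open>Smooth maps\<close>

definition dd :: "'a::euclidean_space \<Rightarrow> ('a \<Rightarrow> 'b::euclidean_space) \<Rightarrow> 'a \<Rightarrow> 'b" where
  "dd v f x = frechet_derivative f (at x) v"

lemma Ck_on_Suc: "Ck_on (Suc k) S f \<longleftrightarrow> (\<forall>x\<in>S. f differentiable (at x)) \<and> (\<forall>v. Ck_on k S (dd v f))"
  by (simp add: dd_def[abs_def])

declare Ck_on.simps(2) [simp del]

lemma has_derivative_dd:
  "f differentiable (at x) \<Longrightarrow> (f has_derivative (\<lambda>v. dd v f x)) (at x)"
  using frechet_derivative_works[of f "at x"] by (simp add: dd_def[abs_def])

lemma dd_eq: "(f has_derivative f') (at x) \<Longrightarrow> dd v f x = f' v"
  by (metis dd_def frechet_derivative_at)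

lemma linear_dd: "f differentiable (at x) \<Longrightarrow> linear (\<lambda>v. dd v f x)"
  using has_derivative_dd has_derivative_linear by blast

lemma Ck_on_SucD: "Ck_on (Suc k) S f \<Longrightarrow> Ck_on k S f"
proof (induction k arbitrary: f)
  case 0
  then show ?case
    by (simp add: Ck_on_Suc differentiable_at_withinI differentiable_imp_continuous_on differentiable_on_def)
next
  case (Suc k)
  then show ?case
    using Ck_on_Suc by blast
qed

lemma Ck_on_cong:
  assumes "open S" "\<And>x. x \<in> S \<Longrightarrow> f x = g x" "Ck_on k S f"
  shows "Ck_on k S g"
  using assms(2,3)
proof (induction k arbitrary: f g)
  case 0
  then show ?case by (simp cong: continuous_on_cong)
next
  case (Suc k)
  have *: "(g has_derivative (\<lambda>v. dd v f x)) (at x)" if "x \<in> S" for x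
    by (rule has_derivative_transform_within_open[OF has_derivative_dd \<open>open S\<close> that])
      (use Suc.prems that in \<open>auto simp: Ck_on_Suc\<close>)
  then have "dd v f x = dd v g x" if "x \<in> S" for x v
    using that dd_eq by metis
  then show ?case
    using Suc.IH[of "dd _ f" "dd _ g"] Suc.prems(2) * unfolding Ck_on_Suc
    by (meson differentiable_def)
qed

lemma Ck_on_subset: "Ck_on k S f \<Longrightarrow> T \<subseteq> S \<Longrightarrow> Ck_on k T f"
  by (induction k arbitrary: f) (auto simp: Ck_on_Suc intro: continuous_on_subset)

lemma Ck_on_SucI:
  assumes "open S" "\<And>x. x \<in> S \<Longrightarrow> (f has_derivative f' x) (at x)"
    "\<And>v. Ck_on k S (\<lambda>x. f' x v)"
  shows "Ck_on (Suc k) S f"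
  unfolding Ck_on_Suc
proof (intro conjI ballI allI)
  show "f differentiable (at x)" if "x \<in> S" for x
    using assms(2) that differentiable_def by blast
  show "Ck_on k S (dd v f)" for v
    by (rule Ck_on_cong[OF assms(1) _ assms(3)]) (simp add: dd_eq[OF assms(2)])
qed

lemma Ck_on_const: "Ck_on k S (\<lambda>x. c)"
proof (induction k arbitrary: c)
  case (Suc k)
  have "dd v (\<lambda>x. c) = (\<lambda>x. 0)" for v :: 'a
    by (rule ext) (rule dd_eq, rule has_derivative_const)
  with Suc show ?case by (auto simp: Ck_on_Suc)
qed auto

lemma dd_linear: "linear h \<Longrightarrow> dd v h = (\<lambda>x. h v)"
  by (rule ext) (simp add: dd_eq linear_imp_has_derivative)

lemma Ck_on_linear:
  assumes "linear h" shows "Ck_on k S h"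
proof (cases k)
  case 0
  with assms show ?thesis by (simp add: linear_continuous_on linear_conv_bounded_linear)
next
  case (Suc k)
  then show ?thesis
    using assms linear_imp_differentiable by (auto simp: Ck_on_Suc Ck_on_const dd_linear)
qed

lemma Ck_on_add:
  assumes "open S" "Ck_on k S f" "Ck_on k S g"
  shows "Ck_on k S (\<lambda>x. f x + g x)"
  using assms(2,3)
proof (induction k arbitrary: f g)
  case 0 then show ?case by (simp add: continuous_on_add)
next
  case (Suc k)
  show ?case
    by (rule Ck_on_SucI[OF assms(1), where f' = "\<lambda>x v. dd v f x + dd v g x"])
      (use Suc in \<open>auto simp: Ck_on_Suc intro!: has_derivative_add has_derivative_dd\<close>)
qed

lemma Ck_on_bilinear:
  assumes "bounded_bilinear B" "open S" "Ck_on k S f" "Ck_on k S g"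
  shows "Ck_on k S (\<lambda>x. B (f x) (g x))"
  using assms(3,4)
proof (induction k arbitrary: f g)
  case 0 then show ?case using bounded_bilinear.continuous_on[OF assms(1)] by simp
next
  case (Suc k)
  show ?case
  proof (rule Ck_on_SucI[OF assms(2), where f' = "\<lambda>x v. B (f x) (dd v g x) + B (dd v f x) (g x)"])
    fix x assume "x \<in> S"
    then show "((\<lambda>x. B (f x) (g x)) has_derivative (\<lambda>v. B (f x) (dd v g x) + B (dd v f x) (g x))) (at x)"
      using Suc.prems unfolding Ck_on_Suc
      by (intro bounded_bilinear.FDERIV[OF assms(1)] has_derivative_dd) auto
  next
    fix v
    show "Ck_on k S (\<lambda>x. B (f x) (dd v g x) + B (dd v f x) (g x))"
      by (intro Ck_on_add assms(2) Suc.IH) (use Suc.prems Ck_on_SucD in \<open>auto simp: Ck_on_Suc\<close>)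
  qed
qed

lemmas Ck_on_scaleR = Ck_on_bilinear[OF bounded_bilinear_scaleR]
  and Ck_on_mult = Ck_on_bilinear[OF bounded_bilinear_mult]
  and Ck_on_inner = Ck_on_bilinear[OF bounded_bilinear_inner]

lemma Ck_on_sum:
  assumes "open S" "\<And>i. i \<in> I \<Longrightarrow> Ck_on k S (f i)"
  shows "Ck_on k S (\<lambda>x. \<Sum>i\<in>I. f i x)"
  using assms(2)
  by (induction I rule: infinite_finite_induct) (auto intro: Ck_on_const Ck_on_add[OF assms(1)])

lemma Ck_on_linear_compose:
  assumes "linear h" "open S" "Ck_on k S f"
  shows "Ck_on k S (\<lambda>x. h (f x))"
  using assms(3)
proof (induction k arbitrary: f)
  case 0
  with assms(1) show ?case
    using linear_continuous_on_compose by (auto simp: linear_conv_bounded_linear)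
next
  case (Suc k)
  show ?case
    by (rule Ck_on_SucI[OF assms(2), where f' = "\<lambda>x v. h (dd v f x)"])
      (use Suc assms(1) in \<open>auto simp: Ck_on_Suc linear_conv_bounded_linear
        intro!: bounded_linear.has_derivative[of h] has_derivative_dd\<close>)
qed

lemma Ck_on_minus: "open S \<Longrightarrow> Ck_on k S f \<Longrightarrow> Ck_on k S (\<lambda>x. - f x)"
  by (rule Ck_on_linear_compose) (auto intro: linearI)

lemma Ck_on_diff: "open S \<Longrightarrow> Ck_on k S f \<Longrightarrow> Ck_on k S g \<Longrightarrow> Ck_on k S (\<lambda>x. f x - g x)"
  using Ck_on_add[of S k f "\<lambda>x. - g x"] Ck_on_minus[of S k g] by simp

lemma dd_compose:
  assumes "f differentiable (at (g x))" "g differentiable (at x)"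
  shows "((\<lambda>x. f (g x)) has_derivative (\<lambda>v. dd (dd v g x) f (g x))) (at x)"
  using has_derivative_compose[OF has_derivative_dd[OF assms(2)] has_derivative_dd[OF assms(1)]] .

lemma dd_expand:
  assumes "f differentiable (at x)"
  shows "dd v f x = (\<Sum>b\<in>Basis. (v \<bullet> b) *\<^sub>R dd b f x)"
proof -
  have "dd v f x = dd (\<Sum>b\<in>Basis. (v \<bullet> b) *\<^sub>R b) f x"
    by (simp add: euclidean_representation)
  then show ?thesis
    by (simp only: linear_sum[OF linear_dd[OF assms]] linear_scale[OF linear_dd[OF assms]])
qed

text \<open>The chain rule produces a derivative of \<open>f\<close> in the direction
  \<open>dd v g x\<close>, which moves with \<open>x\<close>, whereas \<open>Ck_on\<close> speaks of
  fixed directions. Expanding the direction in \<open>Basis\<close> turns it into smooth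
  coefficients times fixed directional derivatives, to which the induction applies.\<close>

lemma Ck_on_compose:
  assumes "open S" "open T" "g ` S \<subseteq> T" "Ck_on k T f" "Ck_on k S g"
  shows "Ck_on k S (\<lambda>x. f (g x))"
  using assms(4,5)
proof (induction k arbitrary: f)
  case 0 with assms(3) show ?case
    using continuous_on_compose2 by auto
next
  case (Suc k)
  have fd: "f differentiable (at (g x))" and gd: "g differentiable (at x)" if "x \<in> S" for x
    using that Suc.prems assms(3) by (auto simp: Ck_on_Suc)
  show ?case
  proof (rule Ck_on_SucI[OF assms(1), where f' = "\<lambda>x v. \<Sum>b\<in>Basis. (dd v g x \<bullet> b) *\<^sub>R dd b f (g x)"])
    fix x assume "x \<in> S"
    then show "((\<lambda>x. f (g x)) has_derivative (\<lambda>v. \<Sum>b\<in>Basis. (dd v g x \<bullet> b) *\<^sub>R dd b f (g x))) (at x)"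
      using dd_compose[OF fd gd] by (simp flip: dd_expand[OF fd])
  next
    fix v
    show "Ck_on k S (\<lambda>x. \<Sum>b\<in>Basis. (dd v g x \<bullet> b) *\<^sub>R dd b f (g x))"
      by (intro Ck_on_sum Ck_on_scaleR Ck_on_inner Ck_on_const Suc.IH assms(1))
        (use Suc.prems Ck_on_SucD in \<open>auto simp: Ck_on_Suc\<close>)
  qed
qed

text \<open>The derivative is -1/2 times the cube of the function itself, so the induction closes
  without other functions. Normalisation in Gram-Schmidt is what it serves.\<close>

lemma Ck_on_inverse_sqrt: "Ck_on k {0<..} (\<lambda>x::real. 1 / sqrt x)"
proof (induction k)
  case 0 show ?case by (auto intro!: continuous_intros)
next
  case (Suc k)
  let ?h = "\<lambda>x::real. 1 / sqrt x"
  show ?case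
  proof (rule Ck_on_SucI[where f' = "\<lambda>x v. v * (-1/2) * (?h x * (?h x * ?h x))"])
    fix x :: real assume "x \<in> {0<..}"
    then have "(?h has_real_derivative (-1/2) * (?h x * (?h x * ?h x))) (at x)"
      by (auto intro!: derivative_eq_intros simp: field_simps)
    then show "(?h has_derivative (\<lambda>v. v * (-1/2) * (?h x * (?h x * ?h x)))) (at x)"
      unfolding has_field_derivative_def by (rule has_derivative_eq_rhs) (simp add: fun_eq_iff)
  next
    show "Ck_on k {0<..} (\<lambda>x. v * (-1/2) * (?h x * (?h x * ?h x)))" for v
      by (intro Ck_on_mult Ck_on_const Suc open_greaterThan)
  qed simp
qed

lemma Ck_on_inverse_sqrt_compose:
  assumes "open S" "Ck_on k S f" "\<And>x. x \<in> S \<Longrightarrow> f x > 0"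
  shows "Ck_on k S (\<lambda>x. 1 / sqrt (f x))"
  by (rule Ck_on_compose[OF assms(1) _ _ Ck_on_inverse_sqrt assms(2)]) (use assms(3) in auto)

lemma smooth_on_dd: "smooth_on S f \<Longrightarrow> smooth_on S (dd v f)"
  unfolding smooth_on_def by (meson Ck_on_Suc)

lemma smooth_on_differentiable: "smooth_on S f \<Longrightarrow> x \<in> S \<Longrightarrow> f differentiable (at x)"
  unfolding smooth_on_def using Ck_on_Suc by blast

lemma smooth_on_continuous_on: "smooth_on S f \<Longrightarrow> continuous_on S f"
  unfolding smooth_on_def by (metis Ck_on.simps(1))

lemma smooth_on_cong: "open S \<Longrightarrow> (\<And>x. x \<in> S \<Longrightarrow> f x = g x) \<Longrightarrow> smooth_on S f \<Longrightarrow> smooth_on S g"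
  unfolding smooth_on_def using Ck_on_cong by blast

lemma smooth_on_subset: "smooth_on S f \<Longrightarrow> T \<subseteq> S \<Longrightarrow> smooth_on T f"
  unfolding smooth_on_def using Ck_on_subset by blast

lemma smooth_on_const: "smooth_on S (\<lambda>x. c)"
  unfolding smooth_on_def using Ck_on_const by blast

lemma smooth_on_linear: "linear h \<Longrightarrow> smooth_on S h"
  unfolding smooth_on_def using Ck_on_linear by blast

lemma smooth_on_add: "open S \<Longrightarrow> smooth_on S f \<Longrightarrow> smooth_on S g \<Longrightarrow> smooth_on S (\<lambda>x. f x + g x)"
  unfolding smooth_on_def using Ck_on_add by blast

lemma smooth_on_diff: "open S \<Longrightarrow> smooth_on S f \<Longrightarrow> smooth_on S g \<Longrightarrow> smooth_on S (\<lambda>x. f x - g x)"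
  unfolding smooth_on_def using Ck_on_diff by blast

lemma smooth_on_sum: "open S \<Longrightarrow> (\<And>i. i \<in> I \<Longrightarrow> smooth_on S (f i)) \<Longrightarrow> smooth_on S (\<lambda>x. \<Sum>i\<in>I. f i x)"
  unfolding smooth_on_def using Ck_on_sum[of S I _ f] by blast

lemma smooth_on_scaleR: "open S \<Longrightarrow> smooth_on S f \<Longrightarrow> smooth_on S g \<Longrightarrow> smooth_on S (\<lambda>x. f x *\<^sub>R g x)"
  unfolding smooth_on_def using Ck_on_scaleR by blast

lemma smooth_on_mult:
  fixes f g :: "'a::euclidean_space \<Rightarrow> real"
  shows "open S \<Longrightarrow> smooth_on S f \<Longrightarrow> smooth_on S g \<Longrightarrow> smooth_on S (\<lambda>x. f x * g x)"
  unfolding smooth_on_def using Ck_on_mult[of S _ f g] by blast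

lemma smooth_on_inner: "open S \<Longrightarrow> smooth_on S f \<Longrightarrow> smooth_on S g \<Longrightarrow> smooth_on S (\<lambda>x. f x \<bullet> g x)"
  unfolding smooth_on_def using Ck_on_inner by blast

lemma smooth_on_linear_compose:
  "linear h \<Longrightarrow> open S \<Longrightarrow> smooth_on S f \<Longrightarrow> smooth_on S (\<lambda>x. h (f x))"
  unfolding smooth_on_def using Ck_on_linear_compose by blast

lemma smooth_on_compose:
  "open S \<Longrightarrow> open T \<Longrightarrow> g ` S \<subseteq> T \<Longrightarrow> smooth_on T f \<Longrightarrow> smooth_on S g \<Longrightarrow> smooth_on S (\<lambda>x. f (g x))"
  unfolding smooth_on_def using Ck_on_compose by blast

lemma smooth_on_inverse_sqrt:
  "open S \<Longrightarrow> smooth_on S f \<Longrightarrow> (\<And>x. x \<in> S \<Longrightarrow> f x > 0) \<Longrightarrow> smooth_on S (\<lambda>x. 1 / sqrt (f x))"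
  unfolding smooth_on_def using Ck_on_inverse_sqrt_compose by blast

lemma smooth_on_openI:
  assumes "\<And>x. x \<in> S \<Longrightarrow> \<exists>T. open T \<and> x \<in> T \<and> smooth_on T f"
  shows "smooth_on S f"
proof -
  have "Ck_on k S f" if *: "\<And>x. x \<in> S \<Longrightarrow> \<exists>T. open T \<and> x \<in> T \<and> Ck_on k T f" for k
    using *
  proof (induction k arbitrary: f)
    case 0
    have "isCont f x" if "x \<in> S" for x
      using 0[OF that] continuous_on_eq_continuous_at by auto
    then show ?case
      unfolding Ck_on.simps(1) by (intro continuous_at_imp_continuous_on) blast
  next
    case (Suc k)
    show ?case unfolding Ck_on_Suc
    proof (intro conjI ballI allI)
      show "f differentiable (at x)" if "x \<in> S" for x
        using Suc.prems[OF that] unfolding Ck_on_Suc by blast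
      show "Ck_on k S (dd v f)" for v
      proof (rule Suc.IH)
        show "\<exists>T. open T \<and> x \<in> T \<and> Ck_on k T (dd v f)" if "x \<in> S" for x
          using Suc.prems[OF that] unfolding Ck_on_Suc by blast
      qed
    qed
  qed
  then show ?thesis
    using assms unfolding smooth_on_def by blast
qed

section \<open>Symmetry of second derivatives\<close>

lemma has_vector_derivative_along_line:
  assumes "f differentiable (at (x + t *\<^sub>R v))"
  shows "((\<lambda>t. f (x + t *\<^sub>R v)) has_vector_derivative dd v f (x + t *\<^sub>R v)) (at t)"
proof -
  have "((\<lambda>t. x + t *\<^sub>R v) has_derivative (\<lambda>s. s *\<^sub>R v)) (at t)"
    by (auto intro!: derivative_eq_intros)
  from has_derivative_compose[OF this has_derivative_dd[OF assms]] show ?thesis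
    unfolding has_vector_derivative_def
    by (simp add: linear_scale[OF linear_dd[OF assms]])
qed

text \<open>Both mixed derivatives are limits of this symmetric second difference.\<close>

lemma second_difference_mvt:
  fixes f :: "'a::euclidean_space \<Rightarrow> real"
  assumes "smooth_on S f" "h > 0"
    and S: "\<And>s t. 0 \<le> s \<Longrightarrow> s \<le> h \<Longrightarrow> 0 \<le> t \<Longrightarrow> t \<le> h \<Longrightarrow> x + s *\<^sub>R v + t *\<^sub>R w \<in> S"
  obtains s t where "0 \<le> s" "s \<le> h" "0 \<le> t" "t \<le> h"
    "f (x + h *\<^sub>R v + h *\<^sub>R w) - f (x + h *\<^sub>R v) - f (x + h *\<^sub>R w) + f x
      = h * h * dd w (dd v f) (x + s *\<^sub>R v + t *\<^sub>R w)"
proof -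
  have df: "f differentiable (at (x + s *\<^sub>R v + t *\<^sub>R w))"
    and ddf: "dd v f differentiable (at (x + s *\<^sub>R v + t *\<^sub>R w))"
    if "0 \<le> s" "s \<le> h" "0 \<le> t" "t \<le> h" for s t
    using S[OF that] assms(1) smooth_on_differentiable smooth_on_dd by blast+
  define \<phi> where "\<phi> s = f (x + h *\<^sub>R w + s *\<^sub>R v) - f (x + s *\<^sub>R v)" for s
  have "\<exists>s>0. s < h \<and> \<phi> h - \<phi> 0 = (h - 0) * (dd v f (x + h *\<^sub>R w + s *\<^sub>R v) - dd v f (x + s *\<^sub>R v))"
  proof (rule MVT2[OF \<open>h > 0\<close>])
    fix s assume s: "0 \<le> s" "s \<le> h"
    show "(\<phi> has_real_derivative dd v f (x + h *\<^sub>R w + s *\<^sub>R v) - dd v f (x + s *\<^sub>R v)) (at s)"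
      unfolding \<phi>_def
      using has_vector_derivative_along_line[of f "x + h *\<^sub>R w" s v]
        has_vector_derivative_along_line[of f x s v] df[of s h] df[of s 0] s \<open>h > 0\<close>
      by (auto intro!: derivative_intros simp: has_real_derivative_iff_has_vector_derivative algebra_simps)
  qed
  then obtain s where s: "0 < s" "s < h"
    and seq: "\<phi> h - \<phi> 0 = h * (dd v f (x + h *\<^sub>R w + s *\<^sub>R v) - dd v f (x + s *\<^sub>R v))" by auto
  have "\<exists>t>0. t < h \<and> dd v f (x + s *\<^sub>R v + h *\<^sub>R w) - dd v f (x + s *\<^sub>R v + 0 *\<^sub>R w)
      = (h - 0) * dd w (dd v f) (x + s *\<^sub>R v + t *\<^sub>R w)"
  proof (rule MVT2[OF \<open>h > 0\<close>])
    fix t assume "0 \<le> t" "t \<le> h"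
    then show "((\<lambda>t. dd v f (x + s *\<^sub>R v + t *\<^sub>R w)) has_real_derivative dd w (dd v f) (x + s *\<^sub>R v + t *\<^sub>R w)) (at t)"
      using has_vector_derivative_along_line[OF ddf[of s t]] s
      by (simp add: has_real_derivative_iff_has_vector_derivative)
  qed
  then obtain t where t: "0 < t" "t < h"
    and teq: "dd v f (x + s *\<^sub>R v + h *\<^sub>R w) - dd v f (x + s *\<^sub>R v) = h * dd w (dd v f) (x + s *\<^sub>R v + t *\<^sub>R w)"
    by auto
  show thesis
  proof (rule that[of s t])
    have c: "x + h *\<^sub>R w + s *\<^sub>R v = x + s *\<^sub>R v + h *\<^sub>R w" by simp
    have "\<phi> h - \<phi> 0 = h * (h * dd w (dd v f) (x + s *\<^sub>R v + t *\<^sub>R w))"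
      using seq teq unfolding c by simp
    moreover have "x + h *\<^sub>R w + h *\<^sub>R v = x + h *\<^sub>R v + h *\<^sub>R w" by simp
    ultimately show "f (x + h *\<^sub>R v + h *\<^sub>R w) - f (x + h *\<^sub>R v) - f (x + h *\<^sub>R w) + f x
      = h * h * dd w (dd v f) (x + s *\<^sub>R v + t *\<^sub>R w)"
      unfolding \<phi>_def by simp
  qed (use s t in auto)
qed

lemma dd_commute_real:
  fixes f :: "'a::euclidean_space \<Rightarrow> real"
  assumes "open S" "x \<in> S" "smooth_on S f"
  shows "dd v (dd w f) x = dd w (dd v f) x"
proof (rule ccontr)
  let ?A = "dd v (dd w f)" and ?B = "dd w (dd v f)"
  assume ne: "?A x \<noteq> ?B x"
  \<comment> \<open>Half the gap: near \<open>x\<close> the second difference makes a value of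
    \<open>?A\<close> equal to a value of \<open>?B\<close>, and this common number would lie within
    \<open>e\<close> of both \<open>?A x\<close> and \<open>?B x\<close>.\<close>
  define e where "e = \<bar>?A x - ?B x\<bar> / 2"
  have "e > 0" using ne by (simp add: e_def)
  have "continuous_on S ?A" "continuous_on S ?B"
    using assms(3) by (auto intro!: smooth_on_continuous_on smooth_on_dd)
  then have "isCont ?A x" "isCont ?B x"
    using assms(1,2) continuous_on_eq_continuous_at by blast+
  then have "\<forall>\<^sub>F y in nhds x. dist (?A y) (?A x) < e" "\<forall>\<^sub>F y in nhds x. dist (?B y) (?B x) < e"
    using \<open>e > 0\<close> tendstoD unfolding isCont_def tendsto_at_iff_tendsto_nhds by blast+
  then have "\<forall>\<^sub>F y in nhds x. dist (?A y) (?A x) < e \<and> dist (?B y) (?B x) < e \<and> y \<in> S"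
    using eventually_nhds_in_open[OF assms(1,2)] by (intro eventually_conj)
  then obtain d where d: "d > 0" "\<And>y. dist y x < d \<Longrightarrow> dist (?A y) (?A x) < e \<and> dist (?B y) (?B x) < e \<and> y \<in> S"
    unfolding eventually_nhds_metric by blast
  define h where "h = d / (2 * (norm v + norm w + 1))"
  have h: "h > 0" using d by (simp add: h_def add_pos_pos add_nonneg_pos)
  \<comment> \<open>Stated for a pair \<open>v'\<close>, \<open>w'\<close> with the same total norm
    so that it covers both orders of \<open>v\<close> and \<open>w\<close>.\<close>
  have near: "dist (x + s *\<^sub>R v' + t *\<^sub>R w') x < d"
    if "0 \<le> s" "s \<le> h" "0 \<le> t" "t \<le> h" "norm v' + norm w' = norm v + norm w" for s t v' w'
  proof -
    have "norm (s *\<^sub>R v' + t *\<^sub>R w') \<le> h * norm v' + h * norm w'"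
      using that by (intro norm_triangle_le add_mono) (auto intro: mult_right_mono)
    also have "\<dots> = h * (norm v + norm w)" by (metis distrib_left that(5))
    also have "\<dots> \<le> h * (norm v + norm w + 1)" using h by simp
    also have "\<dots> = d/2"
    proof -
      have "norm v + norm w + 1 > 0" by (simp add: add_nonneg_pos)
      then show ?thesis by (simp add: h_def field_simps)
    qed
    finally show ?thesis using d by (simp add: dist_norm add.assoc)
  qed
  obtain s t where st: "0 \<le> s" "s \<le> h" "0 \<le> t" "t \<le> h"
    "f (x + h *\<^sub>R v + h *\<^sub>R w) - f (x + h *\<^sub>R v) - f (x + h *\<^sub>R w) + f x = h * h * ?B (x + s *\<^sub>R v + t *\<^sub>R w)"
    using second_difference_mvt[OF assms(3) h, of x v w] d(2)[OF near] by blast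
  obtain s' t' where st': "0 \<le> s'" "s' \<le> h" "0 \<le> t'" "t' \<le> h"
    "f (x + h *\<^sub>R w + h *\<^sub>R v) - f (x + h *\<^sub>R w) - f (x + h *\<^sub>R v) + f x = h * h * ?A (x + s' *\<^sub>R w + t' *\<^sub>R v)"
    using second_difference_mvt[OF assms(3) h, of x w v] d(2)[OF near] by (auto simp: add.commute)
  have c: "x + h *\<^sub>R w + h *\<^sub>R v = x + h *\<^sub>R v + h *\<^sub>R w" by simp
  have "h * h * ?A (x + s' *\<^sub>R w + t' *\<^sub>R v) = h * h * ?B (x + s *\<^sub>R v + t *\<^sub>R w)"
    using st(5) st'(5) unfolding c by linarith
  then have "?A (x + s' *\<^sub>R w + t' *\<^sub>R v) = ?B (x + s *\<^sub>R v + t *\<^sub>R w)" using h by simp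
  moreover have "dist (?A (x + s' *\<^sub>R w + t' *\<^sub>R v)) (?A x) < e"
    using d(2)[OF near[OF st'(1-4)]] by simp
  moreover have "dist (?B (x + s *\<^sub>R v + t *\<^sub>R w)) (?B x) < e"
    using d(2)[OF near[OF st(1-4)]] by simp
  ultimately show False unfolding e_def dist_real_def by argo
qed

section \<open>Smooth orthonormalisation\<close>

definition gram_form :: "('i::finite \<Rightarrow> 'i \<Rightarrow> real) \<Rightarrow> real^'i \<Rightarrow> real^'i \<Rightarrow> real" where
  "gram_form g v w = (\<Sum>k\<in>UNIV. \<Sum>l\<in>UNIV. v $ k * g k l * w $ l)"

lemma linear_gram_form_left: "linear (\<lambda>v. gram_form g v w)"
  by (rule linearI)
    (simp_all add: gram_form_def sum.distrib algebra_simps sum_distrib_left)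

lemma gram_form_commute: "(\<And>k l. g k l = g l k) \<Longrightarrow> gram_form g v w = gram_form g w v"
  unfolding gram_form_def by (subst sum.swap) (auto intro!: sum.cong)

lemma smooth_on_nth:
  fixes f :: "'a::euclidean_space \<Rightarrow> real^'i"
  shows "open S \<Longrightarrow> smooth_on S f \<Longrightarrow> smooth_on S (\<lambda>x. f x $ i)"
  by (rule smooth_on_linear_compose[OF bounded_linear.linear[OF bounded_linear_vec_nth]])

lemma smooth_on_gram_form:
  assumes "open W" "\<And>k l. smooth_on W (\<lambda>x. g x k l)" "smooth_on W v" "smooth_on W w"
  shows "smooth_on W (\<lambda>x. gram_form (g x) (v x) (w x))"
  unfolding gram_form_def
  by (intro smooth_on_sum smooth_on_mult smooth_on_nth assms)

text \<open>Gram-Schmidt uses only sums, products and inverse square roots of positive functions, so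
  the basis depends smoothly on the point. The index type has no order, hence the induction runs
  over finite sets of indices. Its third invariant, that coordinates outside \<open>I\<close>
  vanish, gives the next vector \<open>V x\<close> the coordinate 1 at \<open>j\<close>; thus it is
  nonzero and can be normalised.\<close>

lemma smooth_gram_schmidt:
  fixes g :: "'a::euclidean_space \<Rightarrow> 'i::finite \<Rightarrow> 'i \<Rightarrow> real"
  assumes "open W"
    and smooth: "\<And>k l. smooth_on W (\<lambda>x. g x k l)"
    and sym: "\<And>x k l. g x k l = g x l k"
    and pos: "\<And>x v. x \<in> W \<Longrightarrow> v \<noteq> 0 \<Longrightarrow> gram_form (g x) v v > 0"
  obtains C :: "'i \<Rightarrow> 'a \<Rightarrow> real^'i"
  where "\<And>i. smooth_on W (C i)"
    and "\<And>x i j. x \<in> W \<Longrightarrow> gram_form (g x) (C i x) (C j x) = (if i = j then 1 else 0)"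
proof -
  have "\<exists>C :: 'i \<Rightarrow> 'a \<Rightarrow> real^'i. (\<forall>i\<in>I. smooth_on W (C i)) \<and>
      (\<forall>x\<in>W. \<forall>i\<in>I. \<forall>j\<in>I. gram_form (g x) (C i x) (C j x) = (if i = j then 1 else 0)) \<and>
      (\<forall>x\<in>W. \<forall>i\<in>I. \<forall>k. k \<notin> I \<longrightarrow> C i x $ k = 0)" if "finite I" for I :: "'i set"
    using that
  proof induction
    case empty
    then show ?case by simp
  next
    case (insert j I)
    then obtain C :: "'i \<Rightarrow> 'a \<Rightarrow> real^'i" where sm: "\<And>i. i \<in> I \<Longrightarrow> smooth_on W (C i)"
      and orth: "\<And>x i j. x \<in> W \<Longrightarrow> i \<in> I \<Longrightarrow> j \<in> I \<Longrightarrow> gram_form (g x) (C i x) (C j x) = (if i = j then 1 else 0)"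
      and supp: "\<And>x i k. x \<in> W \<Longrightarrow> i \<in> I \<Longrightarrow> k \<notin> I \<Longrightarrow> C i x $ k = 0"
      by blast
    let ?q = "\<lambda>x. gram_form (g x)"
    note lin = linear_gram_form_left
    have comm: "?q x v w = ?q x w v" for x v w
      using gram_form_commute[of "g x"] sym by blast
    define V where "V x = axis j 1 - (\<Sum>i\<in>I. ?q x (axis j 1) (C i x) *\<^sub>R C i x)" for x
    have Vj: "V x $ j = 1" if "x \<in> W" for x
      using supp[OF that _ insert.hyps(2)] by (simp add: V_def)
    have Vk: "V x $ k = 0" if "x \<in> W" "k \<notin> insert j I" for x k
      using supp[OF that(1)] that(2) by (auto simp: V_def axis_def)
    have qV: "?q x (V x) (C i x) = 0" if "x \<in> W" "i \<in> I" for x i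
    proof -
      have "?q x (V x) (C i x) = ?q x (axis j 1) (C i x)
          - (\<Sum>k\<in>I. ?q x (axis j 1) (C k x) * ?q x (C k x) (C i x))"
        unfolding V_def
        by (simp add: linear_diff[OF lin] linear_sum[OF lin] linear_scale[OF lin])
      also have "(\<Sum>k\<in>I. ?q x (axis j 1) (C k x) * ?q x (C k x) (C i x))
          = (\<Sum>k\<in>I. if k = i then ?q x (axis j 1) (C i x) else 0)"
        using orth that by (intro sum.cong) auto
      finally show ?thesis using that insert.hyps(1) by simp
    qed
    have Vpos: "?q x (V x) (V x) > 0" if "x \<in> W" for x
      using pos[OF that, of "V x"] Vj[OF that] by force
    have smV: "smooth_on W V"
      unfolding V_def
      by (intro smooth_on_diff smooth_on_sum smooth_on_scaleR smooth_on_gram_form smooth_on_const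
          assms sm)
    define D where "D x = (1 / sqrt (?q x (V x) (V x))) *\<^sub>R V x" for x
    have smD: "smooth_on W D"
      unfolding D_def
      by (intro smooth_on_scaleR smooth_on_inverse_sqrt smooth_on_gram_form assms smV Vpos)
    have DD: "?q x (D x) (D x) = 1" if "x \<in> W" for x
    proof -
      have "?q x (D x) (D x) = (1 / sqrt (?q x (V x) (V x))) * ((1 / sqrt (?q x (V x) (V x))) * ?q x (V x) (V x))"
        unfolding D_def
        by (simp only: linear_scale[OF lin] comm[of x "V x" "(1 / sqrt (?q x (V x) (V x))) *\<^sub>R V x"] real_scaleR_def)
      then show ?thesis using Vpos[OF that] by (simp add: field_simps)
    qed
    have DC: "?q x (D x) (C i x) = 0" if "x \<in> W" "i \<in> I" for x i
      unfolding D_def using qV[OF that] by (simp add: linear_scale[OF lin])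
    show ?case
    proof (intro exI[of _ "C(j := D)"] conjI ballI allI impI)
      show "smooth_on W ((C(j := D)) i)" if "i \<in> insert j I" for i
        using that sm[of i] smD by (cases "i = j") simp_all
      show "?q x ((C(j := D)) i x) ((C(j := D)) k x) = (if i = k then 1 else 0)"
        if H: "x \<in> W" "i \<in> insert j I" "k \<in> insert j I" for x i k
      proof -
        consider "i = j" "k = j" | "i = j" "k \<in> I" "k \<noteq> j" | "i \<in> I" "k = j" "i \<noteq> j"
          | "i \<in> I" "k \<in> I" "i \<noteq> j" "k \<noteq> j"
          using H(2,3) by blast
        then show ?thesis
        proof cases
          case 3
          then show ?thesis using DC[OF \<open>x \<in> W\<close>, of i] comm[of x "C i x" "D x"] by simp
        qed (use DD[OF \<open>x \<in> W\<close>] DC[OF \<open>x \<in> W\<close>, of k] orth[OF \<open>x \<in> W\<close>, of i k] in simp_all)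
      qed
      show "(C(j := D)) i x $ k = 0" if "x \<in> W" "i \<in> insert j I" "k \<notin> insert j I" for x i k
        using that supp[of x i k] Vk[of x k] by (cases "i = j") (simp_all add: D_def)
    qed
  qed
  from this[OF finite[of UNIV]] obtain C :: "'i \<Rightarrow> 'a \<Rightarrow> real^'i" where
    "\<forall>i\<in>UNIV. smooth_on W (C i)"
    "\<forall>x\<in>W. \<forall>i\<in>UNIV. \<forall>j\<in>UNIV. gram_form (g x) (C i x) (C j x) = (if i = j then 1 else 0)"
    by blast
  then show thesis by (intro that[of C]) blast+
qed

text \<open>Pairing with \<open>C j\<close> recovers the coordinate \<open>a $ j\<close>, so the map
  from coordinates to vectors is injective, and onto by equality of dimensions.\<close>

lemma orthonormal_expansion:
  fixes C :: "'i::finite \<Rightarrow> real^'i"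
  assumes lin: "\<And>w. linear (\<lambda>v. q v w)"
    and orth: "\<And>i j. q (C i) (C j) = (if i = j then 1 else 0 :: real)"
  shows "v = (\<Sum>i\<in>UNIV. q v (C i) *\<^sub>R C i)"
proof -
  define L where "L a = (\<Sum>i\<in>UNIV. (a $ i) *\<^sub>R C i)" for a :: "real^'i"
  have L: "linear L" unfolding L_def
    by (rule linearI) (simp_all add: sum.distrib algebra_simps scaleR_sum_right)
  have qL: "q (L a) (C j) = a $ j" for a j
  proof -
    have "q (L a) (C j) = (\<Sum>i\<in>UNIV. a $ i * q (C i) (C j))"
      unfolding L_def by (simp add: linear_sum[OF lin] linear_scale[OF lin])
    also have "\<dots> = (\<Sum>i\<in>UNIV. if i = j then a $ j else 0)"
      by (rule sum.cong) (auto simp: orth)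
    finally show ?thesis by simp
  qed
  have "inj L"
  proof (rule injI)
    fix a b assume "L a = L b"
    then have "a $ j = b $ j" for j using qL[of a j] qL[of b j] by simp
    then show "a = b" by (simp add: vec_eq_iff)
  qed
  then obtain a where a: "v = L a"
    using surjD[OF linear_injective_imp_surjective[OF L]] by blast
  then have "q v (C i) = a $ i" for i using qL by simp
  then show ?thesis using a by (simp add: L_def)
qed

text \<open>This gives a meaning to the definite description in \<open>mean_curvature\<close>. One
  slot is expanded in the second basis; after exchanging the sums, the same coefficients expand the
  second basis in the first.\<close>

lemma trace_orthonormal_independent:
  fixes C C' :: "'i::finite \<Rightarrow> real^'i" and B :: "real^'i \<Rightarrow> real^'i \<Rightarrow> 'b::real_vector"
  assumes lin: "\<And>w. linear (\<lambda>v. q v w)" and comm: "\<And>v w. q v w = q w v"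
    and orth: "\<And>i j. q (C i) (C j) = (if i = j then 1 else 0 :: real)"
    and orth': "\<And>i j. q (C' i) (C' j) = (if i = j then 1 else 0 :: real)"
    and B: "\<And>w. linear (\<lambda>v. B v w)" "\<And>v. linear (B v)"
  shows "(\<Sum>i\<in>UNIV. B (C i) (C i)) = (\<Sum>i\<in>UNIV. B (C' i) (C' i))"
proof -
  have "(\<Sum>i\<in>UNIV. B (C i) (C i)) = (\<Sum>i\<in>UNIV. B (C i) (\<Sum>j\<in>UNIV. q (C i) (C' j) *\<^sub>R C' j))"
    using orthonormal_expansion[OF lin orth'] by simp
  also have "\<dots> = (\<Sum>i\<in>UNIV. \<Sum>j\<in>UNIV. q (C' j) (C i) *\<^sub>R B (C i) (C' j))"
    by (simp add: linear_sum[OF B(2)] linear_scale[OF B(2)] comm)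
  also have "\<dots> = (\<Sum>j\<in>UNIV. \<Sum>i\<in>UNIV. q (C' j) (C i) *\<^sub>R B (C i) (C' j))"
    by (rule sum.swap)
  also have "\<dots> = (\<Sum>j\<in>UNIV. B (\<Sum>i\<in>UNIV. q (C' j) (C i) *\<^sub>R C i) (C' j))"
    by (simp add: linear_sum[OF B(1)] linear_scale[OF B(1)])
  also have "\<dots> = (\<Sum>j\<in>UNIV. B (C' j) (C' j))"
    using orthonormal_expansion[OF lin orth] by simp
  finally show ?thesis .
qed

text \<open>The correction is quadratic in \<open>A\<close>: for the differential of the height it has derivative \<open>0\<close>
  at a point where \<open>A\<close> vanishes.\<close>

lemma trace_standard_basis:
  fixes C :: "'i::finite \<Rightarrow> real^'i" and B :: "real^'i \<Rightarrow> real^'i \<Rightarrow> 'b::real_vector"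
    and A :: "real^'i \<Rightarrow> 'c::real_inner"
  assumes A: "linear A"
    and orth: "\<And>i j. C i \<bullet> C j - A (C i) \<bullet> A (C j) = (if i = j then 1 else 0 :: real)"
    and B: "\<And>w. linear (\<lambda>v. B v w)" "\<And>v. linear (B v)"
  shows "(\<Sum>k\<in>UNIV. B (axis k 1) (axis k 1)) = (\<Sum>i\<in>UNIV. B (C i) (C i))
    - (\<Sum>i\<in>UNIV. \<Sum>k\<in>UNIV. (A (axis k 1) \<bullet> A (C i)) *\<^sub>R B (C i) (axis k 1))"
proof -
  define q where "q v w = v \<bullet> w - A v \<bullet> A w" for v w
  have lin: "linear (\<lambda>v. q v w)" for w
    by (rule linearI)
      (simp_all add: q_def linear_add[OF A] linear_scale[OF A] inner_add_left algebra_simps)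
  have exp: "v = (\<Sum>i\<in>UNIV. q v (C i) *\<^sub>R C i)" for v
    by (rule orthonormal_expansion[of q C, OF lin]) (simp add: q_def orth)
  have basis: "v = (\<Sum>k\<in>UNIV. (axis k 1 \<bullet> v) *\<^sub>R axis k 1)" for v :: "real^'i"
    using basis_expansion[of v] by (simp add: inner_axis' scalar_mult_eq_scaleR)
  have "(\<Sum>k\<in>UNIV. B (axis k 1) (axis k 1))
      = (\<Sum>k\<in>UNIV. B (\<Sum>i\<in>UNIV. q (axis k 1) (C i) *\<^sub>R C i) (axis k 1))"
    by (simp only: exp[symmetric])
  also have "\<dots> = (\<Sum>k\<in>UNIV. \<Sum>i\<in>UNIV. q (axis k 1) (C i) *\<^sub>R B (C i) (axis k 1))"
    by (simp add: linear_sum[OF B(1)] linear_scale[OF B(1)])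
  also have "\<dots> = (\<Sum>i\<in>UNIV. \<Sum>k\<in>UNIV. q (axis k 1) (C i) *\<^sub>R B (C i) (axis k 1))"
    by (rule sum.swap)
  also have "\<dots> = (\<Sum>i\<in>UNIV. \<Sum>k\<in>UNIV. (axis k 1 \<bullet> C i) *\<^sub>R B (C i) (axis k 1))
      - (\<Sum>i\<in>UNIV. \<Sum>k\<in>UNIV. (A (axis k 1) \<bullet> A (C i)) *\<^sub>R B (C i) (axis k 1))"
    by (simp add: q_def scaleR_left_diff_distrib sum_subtractf)
  also have "(\<Sum>i\<in>UNIV. \<Sum>k\<in>UNIV. (axis k 1 \<bullet> C i) *\<^sub>R B (C i) (axis k 1))
      = (\<Sum>i\<in>UNIV. B (C i) (\<Sum>k\<in>UNIV. (axis k 1 \<bullet> C i) *\<^sub>R axis k 1))"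
    by (simp add: linear_sum[OF B(2)] linear_scale[OF B(2)])
  also have "\<dots> = (\<Sum>i\<in>UNIV. B (C i) (C i))"
    using basis by simp
  finally show ?thesis .
qed

section \<open>Smoothness of local inverses\<close>

lemma linear_expand_axis:
  fixes A :: "real^'i \<Rightarrow> 'c::real_vector"
  assumes "linear A"
  shows "A v = (\<Sum>k\<in>UNIV. v $ k *\<^sub>R A (axis k 1))"
proof -
  have "A v = A (\<Sum>k\<in>UNIV. v $ k *\<^sub>R axis k 1)"
    using basis_expansion[of v] by (simp add: scalar_mult_eq_scaleR)
  then show ?thesis by (simp add: linear_sum[OF assms] linear_scale[OF assms])
qed

lemma gram_form_eq_inner:
  fixes A :: "real^'i \<Rightarrow> 'c::real_inner"
  assumes "linear A"
  shows "gram_form (\<lambda>k l. A (axis k 1) \<bullet> A (axis l 1)) v w = A v \<bullet> A w"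
  unfolding gram_form_def linear_expand_axis[OF assms, of v] linear_expand_axis[OF assms, of w]
    inner_sum_left
  by (simp add: inner_sum_right sum_distrib_left ac_simps)

text \<open>The inverse of the derivative is written with an orthonormalised basis for \<open>|Df v|\<^sup>2\<close>, which shows
  that it depends smoothly on the point.\<close>

lemma smooth_local_inverse:
  fixes f :: "real^'n::finite \<Rightarrow> real^'n"
  assumes W: "open W" "u0 \<in> W" and sm: "smooth_on W f"
    and inj: "\<And>u v. u \<in> W \<Longrightarrow> dd v f u = 0 \<Longrightarrow> v = 0"
  obtains U V g where "open U" "U \<subseteq> W" "u0 \<in> U" "open V" "homeomorphism U V f g" "smooth_on V g"
proof -
  have df: "f differentiable (at u)" if "u \<in> W" for u
    using sm smooth_on_differentiable that by blast
  have lin: "linear (\<lambda>v. dd v f u)" if "u \<in> W" for u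
    using linear_dd df that by blast
  \<comment> \<open>The inverse function theorem asks for a derivative that is continuous as a map
    into bounded linear maps; in finite dimension this follows from continuity in each
    direction.\<close>
  define f' where "f' u = Blinfun (\<lambda>v. dd v f u)" for u
  have f': "blinfun_apply (f' u) v = dd v f u" if "u \<in> W" for u v
    using lin[OF that] bounded_linear_Blinfun_apply linear_conv_bounded_linear unfolding f'_def by metis
  have "continuous_on W f'"
  proof (rule continuous_on_blinfun_componentwise)
    fix i :: "real^'n"
    have "continuous_on W (\<lambda>u. dd i f u)"
      using smooth_on_continuous_on[OF smooth_on_dd[OF sm]] .
    then show "continuous_on W (\<lambda>u. blinfun_apply (f' u) i)"
      using f' continuous_on_cong by (metis (no_types, lifting))
  qed
  moreover obtain h where h: "linear h" "\<And>v. h (dd v f u0) = v"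
    using linear_injective_left_inverse[OF lin[OF W(2)]] inj[OF W(2)] lin[OF W(2)]
    by (auto simp: linear_injective_0 fun_eq_iff)
  then have "Blinfun h o\<^sub>L f' u0 = id_blinfun"
    by (intro blinfun_eqI)
      (simp add: f'[OF W(2)] bounded_linear_Blinfun_apply linear_conv_bounded_linear[symmetric])
  moreover have "(f has_derivative blinfun_apply (f' u)) (at u)" if "u \<in> W" for u
    using has_derivative_dd[OF df[OF that]] f'[OF that] by presburger
  ultimately obtain U V g g' where U: "open U" "U \<subseteq> W" "u0 \<in> U" "open V" "homeomorphism U V f g"
    and g': "\<And>y. y \<in> V \<Longrightarrow> (g has_derivative (g' y)) (at y)"
      "\<And>y. y \<in> V \<Longrightarrow> g' y = inv (blinfun_apply (f'(g y)))"
      "\<And>y. y \<in> V \<Longrightarrow> bij (blinfun_apply (f'(g y)))"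
    using inverse_function_theorem[OF W(1) _ _ W(2)] by metis
  have gU: "g y \<in> U" if "y \<in> V" for y
    using U(5) that unfolding homeomorphism_def by blast
  obtain C :: "'n \<Rightarrow> real^'n \<Rightarrow> real^'n" where C: "\<And>i. smooth_on W (C i)"
    and orth: "\<And>u i j. u \<in> W \<Longrightarrow> gram_form (\<lambda>k l. dd (axis k 1) f u \<bullet> dd (axis l 1) f u) (C i u) (C j u)
        = (if i = j then 1 else 0)"
  proof (rule smooth_gram_schmidt[OF W(1), of "\<lambda>u k l. dd (axis k 1) f u \<bullet> dd (axis l 1) f u"])
    show "smooth_on W (\<lambda>u. dd (axis k 1) f u \<bullet> dd (axis l 1) f u)" for k l
      by (intro smooth_on_inner smooth_on_dd W sm)
    show "0 < gram_form (\<lambda>k l. dd (axis k 1) f u \<bullet> dd (axis l 1) f u) v v"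
      if "u \<in> W" "v \<noteq> 0" for u v
      using inj[OF that(1)] that(2) by (auto simp: gram_form_eq_inner[OF lin[OF that(1)]])
  qed (auto simp: inner_commute)
  \<comment> \<open>The solution \<open>v\<close> of \<open>dd v f u = w\<close>, expanded in the
    basis \<open>C i u\<close>: its coefficients pair \<open>dd v f u\<close> with
    \<open>dd (C i u) f u\<close>, and the first of these is the known vector
    \<open>w\<close>.\<close>
  define G where "G w u = (\<Sum>i\<in>UNIV. (w \<bullet> (\<Sum>k\<in>UNIV. C i u $ k *\<^sub>R dd (axis k 1) f u)) *\<^sub>R C i u)" for w u
  have G: "smooth_on W (G w)" for w
    unfolding G_def
    by (intro smooth_on_sum smooth_on_scaleR smooth_on_inner smooth_on_const smooth_on_nth smooth_on_dd W C sm)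
  have g'G: "g' y w = G w (g y)" if "y \<in> V" for y w
  proof -
    let ?u = "g y"
    have u: "?u \<in> W" using gU[OF that] U(2) by blast
    have "blinfun_apply (f' ?u) (g' y w) = w"
      using g'(2,3)[OF that] by (simp add: bij_is_surj surj_f_inv_f)
    then have w: "dd (g' y w) f ?u = w"
      using f'[OF u] by simp
    have "g' y w = (\<Sum>i\<in>UNIV. (dd (g' y w) f ?u \<bullet> dd (C i ?u) f ?u) *\<^sub>R C i ?u)"
    proof (rule orthonormal_expansion[of "\<lambda>v w. dd v f ?u \<bullet> dd w f ?u"])
      show "linear (\<lambda>v. dd v f ?u \<bullet> dd w f ?u)" for w
        by (rule linearI) (simp_all add: linear_add[OF lin[OF u]] linear_scale[OF lin[OF u]] inner_add_left)
      show "dd (C i ?u) f ?u \<bullet> dd (C j ?u) f ?u = (if i = j then 1 else 0)" for i j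
        using orth[OF u, of i j] by (simp add: gram_form_eq_inner[OF lin[OF u]])
    qed
    moreover have "dd (C i ?u) f ?u = (\<Sum>k\<in>UNIV. C i ?u $ k *\<^sub>R dd (axis k 1) f ?u)" for i
      by (rule linear_expand_axis[OF lin[OF u]])
    ultimately show ?thesis
      by (simp only: G_def w)
  qed
  \<comment> \<open>Bootstrapping: the derivative of \<open>g\<close> is the smooth map
    \<open>G w\<close> composed with \<open>g\<close>, so each degree of regularity of
    \<open>g\<close> yields the next.\<close>
  have "Ck_on k V g" for k
  proof (induction k)
    case 0
    then show ?case using U(5) by (simp add: homeomorphism_def)
  next
    case (Suc k)
    show ?case
    proof (rule Ck_on_SucI[OF U(4) g'(1)])
      fix w
      have "Ck_on k V (\<lambda>y. G w (g y))"
        using Ck_on_compose[OF U(4) W(1) _ _ Suc, of "G w"] G gU U(2) unfolding smooth_on_def by blast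
      then show "Ck_on k V (\<lambda>y. g' y w)"
        using Ck_on_cong[OF U(4), of "\<lambda>y. G w (g y)" "\<lambda>y. g' y w"] g'G by simp
    qed
  qed
  then show thesis
    using that U unfolding smooth_on_def by blast
qed

section \<open>Local graphs over a space-like plane\<close>

lemma dd_linear_compose:
  assumes "linear h" "f differentiable (at x)"
  shows "dd v (\<lambda>x. h (f x)) x = h (dd v f x)"
  using has_derivative_compose[OF has_derivative_dd[OF assms(2)] linear_imp_has_derivative[OF assms(1)]]
  by (rule dd_eq)

lemma dd_param_tangent:
  assumes "open V" "smooth_on V F" "F ` V \<subseteq> M" "x \<in> V"
  shows "dd v F x \<in> tangent_space M (F x)"
proof -
  obtain e where e: "e > 0" "ball x e \<subseteq> V"
    using assms(1,4) open_contains_ball by blast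
  define \<epsilon> where "\<epsilon> = e / (norm v + 1)"
  have pos: "norm v + 1 > 0" by (simp add: add_nonneg_pos)
  have \<epsilon>: "\<epsilon> > 0" using e pos by (simp add: \<epsilon>_def)
  have V: "x + t *\<^sub>R v \<in> V" if "t \<in> {-\<epsilon><..<\<epsilon>}" for t
  proof -
    have "norm (t *\<^sub>R v) \<le> \<bar>t\<bar> * (norm v + 1)" by (simp add: algebra_simps)
    also have "\<dots> < \<epsilon> * (norm v + 1)" using that pos by (intro mult_strict_right_mono) auto
    also have "\<dots> = e" using pos by (simp add: \<epsilon>_def)
    finally show ?thesis using e(2) by (auto simp: dist_norm subset_iff)
  qed
  have "linear (\<lambda>t. t *\<^sub>R v)" by (rule linearI) (simp_all add: algebra_simps)
  then have line: "smooth_on {-\<epsilon><..<\<epsilon>} (\<lambda>t. x + t *\<^sub>R v)"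
    by (intro smooth_on_add smooth_on_const open_greaterThanLessThan smooth_on_linear)
  have "smooth_on {-\<epsilon><..<\<epsilon>} (\<lambda>t. F (x + t *\<^sub>R v))"
    by (rule smooth_on_compose[OF open_greaterThanLessThan assms(1) _ assms(2) line]) (use V in blast)
  moreover have "((\<lambda>t. F (x + t *\<^sub>R v)) has_vector_derivative dd v F x) (at 0)"
    using has_vector_derivative_along_line[of F x 0 v] smooth_on_differentiable[OF assms(2,4)] by simp
  ultimately show ?thesis
    unfolding tangent_space_def using \<epsilon> V assms(3) by (intro CollectI exI[of _ \<epsilon>] conjI exI) auto
qed

text \<open>Heights are measured with respect to the space-like \<open>n\<close>-plane \<open>S (\<real>\<^sup>n \<times> 0)\<close>, so that the tangent space at
  a chosen point can be made horizontal.\<close>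

locale spacelike_chart =
  fixes M :: "('n::finite, 'm::finite) pseudo_space set"
    and T S :: "('n, 'm) pseudo_space \<Rightarrow> ('n, 'm) pseudo_space"
  assumes spacelike: "spacelike_submanifold M" and closed: "closed M" and zero_mem: "0 \<in> M"
    and linear_T: "linear T" and linear_S: "linear S"
    and TS [simp]: "\<And>v. T (S v) = v" and ST [simp]: "\<And>v. S (T v) = v"
    and isometry: "\<And>v w. pseudo_inner (T v) (T w) = pseudo_inner v w"
begin

definition hor :: "('n, 'm) pseudo_space \<Rightarrow> real^'n" where "hor v = fst (T v)"

definition ver :: "('n, 'm) pseudo_space \<Rightarrow> real^'m" where "ver v = snd (T v)"

lemma linear_hor: "linear hor" and linear_ver: "linear ver"
  by (rule linearI, simp_all only: hor_def ver_def linear_add[OF linear_T] linear_scale[OF linear_T]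
      fst_add snd_add fst_scaleR snd_scaleR)+

lemma S_hor_ver: "S (hor v, ver v) = v"
  by (simp add: hor_def ver_def)

lemma pseudo_inner_hor_ver: "pseudo_inner v w = hor v \<bullet> hor w - ver v \<bullet> ver w"
  using isometry[of v w] by (simp add: pseudo_inner_def hor_def ver_def)

lemma tangent_ver_less_hor:
  assumes "p \<in> M" "v \<in> tangent_space M p" "v \<noteq> 0"
  shows "norm (ver v) < norm (hor v)"
proof -
  have "pseudo_inner v v > 0"
    using assms spacelike unfolding spacelike_submanifold_def by blast
  then show ?thesis
    by (simp add: pseudo_inner_hor_ver norm_lt)
qed

text \<open>A nonzero tangent vector is longer horizontally than vertically, so its horizontal part
  is nonzero. The horizontal projection of a parametrisation thus has injective derivative, and its
  local inverse reparametrises \<open>M\<close> by the horizontal coordinate.\<close>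

lemma local_graph:
  assumes "p \<in> M"
  obtains U V F where "open U" "p \<in> U" "open V" "smooth_on V F" "F ` V = M \<inter> U"
    "\<And>x. x \<in> V \<Longrightarrow> hor (F x) = x"
proof -
  obtain U W \<phi> \<psi> where U: "open U" "p \<in> U" and W: "open W" "smooth_on W (\<phi> :: real^'n \<Rightarrow> ('n, 'm) pseudo_space)"
    and inj: "\<forall>u\<in>W. inj (frechet_derivative \<phi> (at u))" and hom: "homeomorphism W (M \<inter> U) \<phi> \<psi>"
    using spacelike assms unfolding spacelike_submanifold_def smooth_submanifold_def by metis
  have \<phi>M: "\<phi> ` W \<subseteq> M" using hom unfolding homeomorphism_def by blast
  have u0: "\<psi> p \<in> W" using hom U(2) assms unfolding homeomorphism_def by blast
  have d\<phi>: "\<phi> differentiable (at u)" if "u \<in> W" for u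
    using W(2) smooth_on_differentiable that by blast
  define f where "f u = hor (\<phi> u)" for u
  have "smooth_on W f"
    unfolding f_def by (rule smooth_on_linear_compose[OF linear_hor W])
  moreover have "v = 0" if "u \<in> W" "dd v f u = 0" for u v
  proof -
    have "hor (dd v \<phi> u) = 0"
      using that(2) dd_linear_compose[OF linear_hor d\<phi>[OF that(1)]] by (simp add: f_def[abs_def])
    then have "dd v \<phi> u = 0"
      using tangent_ver_less_hor[of "\<phi> u" "dd v \<phi> u"] dd_param_tangent[OF W \<phi>M that(1), of v]
        \<phi>M that(1) by (metis image_subset_iff norm_zero not_less norm_ge_zero)
    moreover have "dd 0 \<phi> u = 0" using linear_0[OF linear_dd[OF d\<phi>[OF that(1)]]] .
    ultimately show "v = 0"
      using inj that(1) unfolding dd_def by (metis injD)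
  qed
  ultimately obtain U' V g where U': "open U'" "U' \<subseteq> W" "\<psi> p \<in> U'" and V: "open V" "smooth_on V g"
    and hom': "homeomorphism U' V f g"
    using smooth_local_inverse[OF W(1) u0] by metis
  \<comment> \<open>The reduced parameter domain must still cover all of \<open>M\<close> inside
    some ambient open set; otherwise other sheets of \<open>M\<close> could enter the neighbourhood
    and the projection would not be injective there.\<close>
  have "openin (top_of_set (M \<inter> U)) (\<phi> ` U')"
    using homeomorphism_imp_open_map[OF hom] U'(1,2) W(1) by (simp add: openin_open_eq)
  then obtain U0 where U0: "open U0" "\<phi> ` U' = M \<inter> U \<inter> U0"
    by (metis openin_open)
  have gV: "g ` V = U'" "\<And>y. y \<in> V \<Longrightarrow> f (g y) = y"
    using hom' unfolding homeomorphism_def by auto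
  show thesis
  proof (rule that)
    show "open (U \<inter> U0)" using U U0 by blast
    show "p \<in> U \<inter> U0"
      using U U0(2) U'(3) hom assms unfolding homeomorphism_def by (metis IntD2 IntI image_eqI)
    show "smooth_on V (\<lambda>y. \<phi> (g y))"
      by (rule smooth_on_compose[OF V(1) W(1) _ W(2) V(2)]) (use gV U' in auto)
    show "(\<lambda>y. \<phi> (g y)) ` V = M \<inter> (U \<inter> U0)"
      using gV(1) U0(2) by (metis Int_assoc image_image)
  qed (use gV V f_def in auto)
qed

end

section \<open>Closed space-like submanifolds as entire graphs\<close>

text \<open>If every neighbourhood failed, there would be pairs of distinct points with equal
  images, ever closer to \<open>K\<close>. Along a subsequence both members converge in
  \<open>K\<close>; injectivity on \<open>K\<close> makes the limits coincide, and local injectivity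
  at the limit excludes such pairs.\<close>

lemma inj_on_near_compact:
  fixes h :: "'a::metric_space \<Rightarrow> 'b::t2_space"
  assumes "compact K" "K \<subseteq> M" "continuous_on M h" "inj_on h K"
    and loc: "\<And>p. p \<in> M \<Longrightarrow> \<exists>U. open U \<and> p \<in> U \<and> inj_on h (M \<inter> U)"
  obtains \<delta> where "\<delta> > 0" "inj_on h (M \<inter> (\<Union>q\<in>K. ball q \<delta>))"
proof (rule ccontr)
  assume no: "\<not> thesis"
  have "\<exists>p q a b. p \<in> M \<and> q \<in> M \<and> p \<noteq> q \<and> h p = h q \<and> a \<in> K \<and> b \<in> K \<and>
      dist a p < inverse (real (Suc k)) \<and> dist b q < inverse (real (Suc k))" for k
  proof -
    have "\<not> inj_on h (M \<inter> (\<Union>q\<in>K. ball q (inverse (real (Suc k)))))"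
      using no that[of "inverse (real (Suc k))"] by auto
    then obtain p q where "p \<in> M \<inter> (\<Union>q\<in>K. ball q (inverse (real (Suc k))))"
      "q \<in> M \<inter> (\<Union>q\<in>K. ball q (inverse (real (Suc k))))" "h p = h q" "p \<noteq> q"
      unfolding inj_on_def by blast
    moreover from this obtain a b where "a \<in> K" "b \<in> K" "p \<in> ball a (inverse (real (Suc k)))"
      "q \<in> ball b (inverse (real (Suc k)))" by blast
    ultimately show ?thesis unfolding mem_ball by blast
  qed
  then obtain p q a b where pq: "\<And>k. p k \<in> M" "\<And>k. q k \<in> M" "\<And>k. p k \<noteq> q k" "\<And>k. h (p k) = h (q k)"
    and ab: "\<And>k. a k \<in> K" "\<And>k. b k \<in> K"
    and d: "\<And>k. dist (a k) (p k) < inverse (real (Suc k))" "\<And>k. dist (b k) (q k) < inverse (real (Suc k))"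
    by metis
  have "compact (K \<times> K)" using assms(1) compact_Times by blast
  moreover have "\<forall>k. (a k, b k) \<in> K \<times> K" using ab by auto
  ultimately obtain l r where l: "l \<in> K \<times> K" and r: "strict_mono r" "((\<lambda>k. (a k, b k)) \<circ> r) \<longlonglongrightarrow> l"
    unfolding compact_def by (metis (mono_tags, lifting))
  obtain a' b' where l': "l = (a', b')" by (cases l)
  have lim: "(\<lambda>k. a (r k)) \<longlonglongrightarrow> a'" "(\<lambda>k. b (r k)) \<longlonglongrightarrow> b'"
    using tendsto_fst[OF r(2)] tendsto_snd[OF r(2)] by (simp_all add: l' o_def)
  have inv0: "(\<lambda>k. inverse (real (Suc (r k)))) \<longlonglongrightarrow> 0"
    using LIMSEQ_subseq_LIMSEQ[OF LIMSEQ_inverse_real_of_nat r(1)] by (simp add: o_def)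
  have near: "(\<lambda>k. y (r k)) \<longlonglongrightarrow> x'"
    if "(\<lambda>k. x (r k)) \<longlonglongrightarrow> x'" "\<And>k. dist (x k) (y k) < inverse (real (Suc k))" for x y :: "nat \<Rightarrow> 'a" and x'
  proof (rule metric_LIMSEQ_I)
    fix e :: real assume "e > 0"
    then have "\<forall>\<^sub>F k in sequentially. dist (x (r k)) x' < e/2" "\<forall>\<^sub>F k in sequentially. inverse (real (Suc (r k))) < e/2"
      using tendstoD[OF that(1), of "e/2"] order_tendstoD(2)[OF inv0, of "e/2"] by auto
    then have "\<forall>\<^sub>F k in sequentially. dist (y (r k)) x' < e"
    proof eventually_elim
      case (elim k)
      then show ?case
        using that(2)[of "r k"] dist_triangle[of "y (r k)" x' "x (r k)"] by (simp add: dist_commute)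
    qed
    then show "\<exists>no. \<forall>n\<ge>no. dist (y (r n)) x' < e" unfolding eventually_sequentially .
  qed
  have plim: "(\<lambda>k. p (r k)) \<longlonglongrightarrow> a'" and qlim: "(\<lambda>k. q (r k)) \<longlonglongrightarrow> b'"
    using near[OF lim(1) d(1)] near[OF lim(2) d(2)] by auto
  have "a' \<in> K" "b' \<in> K" using l l' by auto
  then have aM: "a' \<in> M" "b' \<in> M" using assms(2) by auto
  have "(\<lambda>k. h (p (r k))) \<longlonglongrightarrow> h a'" "(\<lambda>k. h (q (r k))) \<longlonglongrightarrow> h b'"
    using continuous_on_tendsto_compose[OF assms(3) plim aM(1)] continuous_on_tendsto_compose[OF assms(3) qlim aM(2)]
      pq by auto
  then have "h a' = h b'" using pq(4) LIMSEQ_unique by auto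
  then have "a' = b'" using assms(4) \<open>a' \<in> K\<close> \<open>b' \<in> K\<close> by (auto dest: inj_onD)
  obtain U where U: "open U" "a' \<in> U" "inj_on h (M \<inter> U)" using loc[OF aM(1)] by blast
  have "\<forall>\<^sub>F k in sequentially. p (r k) \<in> U" "\<forall>\<^sub>F k in sequentially. q (r k) \<in> U"
    using topological_tendstoD[OF plim U(1,2)] topological_tendstoD[OF qlim U(1)] U(2) \<open>a' = b'\<close> by auto
  then have "\<forall>\<^sub>F k in sequentially. p (r k) \<in> U \<and> q (r k) \<in> U" by (rule eventually_conj)
  then obtain k where "p (r k) \<in> U" "q (r k) \<in> U"
    unfolding eventually_sequentially by blast
  then show False
    using inj_onD[OF U(3) pq(4)[of "r k"]] pq(1,2,3) by blast
qed

context spacelike_chart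
begin

lemma continuous_on_hor: "continuous_on A hor"
  using linear_hor linear_continuous_on linear_conv_bounded_linear by blast

lemma hor_0: "hor 0 = 0"
  using linear_0[OF linear_hor] .

text \<open>Only continuity is asked for, so that limits and inverses of projections qualify
  directly; over open sets smoothness follows by comparison with local graphs.\<close>

definition is_section :: "(real^'n) set \<Rightarrow> (real^'n \<Rightarrow> ('n, 'm) pseudo_space) \<Rightarrow> bool" where
  "is_section W g \<longleftrightarrow> continuous_on W g \<and> (\<forall>x\<in>W. g x \<in> M \<and> hor (g x) = x)"

lemma is_sectionI_local:
  assumes "open W" "\<And>x. x \<in> W \<Longrightarrow> g x \<in> M \<and> hor (g x) = x"
    and "\<And>x. x \<in> W \<Longrightarrow> \<exists>N F. open N \<and> x \<in> N \<and> continuous_on N F \<and> (\<forall>y\<in>N. g y = F y)"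
  shows "is_section W g"
proof -
  have "isCont g x" if x: "x \<in> W" for x
  proof -
    obtain N F where N: "open N" "x \<in> N" "continuous_on N F" "\<forall>y\<in>N. g y = F y"
      using assms(3)[OF x] by blast
    then have "continuous_on N g" by (simp cong: continuous_on_cong)
    then show ?thesis using N(1,2) continuous_on_eq_continuous_at by blast
  qed
  then show ?thesis
    using assms(2) by (auto simp: is_section_def intro: continuous_at_imp_continuous_on)
qed

text \<open>By continuity \<open>g\<close> stays in \<open>U\<close> near \<open>x\<close>, and a
  point of \<open>M \<inter> U\<close> is determined by its horizontal part, so \<open>g\<close>
  must coincide with the local graph \<open>F\<close>.\<close>

lemma section_local:
  assumes "open W" "is_section W g" "x \<in> W"
  obtains N F U V where "open N" "x \<in> N" "N \<subseteq> W" "N \<subseteq> V" "\<And>y. y \<in> N \<Longrightarrow> g y = F y"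
    "open U" "g x \<in> U" "open V" "smooth_on V F" "F ` V = M \<inter> U" "\<And>y. y \<in> V \<Longrightarrow> hor (F y) = y"
proof -
  have gx: "g x \<in> M" using assms by (simp add: is_section_def)
  obtain U V F where U: "open U" "g x \<in> U" "open V" "smooth_on V F" "F ` V = M \<inter> U"
    and F: "\<And>y. y \<in> V \<Longrightarrow> hor (F y) = y"
    using local_graph[OF gx] by metis
  define N where "N = W \<inter> g -` U"
  have "open N" unfolding N_def
    using assms(2) continuous_open_preimage[OF _ assms(1) U(1)] by (simp add: is_section_def)
  moreover have "y \<in> V \<and> g y = F y" if y: "y \<in> N" for y
  proof -
    have "g y \<in> F ` V" using y U(5) assms(2) by (auto simp: N_def is_section_def)
    then obtain y' where y': "y' \<in> V" "g y = F y'" by blast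
    have "y' = y" using F[OF y'(1)] y'(2) y assms(2) by (auto simp: N_def is_section_def)
    then show ?thesis using y' by simp
  qed
  moreover have "x \<in> N" using assms(3) U(2) by (simp add: N_def)
  moreover have "N \<subseteq> W" by (auto simp: N_def)
  ultimately show thesis using that[of N V F U] U F by blast
qed

lemma section_smooth:
  assumes "open W" "is_section W g"
  shows "smooth_on W g"
proof (rule smooth_on_openI)
  fix x assume "x \<in> W"
  then obtain N F U V where N: "open N" "x \<in> N" "N \<subseteq> V" "\<And>y. y \<in> N \<Longrightarrow> g y = F y" "smooth_on V F"
    using section_local[OF assms] by metis
  then have "smooth_on N g"
    using smooth_on_cong[OF N(1), of F g] smooth_on_subset[OF N(5,3)] by simp
  then show "\<exists>T. open T \<and> x \<in> T \<and> smooth_on T g" using N by blast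
qed

text \<open>The set of agreement is closed by continuity and open because near each of its points
  both sections equal the same local graph.\<close>

lemma section_unique:
  assumes "open W" "connected W" "is_section W g" "is_section W g'" "x0 \<in> W" "g x0 = g' x0" "x \<in> W"
  shows "g x = g' x"
proof -
  define A where "A = {x \<in> W. g x - g' x = 0}"
  have "closedin (top_of_set W) A" unfolding A_def
    using assms(3,4) by (intro continuous_closedin_preimage_constant continuous_intros) (auto simp: is_section_def)
  moreover have "open A"
  proof (subst open_subopen, intro ballI)
    fix y assume "y \<in> A"
    then have y: "y \<in> W" "g y = g' y" by (auto simp: A_def)
    obtain N F U V where N: "open N" "y \<in> N" "N \<subseteq> W" "\<And>z. z \<in> N \<Longrightarrow> g z = F z"
      and U: "open U" "g y \<in> U" "F ` V = M \<inter> U" "\<And>z. z \<in> V \<Longrightarrow> hor (F z) = z"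
      using section_local[OF assms(1,3) y(1)] by metis
    define N' where "N' = N \<inter> (W \<inter> g' -` U)"
    have "open N'" unfolding N'_def
      using assms(4) N(1) continuous_open_preimage[OF _ assms(1) U(1)] by (auto simp: is_section_def)
    moreover have "g z = g' z" if z: "z \<in> N'" for z
    proof -
      have "g' z \<in> F ` V" using z U(3) assms(4) by (auto simp: N'_def is_section_def)
      then obtain z' where z': "z' \<in> V" "g' z = F z'" by blast
      have "z' = z" using U(4)[OF z'(1)] z'(2) z assms(4) by (auto simp: N'_def is_section_def)
      then show ?thesis using z' N(4) z by (simp add: N'_def)
    qed
    moreover have "y \<in> N'" using y N(2) U(2) by (auto simp: N'_def)
    moreover have "N' \<subseteq> W" by (auto simp: N'_def)
    ultimately show "\<exists>N. open N \<and> y \<in> N \<and> N \<subseteq> A"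
      unfolding A_def by (intro exI[of _ N']) auto
  qed
  then have "openin (top_of_set W) A"
    using assms(1) by (auto simp: openin_open_eq A_def)
  ultimately have "A = {} \<or> A = W" using assms(2) connected_clopen by blast
  then show ?thesis using assms(5-7) by (auto simp: A_def)
qed

lemma section_derivative:
  assumes "open W" "is_section W g" "x \<in> W"
  shows "dd v g x \<in> tangent_space M (g x)" "hor (dd v g x) = v"
proof -
  have sm: "smooth_on W g" using section_smooth assms by blast
  show "dd v g x \<in> tangent_space M (g x)"
    by (rule dd_param_tangent[OF assms(1) sm _ assms(3)]) (use assms(2) in \<open>auto simp: is_section_def\<close>)
  have "((\<lambda>y. hor (g y)) has_derivative (\<lambda>v. hor (dd v g x))) (at x)"
    using has_derivative_compose[OF has_derivative_dd[OF smooth_on_differentiable[OF sm assms(3)]]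
        linear_imp_has_derivative[OF linear_hor]] .
  then have "((\<lambda>y. y) has_derivative (\<lambda>v. hor (dd v g x))) (at x)"
    by (rule has_derivative_transform_within_open[OF _ assms(1,3)]) (use assms(2) in \<open>auto simp: is_section_def\<close>)
  then have "(\<lambda>v. hor (dd v g x)) = (\<lambda>v. v)"
    using has_derivative_unique has_derivative_ident by blast
  then show "hor (dd v g x) = v" by meson
qed

lemma section_ver_derivative_less:
  assumes "open W" "is_section W g" "x \<in> W" "v \<noteq> 0"
  shows "norm (ver (dd v g x)) < norm v"
proof -
  have "dd v g x \<noteq> 0" using section_derivative(2)[OF assms(1-3), of v] assms(4) hor_0 by metis
  then show ?thesis
    using tangent_ver_less_hor[of "g x" "dd v g x"] section_derivative[OF assms(1-3), of v] assms(2,3)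
    by (auto simp: is_section_def)
qed

text \<open>Space-likeness bounds the slope of the height by 1. This uniform bound is what stops a
  section from escaping or oscillating at the boundary of its ball.\<close>

lemma section_lipschitz:
  assumes "open W" "convex W" "is_section W g" "x \<in> W" "y \<in> W"
  shows "norm (ver (g x) - ver (g y)) \<le> norm (x - y)"
proof -
  have sm: "smooth_on W g" using section_smooth assms by blast
  have "norm (ver (g x) - ver (g y)) \<le> 1 * norm (x - y)"
  proof (rule differentiable_bound[OF assms(2) _ _ assms(4,5)])
    fix z assume z: "z \<in> W"
    show "((\<lambda>y. ver (g y)) has_derivative (\<lambda>v. ver (dd v g z))) (at z within W)"
      using has_derivative_compose[OF has_derivative_dd[OF smooth_on_differentiable[OF sm z]]
          linear_imp_has_derivative[OF linear_ver]] by (rule has_derivative_at_withinI)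
    show "onorm (\<lambda>v. ver (dd v g z)) \<le> 1"
    proof (rule onorm_le)
      show "norm (ver (dd v g z)) \<le> 1 * norm v" for v
        using section_ver_derivative_less[OF assms(1,3) z, of v]
          linear_0[OF linear_dd[OF smooth_on_differentiable[OF sm z]]] linear_0[OF linear_ver]
        by (cases "v = 0") auto
    qed
  qed
  then show ?thesis by simp
qed

text \<open>The Lipschitz bound extends the height to the closed ball, and closedness of
  \<open>M\<close> in the Euclidean topology puts the boundary values on \<open>M\<close>.\<close>

lemma section_extend_closure:
  assumes "R > 0" "is_section (ball 0 R) g"
  obtains g' where "is_section (cball 0 R) g'" "\<And>x. x \<in> ball 0 R \<Longrightarrow> g' x = g x"
proof -
  have "uniformly_continuous_on (ball 0 R) (\<lambda>x. ver (g x))"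
    unfolding uniformly_continuous_on_def dist_norm
    using section_lipschitz[OF open_ball convex_ball assms(2)] by (meson order_le_less_trans)
  then obtain Y where Y: "uniformly_continuous_on (closure (ball 0 R)) Y"
    "\<And>x. x \<in> ball 0 R \<Longrightarrow> ver (g x) = Y x"
    using uniformly_continuous_on_extension_on_closure by metis
  have cl: "closure (ball 0 R) = cball (0::real^'n) R" using assms(1) by simp
  have contY: "continuous_on (closure (ball 0 R)) Y"
    using Y(1) uniformly_continuous_imp_continuous by blast
  have S: "continuous_on A S" for A
    using linear_S linear_continuous_on linear_conv_bounded_linear by blast
  define g' where "g' x = S (x, Y x)" for x
  have cont: "continuous_on (closure (ball 0 R)) g'"
    unfolding g'_def
    by (rule continuous_on_compose2[OF S[of UNIV]]) (auto intro!: continuous_intros contY)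
  have eq: "g' x = g x" if "x \<in> ball 0 R" for x
    using S_hor_ver[of "g x"] assms(2) that Y(2) by (simp add: g'_def is_section_def)
  have "g' ` closure (ball 0 R) \<subseteq> M"
    by (rule image_closure_subset[OF cont closed]) (use eq assms(2) in \<open>auto simp: is_section_def\<close>)
  moreover have "hor (g' x) = x" for x by (simp add: g'_def hor_def)
  ultimately have "is_section (cball 0 R) g'"
    using cont cl by (auto simp: is_section_def)
  then show thesis using that eq by blast
qed

text \<open>Projection is injective on the compact image of the closed ball, hence on a neighbourhood of
  it in \<open>M\<close>; the inverse is the larger section.\<close>

lemma section_extend:
  assumes "R > 0" "is_section (ball 0 R) g" "g 0 = 0"
  obtains R' g' where "R' > R" "is_section (ball 0 R') g'" "g' 0 = 0"
proof -
  obtain g1 where g1: "is_section (cball 0 R) g1" "\<And>x. x \<in> ball 0 R \<Longrightarrow> g1 x = g x"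
    using section_extend_closure[OF assms(1,2)] by metis
  define K where "K = g1 ` cball 0 R"
  have K: "compact K" "K \<subseteq> M" "inj_on hor K" "hor ` K = cball 0 R"
    using g1(1) by (auto simp: K_def is_section_def inj_on_def image_image intro!: compact_continuous_image)
  have "0 \<in> K" using assms(1,3) g1(2)[of 0] unfolding K_def by (intro image_eqI[of _ _ 0]) auto
  have "\<exists>U. open U \<and> p \<in> U \<and> inj_on hor (M \<inter> U)" if p: "p \<in> M" for p
  proof -
    obtain U V F where U: "open U" "p \<in> U" "F ` V = M \<inter> U" "\<And>y. y \<in> V \<Longrightarrow> hor (F y) = y"
      using local_graph[OF p] by metis
    have "F (hor q) = q" if "q \<in> M \<inter> U" for q
    proof -
      obtain y where "y \<in> V" "q = F y" using \<open>q \<in> M \<inter> U\<close> U(3) by blast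
      then show ?thesis using U(4) by simp
    qed
    then show ?thesis using U(1,2) inj_on_inverseI[of "M \<inter> U" F hor] by blast
  qed
  then obtain \<delta> where \<delta>: "\<delta> > 0" "inj_on hor (M \<inter> (\<Union>q\<in>K. ball q \<delta>))"
    using inj_on_near_compact[OF K(1,2) continuous_on_hor K(3)] by metis
  define O' where "O' = (\<Union>q\<in>K. ball q \<delta>)"
  have O': "open O'" "K \<subseteq> O'" "inj_on hor (M \<inter> O')" using \<delta> by (auto simp: O'_def)
  define H where "H = hor ` (M \<inter> O')"
  define s where "s = inv_into (M \<inter> O') hor"
  have s: "s x \<in> M \<inter> O'" "hor (s x) = x" if "x \<in> H" for x
    using that inv_into_into[of x hor "M \<inter> O'"] f_inv_into_f[of x hor "M \<inter> O'"] by (auto simp: H_def s_def)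
  have s': "s (hor p) = p" if "p \<in> M \<inter> O'" for p
    using that O'(3) by (simp add: s_def)
  \<comment> \<open>Where a local graph \<open>F\<close> stays inside \<open>O'\<close>, injectivity
    of the projection forces \<open>s = F\<close>; this yields openness of \<open>H\<close> and
    continuity of \<open>s\<close> together.\<close>
  have loc: "\<exists>N F. open N \<and> x \<in> N \<and> N \<subseteq> H \<and> continuous_on N F \<and> (\<forall>y\<in>N. s y = F y)" if x: "x \<in> H" for x
  proof -
    have sx: "s x \<in> M" "s x \<in> O'" using s[OF x] by auto
    obtain U V F where U: "open U" "s x \<in> U" "open V" "smooth_on V F" "F ` V = M \<inter> U"
      and F: "\<And>y. y \<in> V \<Longrightarrow> hor (F y) = y"
      using local_graph[OF sx(1)] by metis
    define N where "N = V \<inter> F -` O'"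
    have cont: "continuous_on V F" using U(4) smooth_on_continuous_on by blast
    have "open N" unfolding N_def using continuous_open_preimage[OF cont U(3) O'(1)] .
    moreover have "x \<in> N"
    proof -
      obtain x' where x': "x' \<in> V" "s x = F x'" using sx(1) U(2,5) by blast
      then have "x' = x" using F[OF x'(1)] s(2)[OF x] by simp
      then show ?thesis using x' sx(2) by (simp add: N_def)
    qed
    moreover have *: "y \<in> H \<and> s y = F y" if y: "y \<in> N" for y
    proof -
      have "F y \<in> M \<inter> O'" using y U(5) by (auto simp: N_def)
      moreover have "hor (F y) = y" using y F by (simp add: N_def)
      ultimately show ?thesis using s' by (metis H_def image_eqI)
    qed
    moreover have "continuous_on N F" using cont by (rule continuous_on_subset) (auto simp: N_def)
    ultimately show ?thesis by blast
  qed
  then have "open H" by (subst open_subopen) blast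
  then have sec: "is_section H s"
  proof (rule is_sectionI_local)
    fix x assume x: "x \<in> H"
    show "s x \<in> M \<and> hor (s x) = x" using s[OF x] by simp
    show "\<exists>N F. open N \<and> x \<in> N \<and> continuous_on N F \<and> (\<forall>y\<in>N. s y = F y)" using loc[OF x] by blast
  qed
  have "cball 0 R \<subseteq> H"
    unfolding H_def K(4)[symmetric] using K(2) O'(2) by (intro image_mono) blast
  then obtain e where e: "e > 0" "(\<Union>x\<in>cball 0 R. ball x e) \<subseteq> H"
    using compact_subset_open_imp_ball_epsilon_subset[OF compact_cball \<open>open H\<close>] by metis
  have "ball 0 (R + e) \<subseteq> H"
  proof
    fix x :: "real^'n" assume x: "x \<in> ball 0 (R + e)"
    show "x \<in> H"
    proof (cases "norm x \<le> R")
      case True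
      then show ?thesis using \<open>cball 0 R \<subseteq> H\<close> by auto
    next
      case False
      define y where "y = (R / norm x) *\<^sub>R x"
      have "x \<noteq> 0" using False assms(1) by auto
      then have "norm y = R" using assms(1) by (simp add: y_def)
      moreover have "dist y x < e"
      proof -
        have "y - x = (R / norm x - 1) *\<^sub>R x" by (simp add: y_def algebra_simps)
        then have "dist y x = \<bar>R / norm x - 1\<bar> * norm x" by (simp add: dist_norm)
        also have "\<dots> = \<bar>(R / norm x - 1) * norm x\<bar>" by (simp add: abs_mult)
        also have "(R / norm x - 1) * norm x = R - norm x"
          using \<open>x \<noteq> 0\<close> by (simp add: left_diff_distrib)
        also have "\<bar>R - norm x\<bar> < e" using False x by simp
        finally show ?thesis .
      qed
      ultimately have "y \<in> cball 0 R" "x \<in> ball y e" by simp_all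
      then show ?thesis using e(2) by blast
    qed
  qed
  then have "is_section (ball 0 (R + e)) s"
    using sec unfolding is_section_def by (auto intro: continuous_on_subset)
  moreover have "s 0 = 0" using s'[of 0] hor_0 \<open>0 \<in> K\<close> O'(2) zero_mem by auto
  ultimately show thesis using that[of "R + e" s] e(1) by simp
qed

lemma section_start:
  obtains R g where "R > 0" "is_section (ball 0 R) g" "g 0 = 0"
proof -
  obtain U V F where U: "open U" "0 \<in> U" "open V" "smooth_on V F" "F ` V = M \<inter> U"
    and F: "\<And>y. y \<in> V \<Longrightarrow> hor (F y) = y"
    using local_graph[OF zero_mem] by metis
  have "0 \<in> F ` V" using U(2,5) zero_mem by simp
  then obtain x where x: "x \<in> V" "F x = 0" by auto
  then have "x = 0" using F[OF x(1)] hor_0 by simp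
  with x obtain R where R: "R > 0" "ball 0 R \<subseteq> V" using U(3) open_contains_ball by blast
  then have "is_section (ball 0 R) F"
    unfolding is_section_def
    using smooth_on_continuous_on[OF U(4)] continuous_on_subset U(5) F by blast
  then show thesis using that R x \<open>x = 0\<close> by blast
qed

text \<open>Continuation in the radius. Sections through the origin agree on the smaller of two
  balls, so the choice of radius in the glued section is immaterial. If the radii were bounded, the
  glued section would live on the ball of radius \<open>Sup \<R>\<close> and extend past it.\<close>

lemma global_section:
  obtains g where "is_section UNIV g" "g 0 = 0"
proof -
  define \<R> where "\<R> = {R. R > 0 \<and> (\<exists>g. is_section (ball 0 R) g \<and> g 0 = 0)}"
  obtain G where G: "\<And>R. R \<in> \<R> \<Longrightarrow> is_section (ball 0 R) (G R) \<and> G R 0 = 0"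
  proof -
    have "\<forall>R\<in>\<R>. \<exists>g. is_section (ball 0 R) g \<and> g 0 = 0" by (simp add: \<R>_def)
    then show thesis using bchoice that by (metis (no_types))
  qed
  define W where "W = (\<Union>R\<in>\<R>. ball (0::real^'n) R)"
  have "\<exists>r. r \<in> \<R> \<and> x \<in> ball 0 r" if "x \<in> W" for x using that by (auto simp: W_def)
  then obtain r where r: "\<And>x. x \<in> W \<Longrightarrow> r x \<in> \<R> \<and> x \<in> ball 0 (r x)" by metis
  define g where "g x = G (r x) x" for x
  have geq: "g x = G R x" if R: "R \<in> \<R>" "x \<in> ball 0 R" for x R
  proof -
    have x: "r x \<in> \<R>" "x \<in> ball 0 (r x)" using r[of x] R by (auto simp: W_def)
    let ?m = "min (r x) R"
    have "is_section (ball 0 ?m) (G (r x))" "is_section (ball 0 ?m) (G R)"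
      using G[OF x(1)] G[OF R(1)] unfolding is_section_def
      by (auto intro: continuous_on_subset)
    then have "G (r x) x = G R x"
      using section_unique[of "ball 0 ?m" "G (r x)" "G R" 0 x] G[OF x(1)] G[OF R(1)] x R
      by (auto simp: \<R>_def)
    then show ?thesis by (simp add: g_def)
  qed
  have "open W" by (auto simp: W_def)
  have gW: "is_section W g"
  proof (rule is_sectionI_local[OF \<open>open W\<close>])
    fix x assume "x \<in> W"
    then have x: "r x \<in> \<R>" "x \<in> ball 0 (r x)" using r by auto
    show "g x \<in> M \<and> hor (g x) = x"
      using G[OF x(1)] x(2) by (simp add: g_def is_section_def)
    show "\<exists>N F. open N \<and> x \<in> N \<and> continuous_on N F \<and> (\<forall>y\<in>N. g y = F y)"
      using G[OF x(1)] x geq by (intro exI[of _ "ball 0 (r x)"] exI[of _ "G (r x)"]) (auto simp: is_section_def)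
  qed
  obtain R0 g0 where R0: "R0 > 0" "is_section (ball 0 R0) g0" "g0 0 = 0" using section_start .
  then have R0': "R0 \<in> \<R>" by (auto simp: \<R>_def)
  have g0: "g 0 = 0" using geq[OF R0', of 0] G[OF R0'] R0(1) by simp
  have "\<not> bdd_above \<R>"
  proof
    assume bdd: "bdd_above \<R>"
    have W: "W = ball 0 (Sup \<R>)"
    proof
      show "W \<subseteq> ball 0 (Sup \<R>)"
        unfolding W_def using cSup_upper[OF _ bdd] by fastforce
      show "ball 0 (Sup \<R>) \<subseteq> W"
      proof
        fix x :: "real^'n" assume "x \<in> ball 0 (Sup \<R>)"
        then obtain R where "R \<in> \<R>" "norm x < R"
          using less_cSup_iff[OF _ bdd] R0' by (metis (no_types, lifting) empty_iff mem_ball_0)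
        then show "x \<in> W" by (auto simp: W_def)
      qed
    qed
    have "Sup \<R> > 0" using cSup_upper[OF R0' bdd] R0(1) by simp
    then obtain R' g' where "R' > Sup \<R>" "is_section (ball 0 R') g'" "g' 0 = 0"
      using section_extend[of "Sup \<R>" g] gW W g0 by metis
    moreover then have "R' \<in> \<R>" using \<open>Sup \<R> > 0\<close> by (auto simp: \<R>_def)
    ultimately show False using cSup_upper[OF _ bdd] by fastforce
  qed
  then have "W = UNIV"
    unfolding W_def bdd_above_def by (auto simp: not_le)
  then show thesis using that gW g0 by blast
qed

text \<open>Connectedness of \<open>M\<close> enters here. The range is closed in \<open>M\<close>
  as the set where \<open>g (hor p) = p\<close>, and open in \<open>M\<close> since near each of its
  points \<open>M\<close> is a single local graph.\<close>

lemma global_section_range: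
  assumes g: "is_section UNIV g"
  shows "M = range g"
proof -
  have gM: "range g \<subseteq> M" using g by (auto simp: is_section_def)
  have cont: "continuous_on UNIV g" using g by (simp add: is_section_def)
  have "range g = {p \<in> M. g (hor p) - p = 0}"
  proof (intro equalityI subsetI)
    show "p \<in> {p \<in> M. g (hor p) - p = 0}" if "p \<in> range g" for p
      using that g by (auto simp: is_section_def)
    show "p \<in> range g" if "p \<in> {p \<in> M. g (hor p) - p = 0}" for p
      using that by (intro image_eqI[of _ _ "hor p"]) auto
  qed
  moreover have "continuous_on M (\<lambda>p. g (hor p) - p)"
    by (intro continuous_intros continuous_on_compose2[OF cont continuous_on_hor]) auto
  ultimately have "closedin (top_of_set M) (range g)"
    using continuous_closedin_preimage_constant[of M "\<lambda>p. g (hor p) - p" 0] by presburger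
  moreover have "openin (top_of_set M) (range g)"
  proof (subst openin_subopen, intro ballI)
    fix p assume "p \<in> range g"
    then obtain x where x: "p = g x" by blast
    obtain N F U V where N: "open N" "x \<in> N" "\<And>z. z \<in> N \<Longrightarrow> g z = F z"
      and U: "open U" "g x \<in> U" "F ` V = M \<inter> U" "\<And>z. z \<in> V \<Longrightarrow> hor (F z) = z"
      using section_local[OF open_UNIV g UNIV_I] by metis
    have "open (U \<inter> hor -` N)"
      using continuous_open_preimage[OF continuous_on_hor U(1) N(1)] .
    then have "openin (top_of_set M) (M \<inter> (U \<inter> hor -` N))" by (rule openin_open_Int)
    moreover have "p \<in> M \<inter> (U \<inter> hor -` N)"
      using x U(2) N(2) g by (auto simp: is_section_def)
    moreover have "M \<inter> (U \<inter> hor -` N) \<subseteq> range g"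
    proof
      fix q assume q: "q \<in> M \<inter> (U \<inter> hor -` N)"
      then obtain z where z: "z \<in> V" "q = F z" using U(3) by blast
      then have "q = g z" using q N(3)[of z] U(4)[of z] by auto
      then show "q \<in> range g" by blast
    qed
    ultimately show "\<exists>A. openin (top_of_set M) A \<and> p \<in> A \<and> A \<subseteq> range g" by blast
  qed
  ultimately have "range g = {} \<or> range g = M"
    using spacelike connected_clopen[of M] unfolding spacelike_submanifold_def by blast
  then show ?thesis by blast
qed

end

section \<open>The self-shrinker equation of a graph\<close>

lemma dd_const: "dd v (\<lambda>x. c) x = 0"
  by (rule dd_eq[OF has_derivative_const])

lemma dd_add:
  assumes "f differentiable (at x)" "g differentiable (at x)"
  shows "dd v (\<lambda>x. f x + g x) x = dd v f x + dd v g x"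
  by (rule dd_eq[OF has_derivative_add[OF has_derivative_dd[OF assms(1)] has_derivative_dd[OF assms(2)]]])

lemma dd_scaleR_const:
  assumes "f differentiable (at x)"
  shows "dd v (\<lambda>x. r *\<^sub>R f x) x = r *\<^sub>R dd v f x"
  by (rule dd_eq[OF has_derivative_scaleR_right[OF has_derivative_dd[OF assms]]])

lemma linear_dd_dd:
  assumes "smooth_on UNIV f"
  shows "linear (\<lambda>w. dd v (dd w f) x)" "linear (\<lambda>v. dd v (dd w f) x)"
proof -
  have df: "f differentiable (at y)" "dd w f differentiable (at y)" for w y
    using smooth_on_differentiable smooth_on_dd assms by blast+
  show "linear (\<lambda>v. dd v (dd w f) x)" using linear_dd df by blast
  have *: "dd (a + b) f = (\<lambda>y. dd a f y + dd b f y)" "dd (r *\<^sub>R a) f = (\<lambda>y. r *\<^sub>R dd a f y)" for a b r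
    using linear_add[OF linear_dd[OF df(1)]] linear_scale[OF linear_dd[OF df(1)]] by (auto simp: fun_eq_iff)
  show "linear (\<lambda>w. dd v (dd w f) x)"
    by (rule linearI) (simp_all only: * dd_add[OF df(2) df(2)] dd_scaleR_const[OF df(2)])
qed

lemma gram_form_diff_inner:
  fixes A :: "real^'i \<Rightarrow> 'c::real_inner"
  assumes "linear A"
  shows "gram_form (\<lambda>k l. (axis k 1 :: real^'i) \<bullet> axis l 1 - A (axis k 1) \<bullet> A (axis l 1)) v w = v \<bullet> w - A v \<bullet> A w"
  using gram_form_eq_inner[OF assms, of v w] gram_form_eq_inner[OF linear_id, of v w]
  by (simp add: gram_form_def algebra_simps sum_subtractf)

context spacelike_chart
begin

section \<open>The height function and its derivatives\<close>

definition graph_map :: "real^'n \<Rightarrow> ('n, 'm) pseudo_space" where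
  "graph_map = (SOME g. is_section UNIV g \<and> g 0 = 0)"

definition height :: "real^'n \<Rightarrow> real^'m" where
  "height x = ver (graph_map x)"

lemma section_graph_map: "is_section UNIV graph_map" and graph_map_0: "graph_map 0 = 0"
proof -
  have "\<exists>g. is_section UNIV g \<and> g 0 = 0" using global_section by blast
  then have "is_section UNIV graph_map \<and> graph_map 0 = 0" unfolding graph_map_def by (rule someI_ex)
  then show "is_section UNIV graph_map" "graph_map 0 = 0" by blast+
qed

lemma M_eq: "M = range graph_map"
  by (rule global_section_range[OF section_graph_map])

lemma graph_map_mem: "graph_map x \<in> M"
  using M_eq by blast

lemma hor_graph_map: "hor (graph_map x) = x"
  using section_graph_map by (simp add: is_section_def)

lemma graph_map_hor: "p \<in> M \<Longrightarrow> graph_map (hor p) = p"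
  using M_eq hor_graph_map by (metis rangeE)

lemma graph_map_eq: "graph_map x = S (x, height x)"
  using S_hor_ver[of "graph_map x"] by (simp add: hor_graph_map height_def)

lemma smooth_graph_map: "smooth_on UNIV graph_map"
  by (rule section_smooth[OF open_UNIV section_graph_map])

lemma differentiable_graph_map: "graph_map differentiable (at x)" "dd v graph_map differentiable (at x)"
  using smooth_on_differentiable smooth_on_dd smooth_graph_map by blast+

lemma smooth_height: "smooth_on UNIV height"
  using smooth_on_linear_compose[OF linear_ver open_UNIV smooth_graph_map] by (simp add: height_def[abs_def])

lemma height_0: "height 0 = 0"
  by (simp add: height_def graph_map_0 linear_0[OF linear_ver])

lemma linear_dd_height: "linear (\<lambda>v. dd v height x)"
  using linear_dd smooth_on_differentiable[OF smooth_height] by blast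

lemma dd_graph_map: "dd v graph_map x = S (v, dd v height x)"
proof -
  have "ver (dd v graph_map x) = dd v height x"
    using dd_linear_compose[OF linear_ver differentiable_graph_map(1), of v x] by (simp add: height_def[abs_def])
  then show ?thesis
    using S_hor_ver[of "dd v graph_map x"] section_derivative(2)[OF open_UNIV section_graph_map UNIV_I, of v x]
    by simp
qed

lemma dd_dd_graph_map: "dd v (dd w graph_map) x = S (0, dd v (dd w height) x)"
proof -
  have "ver (dd v (dd w graph_map) x) = dd v (dd w height) x"
    using dd_linear_compose[OF linear_ver differentiable_graph_map(2), of v w x]
    by (simp add: dd_graph_map[abs_def] ver_def)
  moreover have "hor (dd v (dd w graph_map) x) = 0"
    using dd_linear_compose[OF linear_hor differentiable_graph_map(2), of v w x]
    by (simp add: dd_graph_map[abs_def] hor_def dd_const)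
  ultimately show ?thesis
    using S_hor_ver[of "dd v (dd w graph_map) x"] by simp
qed

lemma dd_height_less: "v \<noteq> 0 \<Longrightarrow> norm (dd v height x) < norm v"
  using section_ver_derivative_less[OF open_UNIV section_graph_map UNIV_I, of v x]
  by (simp add: dd_graph_map ver_def)

lemma pseudo_inner_S: "pseudo_inner (S a) (S b) = pseudo_inner a b"
  using isometry[of "S a" "S b"] by simp

text \<open>For the inclusion from left to right, a curve in \<open>M\<close> is recovered from its
  horizontal part by \<open>graph_map\<close>; differentiating this identity at 0 expresses its
  velocity through the derivative of \<open>graph_map\<close>.\<close>

lemma tangent_space_eq: "tangent_space M (graph_map x) = range (\<lambda>v. S (v, dd v height x))"
proof
  show "range (\<lambda>v. S (v, dd v height x)) \<subseteq> tangent_space M (graph_map x)"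
    using section_derivative(1)[OF open_UNIV section_graph_map UNIV_I, of _ x] by (auto simp: dd_graph_map)
  show "tangent_space M (graph_map x) \<subseteq> range (\<lambda>v. S (v, dd v height x))"
  proof
    fix w assume "w \<in> tangent_space M (graph_map x)"
    then obtain \<epsilon> \<gamma> where e: "\<epsilon> > 0" "\<gamma> ` {-\<epsilon><..<\<epsilon>} \<subseteq> M" "\<gamma> 0 = graph_map x"
      and d: "(\<gamma> has_vector_derivative w) (at 0)"
      unfolding tangent_space_def by blast
    have "(\<gamma> has_derivative (\<lambda>t. t *\<^sub>R w)) (at 0)" using d by (simp add: has_vector_derivative_def)
    moreover have "((\<lambda>t. hor (\<gamma> t)) has_derivative (\<lambda>t. hor (t *\<^sub>R w))) (at 0)"
      using has_derivative_compose[OF calculation linear_imp_has_derivative[OF linear_hor]] .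
    moreover have "graph_map differentiable (at (hor (\<gamma> 0)))" by (rule differentiable_graph_map)
    ultimately have "((\<lambda>t. graph_map (hor (\<gamma> t))) has_derivative (\<lambda>t. dd (hor (t *\<^sub>R w)) graph_map (hor (\<gamma> 0)))) (at 0)"
      using has_derivative_compose[OF _ has_derivative_dd] by blast
    then have "(\<gamma> has_derivative (\<lambda>t. dd (hor (t *\<^sub>R w)) graph_map (hor (\<gamma> 0)))) (at 0)"
    proof (rule has_derivative_transform_within_open[OF _ open_greaterThanLessThan[of "-\<epsilon>" \<epsilon>]])
      show "graph_map (hor (\<gamma> t)) = \<gamma> t" if "t \<in> {-\<epsilon><..<\<epsilon>}" for t
        using graph_map_hor e(2) that by blast
    qed (use e in auto)
    then have "(\<lambda>t. dd (hor (t *\<^sub>R w)) graph_map (hor (\<gamma> 0))) = (\<lambda>t. t *\<^sub>R w)"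
      using d has_derivative_unique unfolding has_vector_derivative_def by blast
    then have "dd (hor (1 *\<^sub>R w)) graph_map (hor (\<gamma> 0)) = 1 *\<^sub>R w" by meson
    then have "w = S (hor w, dd (hor w) height x)"
      by (simp add: e(3) hor_graph_map dd_graph_map)
    then show "w \<in> range (\<lambda>v. S (v, dd v height x))" by blast
  qed
qed

section \<open>Orthogonal decomposition of the ambient space along \<open>M\<close>\<close>

lemma subspace_tangent: "p \<in> M \<Longrightarrow> subspace (tangent_space M p)"
proof -
  assume "p \<in> M"
  then obtain x where x: "p = graph_map x" using M_eq by blast
  have "linear (\<lambda>v. dd v graph_map x)" using linear_dd differentiable_graph_map by blast
  then show ?thesis
    using linear_subspace_image[OF _ subspace_UNIV] x by (auto simp: tangent_space_eq dd_graph_map)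
qed

lemma pseudo_inner_diff_left: "pseudo_inner (a - b) w = pseudo_inner a w - pseudo_inner b w"
  and pseudo_inner_diff_right: "pseudo_inner w (a - b) = pseudo_inner w a - pseudo_inner w b"
  and pseudo_inner_add_right: "pseudo_inner w (a + b) = pseudo_inner w a + pseudo_inner w b"
  and pseudo_inner_scaleR_left: "pseudo_inner (r *\<^sub>R a) w = r * pseudo_inner a w"
  and pseudo_inner_scaleR_right: "pseudo_inner w (r *\<^sub>R a) = r * pseudo_inner w a"
  for a b w :: "('n, 'm) pseudo_space"
  by (simp_all add: pseudo_inner_def inner_diff_left inner_diff_right inner_add_right algebra_simps)

lemma pseudo_inner_commute: "pseudo_inner v w = pseudo_inner w (v :: ('n, 'm) pseudo_space)"
  by (simp add: pseudo_inner_def inner_commute)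

lemma subspace_normal: "subspace (normal_space M p)"
  by (auto simp: subspace_def normal_space_def pseudo_inner_add_right pseudo_inner_scaleR_right)
    (simp add: pseudo_inner_def)

lemma tangent_normal_zero:
  assumes "p \<in> M" "w \<in> tangent_space M p" "w \<in> normal_space M p"
  shows "w = 0"
proof -
  have "pseudo_inner w w = 0" using assms(2,3) by (simp add: normal_space_def)
  then show ?thesis
    using assms(1,2) spacelike unfolding spacelike_submanifold_def by force
qed

text \<open>In graph coordinates the induced metric is the Euclidean product minus the product of
  the height derivatives, positive definite because the slope is below 1. As the graph is entire,
  one frame serves all of \<open>M\<close>.\<close>

lemma orthonormal_field:
  obtains C :: "'n \<Rightarrow> real^'n \<Rightarrow> real^'n" where "\<And>i. smooth_on UNIV (C i)"
    "\<And>x i j. C i x \<bullet> C j x - dd (C i x) height x \<bullet> dd (C j x) height x = (if i = j then 1 else 0)"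
proof -
  let ?g = "\<lambda>x k l. (axis k 1 :: real^'n) \<bullet> axis l 1 - dd (axis k 1) height x \<bullet> dd (axis l 1) height x"
  have sm: "smooth_on UNIV (\<lambda>x. ?g x k l)" for k l
    by (intro smooth_on_diff smooth_on_const smooth_on_inner smooth_on_dd smooth_height open_UNIV)
  have pos: "0 < gram_form (?g x) v v" if "v \<noteq> 0" for x v
    using dd_height_less[OF that, of x] by (simp add: gram_form_diff_inner[OF linear_dd_height] norm_lt)
  have sym: "?g x k l = ?g x l k" for x k l by (simp add: inner_commute)
  show thesis
  proof (rule smooth_gram_schmidt[OF open_UNIV, of ?g])
    fix C :: "'n \<Rightarrow> real^'n \<Rightarrow> real^'n"
    assume C: "\<And>i. smooth_on UNIV (C i)"
      "\<And>x i j. x \<in> UNIV \<Longrightarrow> gram_form (?g x) (C i x) (C j x) = (if i = j then 1 else 0)"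
    show thesis
      by (rule that[OF C(1)]) (rule C(2)[OF UNIV_I, unfolded gram_form_diff_inner[OF linear_dd_height]])
  qed (use sm sym pos in blast)+
qed

lemma linear_pseudo_inner_left: "linear (\<lambda>v. pseudo_inner v (w :: ('n, 'm) pseudo_space))"
  by (rule linearI) (simp_all add: pseudo_inner_def inner_add_left algebra_simps)

lemma normal_decomposition:
  assumes "p \<in> M"
  shows "\<exists>w. w \<in> normal_space M p \<and> v - w \<in> tangent_space M p"
proof -
  obtain x where x: "p = graph_map x" using assms M_eq by blast
  obtain C :: "'n \<Rightarrow> real^'n \<Rightarrow> real^'n" where
    C: "\<And>x i j. C i x \<bullet> C j x - dd (C i x) height x \<bullet> dd (C j x) height x = (if i = j then 1 else 0)"
    using orthonormal_field by metis
  define e where "e i = S (C i x, dd (C i x) height x)" for i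
  have e: "e i \<in> tangent_space M p" for i by (auto simp: e_def x tangent_space_eq)
  have ee: "pseudo_inner (e i) (e j) = (if i = j then 1 else 0)" for i j
    using C[of i x j] unfolding e_def pseudo_inner_S by (simp add: pseudo_inner_def)
  define t where "t = (\<Sum>i\<in>UNIV. pseudo_inner v (e i) *\<^sub>R e i)"
  have t: "t \<in> tangent_space M p"
    unfolding t_def using subspace_tangent[OF assms] e by (intro subspace_sum subspace_scale)
  have te: "pseudo_inner t (e j) = pseudo_inner v (e j)" for j
  proof -
    have "pseudo_inner t (e j) = (\<Sum>i\<in>UNIV. pseudo_inner v (e i) * pseudo_inner (e i) (e j))"
      unfolding t_def
      by (simp only: linear_sum[OF linear_pseudo_inner_left] pseudo_inner_scaleR_left)
    also have "\<dots> = (\<Sum>i\<in>UNIV. if i = j then pseudo_inner v (e j) else 0)"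
      by (rule sum.cong) (auto simp: ee)
    finally show ?thesis by simp
  qed
  have "v - t \<in> normal_space M p"
    unfolding normal_space_def
  proof (intro CollectI ballI)
    fix u assume "u \<in> tangent_space M p"
    then obtain \<xi> where \<xi>: "u = S (\<xi>, dd \<xi> height x)" using tangent_space_eq x by blast
    have "\<xi> = (\<Sum>i\<in>UNIV. (\<xi> \<bullet> C i x - dd \<xi> height x \<bullet> dd (C i x) height x) *\<^sub>R C i x)"
    proof (rule orthonormal_expansion[of "\<lambda>v w. v \<bullet> w - dd v height x \<bullet> dd w height x"])
      show "linear (\<lambda>v. v \<bullet> w - dd v height x \<bullet> dd w height x)" for w
        by (rule linearI)
          (simp_all add: linear_add[OF linear_dd_height] linear_scale[OF linear_dd_height] inner_add_left algebra_simps)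
    qed (use C in auto)
    then obtain a where a: "\<xi> = (\<Sum>i\<in>UNIV. a i *\<^sub>R C i x)"
      by (rule that[of "\<lambda>i. \<xi> \<bullet> C i x - dd \<xi> height x \<bullet> dd (C i x) height x"])
    have lin: "linear (\<lambda>v. dd v graph_map x)" using linear_dd differentiable_graph_map by blast
    have u: "u = (\<Sum>i\<in>UNIV. a i *\<^sub>R e i)"
      unfolding \<xi> e_def dd_graph_map[symmetric] a
      by (simp only: linear_sum[OF lin] linear_scale[OF lin])
    show "pseudo_inner u (v - t) = 0"
      unfolding u linear_sum[OF linear_pseudo_inner_left] pseudo_inner_scaleR_left pseudo_inner_diff_right
      using te by (simp add: pseudo_inner_commute)
  qed
  moreover have "v - (v - t) \<in> tangent_space M p" using t by simp
  ultimately show ?thesis by blast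
qed

lemma normal_part_eqI:
  assumes "p \<in> M" "w \<in> normal_space M p" "v - w \<in> tangent_space M p"
  shows "normal_part M p v = w"
  unfolding normal_part_def
proof (rule the_equality)
  fix w' assume w': "w' \<in> normal_space M p \<and> v - w' \<in> tangent_space M p"
  have "w' - w \<in> normal_space M p" using w' assms(2) subspace_normal subspace_diff by blast
  moreover have "(v - w) - (v - w') \<in> tangent_space M p"
    using w' assms(1,3) subspace_tangent subspace_diff by blast
  ultimately show "w' = w" using tangent_normal_zero[OF assms(1), of "w' - w"] by simp
qed (use assms in auto)

lemma normal_part_mem:
  assumes "p \<in> M"
  shows "normal_part M p v \<in> normal_space M p" "v - normal_part M p v \<in> tangent_space M p"
  using normal_decomposition[OF assms, of v] normal_part_eqI[OF assms] by metis+

lemma linear_normal_part: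
  assumes "p \<in> M" shows "linear (normal_part M p)"
proof (rule linearI)
  note mem = normal_part_mem[OF assms]
  fix a b r
  have "(a - normal_part M p a) + (b - normal_part M p b) \<in> tangent_space M p"
    using mem subspace_tangent[OF assms] subspace_add by blast
  then show "normal_part M p (a + b) = normal_part M p a + normal_part M p b"
    using subspace_add[OF subspace_normal mem(1) mem(1)]
    by (intro normal_part_eqI assms) (simp_all add: algebra_simps)
  have "r *\<^sub>R (a - normal_part M p a) \<in> tangent_space M p"
    using mem subspace_tangent[OF assms] subspace_scale by blast
  then show "normal_part M p (r *\<^sub>R a) = r *\<^sub>R normal_part M p a"
    using subspace_scale[OF subspace_normal mem(1)]
    by (intro normal_part_eqI assms) (simp_all add: algebra_simps)
qed

lemma normal_part_tangent:
  assumes "p \<in> M" "v \<in> tangent_space M p"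
  shows "normal_part M p v = 0"
  using assms subspace_0[OF subspace_normal, of p] by (intro normal_part_eqI) simp_all

text \<open>Along \<open>M\<close> the field is the derivative of \<open>graph_map\<close> in a
  direction \<open>c y\<close>. Differentiating in direction \<open>c x\<close> gives the second
  derivative of \<open>graph_map\<close> plus its first derivative in a new direction; the latter is
  tangent and disappears in the normal part.\<close>

lemma frame_second_fundamental_form:
  assumes x: "p = graph_map x" "p \<in> U" and e: "tangent_field M U e"
  shows "second_fundamental_form M e e p = normal_part M p (dd (hor (e p)) (dd (hor (e p)) graph_map) x)"
proof -
  have U: "open U" "smooth_on U e" and tan: "\<And>q. q \<in> M \<inter> U \<Longrightarrow> e q \<in> tangent_space M q"
    using e by (auto simp: tangent_field_def)
  have p: "p \<in> M" using x graph_map_mem by simp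
  let ?F = graph_map
  define c where "c y = hor (e (?F y))" for y
  define V where "V = ?F -` U"
  have V: "open V" "x \<in> V"
    unfolding V_def using x continuous_open_preimage[OF smooth_on_continuous_on[OF smooth_graph_map] open_UNIV U(1)]
    by auto
  have edF: "e (?F y) = dd (c y) ?F y" if "y \<in> V" for y
  proof -
    have "e (?F y) \<in> tangent_space M (?F y)"
      using tan[of "?F y"] graph_map_mem[of y] that by (simp add: V_def)
    then obtain v where "e (?F y) = S (v, dd v height y)"
      unfolding tangent_space_eq by blast
    then show ?thesis by (simp add: c_def hor_def dd_graph_map)
  qed
  have de: "e differentiable (at p)" using smooth_on_differentiable[OF U(2) x(2)] .
  have deF: "((\<lambda>y. e (?F y)) has_derivative (\<lambda>v. dd (dd v ?F x) e p)) (at x)"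
    using dd_compose[OF de[unfolded x(1)] differentiable_graph_map(1)] x(1) by simp
  then have dc: "(c has_derivative (\<lambda>v. hor (dd (dd v ?F x) e p))) (at x)"
    unfolding c_def using has_derivative_compose[OF _ linear_imp_has_derivative[OF linear_hor]] by blast
  define c' where "c' v = hor (dd (dd v ?F x) e p)" for v
  have lin: "linear (\<lambda>v. dd v ?F y)" for y
    using linear_dd differentiable_graph_map by blast
  have "((\<lambda>y. \<Sum>k\<in>UNIV. c y $ k *\<^sub>R dd (axis k 1) ?F y) has_derivative
      (\<lambda>v. \<Sum>k\<in>UNIV. c x $ k *\<^sub>R dd v (dd (axis k 1) ?F) x + c' v $ k *\<^sub>R dd (axis k 1) ?F x)) (at x)"
  proof (intro has_derivative_sum has_derivative_scaleR has_derivative_dd differentiable_graph_map)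
    show "((\<lambda>y. c y $ k) has_derivative (\<lambda>v. c' v $ k)) (at x)" for k
      using bounded_linear.has_derivative[OF bounded_linear_vec_nth dc[folded c'_def]] .
  qed
  then have "((\<lambda>y. e (?F y)) has_derivative
      (\<lambda>v. \<Sum>k\<in>UNIV. c x $ k *\<^sub>R dd v (dd (axis k 1) ?F) x + c' v $ k *\<^sub>R dd (axis k 1) ?F x)) (at x)"
  proof (rule has_derivative_transform_within_open[OF _ V])
    show "(\<Sum>k\<in>UNIV. c y $ k *\<^sub>R dd (axis k 1) ?F y) = e (?F y)" if "y \<in> V" for y
      unfolding edF[OF that] using linear_expand_axis[OF lin, of "c y" y] by simp
  qed
  then have "(\<lambda>v. dd (dd v ?F x) e p)
      = (\<lambda>v. \<Sum>k\<in>UNIV. c x $ k *\<^sub>R dd v (dd (axis k 1) ?F) x + c' v $ k *\<^sub>R dd (axis k 1) ?F x)"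
    using deF has_derivative_unique by blast
  then have "dd (dd (c x) ?F x) e p
      = (\<Sum>k\<in>UNIV. c x $ k *\<^sub>R dd (c x) (dd (axis k 1) ?F) x + c' (c x) $ k *\<^sub>R dd (axis k 1) ?F x)" by meson
  also have "\<dots> = dd (c x) (dd (c x) ?F) x + dd (c' (c x)) ?F x"
    unfolding sum.distrib
    using linear_expand_axis[OF linear_dd_dd(1)[OF smooth_graph_map, of "c x" x], of "c x"]
      linear_expand_axis[OF lin, of "c' (c x)" x] by simp
  finally have "dd (e p) e p = dd (c x) (dd (c x) ?F) x + dd (c' (c x)) ?F x"
    using edF[OF V(2)] x(1) by simp
  moreover have "dd (c' (c x)) ?F x \<in> tangent_space M p"
    using x(1) by (auto simp: tangent_space_eq dd_graph_map)
  ultimately have "normal_part M p (dd (e p) e p) = normal_part M p (dd (c x) (dd (c x) ?F) x)"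
    using linear_add[OF linear_normal_part[OF p]] normal_part_tangent[OF p] by simp
  then show ?thesis
    unfolding second_fundamental_form_def dd_def c_def x(1) .
qed

text \<open>Both halves of the definite description must be supplied: every orthonormal frame gives
  this value by independence of the trace, and at least one frame exists.\<close>

lemma mean_curvature_eq:
  fixes c :: "'n \<Rightarrow> real^'n"
  assumes c: "\<And>i j. c i \<bullet> c j - dd (c i) height x \<bullet> dd (c j) height x = (if i = j then 1 else 0)"
  shows "mean_curvature M (graph_map x) = normal_part M (graph_map x) (\<Sum>i\<in>UNIV. dd (c i) (dd (c i) graph_map) x)"
  unfolding mean_curvature_def
proof (rule the_equality)
  let ?p = "graph_map x" and ?q = "\<lambda>v w. v \<bullet> w - dd v height x \<bullet> dd w height x"
  have p: "?p \<in> M" by (rule graph_map_mem)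
  have lin: "linear (\<lambda>v. ?q v w)" for w
    by (rule linearI)
      (simp_all add: linear_add[OF linear_dd_height] linear_scale[OF linear_dd_height] inner_add_left algebra_simps)
  have frame: "(\<Sum>i\<in>UNIV. second_fundamental_form M (e i) (e i) ?p)
      = normal_part M ?p (\<Sum>i\<in>UNIV. dd (c i) (dd (c i) graph_map) x)"
    if e: "orthonormal_frame M U e" "?p \<in> U" for U e
  proof -
    define c' where "c' i = hor (e i ?p)" for i
    have tf: "tangent_field M U (e i)" for i using e by (simp add: orthonormal_frame_def)
    have ep: "e i ?p = S (c' i, dd (c' i) height x)" for i
    proof -
      obtain v where "e i ?p = S (v, dd v height x)"
        using tf[of i] e(2) p tangent_space_eq unfolding tangent_field_def by blast
      then show ?thesis by (simp add: c'_def hor_def)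
    qed
    have orth: "?q (c' i) (c' j) = (if i = j then 1 else 0)" for i j
    proof -
      have "pseudo_inner (e i ?p) (e j ?p) = (if i = j then 1 else 0)"
        using e p unfolding orthonormal_frame_def by blast
      then show ?thesis unfolding ep pseudo_inner_S by (simp add: pseudo_inner_def)
    qed
    have "(\<Sum>i\<in>UNIV. dd (c' i) (dd (c' i) graph_map) x) = (\<Sum>i\<in>UNIV. dd (c i) (dd (c i) graph_map) x)"
    proof (rule trace_orthonormal_independent[of ?q c' c "\<lambda>v w. dd v (dd w graph_map) x"])
      show "?q v w = ?q w v" for v w by (simp add: inner_commute)
    qed (use lin orth c linear_dd_dd[OF smooth_graph_map] in auto)
    then show ?thesis
      using frame_second_fundamental_form[OF refl e(2) tf]
      by (simp add: linear_sum[OF linear_normal_part[OF p], symmetric] c'_def)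
  qed
  show "h = normal_part M ?p (\<Sum>i\<in>UNIV. dd (c i) (dd (c i) graph_map) x)"
    if "\<exists>U e. ?p \<in> U \<and> orthonormal_frame M U e \<and> h = (\<Sum>i\<in>UNIV. second_fundamental_form M (e i) (e i) ?p)" for h
    using that frame by blast
  obtain C :: "'n \<Rightarrow> real^'n \<Rightarrow> real^'n" where C: "\<And>i. smooth_on UNIV (C i)"
    "\<And>x i j. C i x \<bullet> C j x - dd (C i x) height x \<bullet> dd (C j x) height x = (if i = j then 1 else 0)"
    using orthonormal_field by metis
  \<comment> \<open>Frames consist of fields on ambient open sets, so the frame along
    \<open>M\<close> is extended to be constant along the fibres of \<open>hor\<close>.\<close>
  define E where "E i q = (\<Sum>k\<in>UNIV. C i (hor q) $ k *\<^sub>R dd (axis k 1) graph_map (hor q))" for i q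
  have E: "E i q = S (C i (hor q), dd (C i (hor q)) height (hor q))" for i q
    unfolding E_def dd_graph_map[symmetric]
    by (rule linear_expand_axis[symmetric, OF linear_dd[OF differentiable_graph_map(1)]])
  have fr: "orthonormal_frame M UNIV E"
    unfolding orthonormal_frame_def tangent_field_def
  proof (intro conjI allI ballI open_UNIV)
    show "smooth_on UNIV (E i)" for i
    proof -
      have "smooth_on UNIV (\<lambda>y. \<Sum>k\<in>UNIV. C i y $ k *\<^sub>R dd (axis k 1) graph_map y)"
        by (intro smooth_on_sum smooth_on_scaleR smooth_on_nth smooth_on_dd smooth_graph_map C open_UNIV)
      then show ?thesis unfolding E_def
        by (rule smooth_on_compose[OF open_UNIV open_UNIV subset_UNIV _ smooth_on_linear[OF linear_hor]])
    qed
    show "E i q \<in> tangent_space M q" if "q \<in> M \<inter> UNIV" for i q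
      using tangent_space_eq[of "hor q"] that by (auto simp: E graph_map_hor)
    show "pseudo_inner (E i q) (E j q) = (if i = j then 1 else 0)" for i j q
      using C(2)[of i "hor q" j] unfolding E pseudo_inner_S by (simp add: pseudo_inner_def)
  qed
  show "\<exists>U e. ?p \<in> U \<and> orthonormal_frame M U e \<and>
      normal_part M ?p (\<Sum>i\<in>UNIV. dd (c i) (dd (c i) graph_map) x) =
      (\<Sum>i\<in>UNIV. second_fundamental_form M (e i) (e i) ?p)"
    by - (rule exI[of _ UNIV], rule exI[of _ E], intro conjI, rule UNIV_I, rule fr,
      rule frame[OF fr UNIV_I, symmetric])
qed

text \<open>The equation says that the trace of the second derivative of \<open>graph_map\<close>
  plus half the position vector is tangent. That trace is vertical, so the horizontal part of the
  tangent vector is \<open>(1/2) *\<^sub>R x\<close>, which determines its vertical part.\<close>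

lemma self_shrinker_equation:
  fixes c :: "'n \<Rightarrow> real^'n"
  assumes "spacelike_self_shrinker M"
    and c: "\<And>i j. c i \<bullet> c j - dd (c i) height x \<bullet> dd (c j) height x = (if i = j then 1 else 0)"
  shows "(\<Sum>i\<in>UNIV. dd (c i) (dd (c i) height) x) = (1/2) *\<^sub>R (dd x height x - height x)"
proof -
  let ?p = "graph_map x" and ?H = "\<Sum>i\<in>UNIV. dd (c i) (dd (c i) graph_map) x"
  have p: "?p \<in> M" by (rule graph_map_mem)
  have "normal_part M ?p ?H = - (1/2) *\<^sub>R normal_part M ?p ?p"
    using assms(1) p mean_curvature_eq[OF c] by (simp add: spacelike_self_shrinker_def)
  then have "normal_part M ?p (?H + (1/2) *\<^sub>R ?p) = 0"
    by (simp add: linear_add[OF linear_normal_part[OF p]] linear_scale[OF linear_normal_part[OF p]])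
  then have "?H + (1/2) *\<^sub>R ?p \<in> tangent_space M ?p"
    using normal_part_mem(2)[OF p, of "?H + (1/2) *\<^sub>R ?p"] by simp
  then obtain v where v: "?H + (1/2) *\<^sub>R ?p = S (v, dd v height x)"
    using tangent_space_eq by auto
  have "?H = S (0, \<Sum>i\<in>UNIV. dd (c i) (dd (c i) height) x)"
    unfolding dd_dd_graph_map linear_sum[OF linear_S, symmetric] sum_prod by simp
  then have "T (S (0, \<Sum>i\<in>UNIV. dd (c i) (dd (c i) height) x) + (1/2) *\<^sub>R S (x, height x)) = (v, dd v height x)"
    using v by (simp add: graph_map_eq)
  then have "(0, \<Sum>i\<in>UNIV. dd (c i) (dd (c i) height) x) + (1/2) *\<^sub>R (x, height x) = (v, dd v height x)"
    by (simp only: linear_add[OF linear_T] linear_scale[OF linear_T] TS)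
  then have "v = (1/2) *\<^sub>R x" "(\<Sum>i\<in>UNIV. dd (c i) (dd (c i) height) x) + (1/2) *\<^sub>R height x = dd v height x"
    by auto
  then show ?thesis
    using linear_scale[OF linear_dd_height, of "1/2" x x] by (simp add: algebra_simps)
qed

end

section \<open>The weight and the second-order conditions\<close>

text \<open>The slope \<open>t / (8 (t + k))\<close> is small for \<open>t\<close> small against \<open>k\<close> and tends to \<open>1/8\<close>, while
  \<open>t w''(t) \<le> 1/32\<close> throughout.\<close>

definition weight :: "real \<Rightarrow> real \<Rightarrow> real" where
  "weight k t = (t - k * ln (1 + t / k)) / 8"

lemma weight_deriv:
  assumes "k > 0" "t \<ge> 0"
  shows "(weight k has_real_derivative t / (8 * (t + k))) (at t)"
    and "((\<lambda>t. t / (8 * (t + k))) has_real_derivative k / (8 * (t + k)^2)) (at t)"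
proof -
  have pos: "1 + t / k > 0" "t + k > 0" using assms by (simp_all add: add_pos_nonneg)
  have e: "k * (1 / k / (1 + t / k)) = k / (t + k)"
    using assms pos by (simp add: field_simps)
  have "(weight k has_real_derivative (1 - k * (1 / k / (1 + t / k))) / 8) (at t)"
    unfolding weight_def[abs_def] using assms pos
    by (auto intro!: derivative_eq_intros)
  moreover have "(1 - k * (1 / k / (1 + t / k))) / 8 = t / (8 * (t + k))"
    unfolding e using pos by (simp add: field_simps)
  ultimately show "(weight k has_real_derivative t / (8 * (t + k))) (at t)" by (rule DERIV_cong)
  show "((\<lambda>t. t / (8 * (t + k))) has_real_derivative k / (8 * (t + k)^2)) (at t)"
  proof (rule DERIV_cong)
    show "((\<lambda>t. t / (8 * (t + k))) has_real_derivative
        (1 * (8 * (t + k)) - t * (8 * 1)) / ((8 * (t + k)) * (8 * (t + k)))) (at t)"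
      using pos by (intro DERIV_divide) (auto intro!: derivative_eq_intros)
    have "1 * (8 * (t + k)) - t * (8 * 1) = 8 * k" by simp
    moreover have "8 * k / ((8 * u) * (8 * u)) = k / (8 * u^2)" for u :: real
      by (simp add: power2_eq_square)
    ultimately show "(1 * (8 * (t + k)) - t * (8 * 1)) / ((8 * (t + k)) * (8 * (t + k))) = k / (8 * (t + k)^2)"
      by presburger
  qed
qed

text \<open>The weight falls short of t/8 only by a logarithm, so any rate below 1/8 loses against
  it linearly. Together with properness this confines the maximum to a compact set.\<close>

lemma weight_growth:
  assumes "k > 0" "a < 1/8"
  obtains \<epsilon> B where "\<epsilon> > 0" "\<And>t. t \<ge> 0 \<Longrightarrow> a * t - weight k t \<le> B - \<epsilon> * t"
proof -
  \<comment> \<open>A tangent line of slope \<open>e\<close> bounds the logarithm; after division by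
    8 it consumes half of the gap 1/8 - a.\<close>
  define e where "e = 4 * (1/8 - a)"
  have e: "e > 0" using assms by (simp add: e_def)
  show thesis
  proof (rule that)
    show "0 < (1/8 - a) / 2" using assms by simp
    fix t :: real assume t: "t \<ge> 0"
    have p: "1 + t / k > 0" using assms t by (simp add: add_pos_nonneg)
    have "ln (e * (1 + t / k)) \<le> e * (1 + t / k) - 1"
      using p e by (intro ln_le_minus_one) simp
    then have "ln (1 + t / k) \<le> e * (1 + t / k) - 1 - ln e"
      using p e by (simp add: ln_mult)
    then have "k * ln (1 + t / k) \<le> k * (e * (1 + t / k) - 1 - ln e)"
      using assms by simp
    also have "\<dots> = e * t + k * (e - 1 - ln e)" using assms by (simp add: field_simps)
    finally show "a * t - weight k t \<le> k * (e - 1 - ln e) / 8 - (1/8 - a) / 2 * t"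
      unfolding weight_def e_def by (simp add: field_simps)
  qed
qed

text \<open>The strict opposite of what the maximum forces. With k = 2 n^2 the coefficient of
  \<open>r\<close> is nonnegative, the \<open>f2\<close> term costs at most 1/8, and
  \<open>2 * n * f1\<close> exceeds the gain from \<open>z\<close> by at most 1/3, so 1 - 1/8 - 1/3
  is left.\<close>

lemma weight_inequality:
  fixes n :: real
  assumes "n \<ge> 1" "z \<ge> 0" "r \<ge> 0" and k: "k = 2 * n^2"
    and f1: "f1 = z / (8 * (z + k))" and f2: "f2 = k / (8 * (z + k)^2)"
  shows "0 < 1 + z * (f1 - 2 * f1^2 - 4 * f2) + r * ((1 - 2 * f1)^2 / (2 * n) - 4 * f2) - 2 * n * f1"
proof -
  have k0: "k > 0" "z + k > 0" using assms by (auto intro: add_nonneg_pos)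
  have f1b: "0 \<le> f1" "f1 \<le> 1/8" using assms(2) k0 by (auto simp: f1 field_simps)
  have zf2: "4 * z * f2 \<le> 1/8"
  proof -
    have "4 * (k * z) \<le> (z + k)^2" using sum_squares_bound[of z k] by (simp add: power2_eq_square algebra_simps)
    then show ?thesis using k0 by (simp add: f2 field_simps)
  qed
  have f2b: "4 * f2 \<le> 1 / (4 * n)"
  proof -
    have "k * k \<le> (z + k)^2" using assms(2) k0 by (simp add: power2_eq_square mult_mono)
    then have "k / (z + k)^2 \<le> 1 / k" using k0 by (simp add: field_simps)
    moreover have "1 / k \<le> 1 / (2 * n)"
      unfolding k using assms(1) by (intro divide_left_mono) (auto simp: power2_eq_square)
    ultimately show ?thesis by (simp add: f2)
  qed
  have "(1 - 2 * f1)^2 \<ge> (3/4)^2" using f1b by (intro power_mono) auto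
  then have "(1 - 2 * f1)^2 / (2 * n) \<ge> (9/16) / (2 * n)"
    using assms(1) by (intro divide_right_mono) (auto simp: power2_eq_square)
  also have "(9/16) / (2 * n) = (9/32) * (1 / n)" by simp
  finally have "(1 - 2 * f1)^2 / (2 * n) - 4 * f2 \<ge> (9/32) * (1/n) - (1/4) * (1/n)"
    using f2b by simp
  moreover have "1 / n > 0" using assms(1) by simp
  ultimately have "(1 - 2 * f1)^2 / (2 * n) - 4 * f2 \<ge> 0" by linarith
  then have r: "r * ((1 - 2 * f1)^2 / (2 * n) - 4 * f2) \<ge> 0"
    using assms(3) by (rule mult_nonneg_nonneg[rotated])
  have "2 * f1 * f1 \<le> (1/4) * f1" using f1b by (intro mult_right_mono) auto
  then have "z * (f1 - 2 * f1^2) \<ge> z * ((3/4) * f1)"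
    using assms(2) by (intro mult_left_mono) (auto simp: power2_eq_square)
  then have zf: "z * (f1 - 2 * f1^2 - 4 * f2) \<ge> (3/4) * z * f1 - 1/8"
    using zf2 by (simp add: algebra_simps)
  \<comment> \<open>The bracket is positive only for z below 8n/3, and there the slope is still at
    most 1/(6n).\<close>
  have "f1 * (2 * n - (3/4) * z) \<le> 1/3"
  proof (cases "z \<ge> 8 * n / 3")
    case True
    then have "f1 * (2 * n - (3/4) * z) \<le> 0" using f1b by (intro mult_nonneg_nonpos) auto
    then show ?thesis by linarith
  next
    case False
    have "f1 \<le> z / (8 * k)"
      unfolding f1 using assms(2) k0 by (intro divide_left_mono) auto
    also have "\<dots> \<le> (8 * n / 3) / (8 * k)" using False k0 by (intro divide_right_mono) auto
    also have "\<dots> = 1 / (6 * n)" unfolding k using assms(1) by (simp add: power2_eq_square field_simps)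
    finally have "f1 * (2 * n - (3/4) * z) \<le> 1 / (6 * n) * (2 * n)"
      using f1b assms(1,2) False by (intro mult_mono) auto
    also have "\<dots> = 1/3" using assms(1) by simp
    finally show ?thesis .
  qed
  then show ?thesis using r zf by (simp add: algebra_simps)
qed

lemma second_derivative_test:
  fixes \<phi> :: "real \<Rightarrow> real"
  assumes d: "\<And>t. (\<phi> has_real_derivative \<phi>' t) (at t)" and d2: "(\<phi>' has_real_derivative D) (at 0)"
    and mx: "\<And>t. \<phi> t \<le> \<phi> 0"
  shows "\<phi>' 0 = 0" "D \<le> 0"
proof -
  show z: "\<phi>' 0 = 0"
    by (rule DERIV_local_max[OF d[of 0], of 1]) (use mx in auto)
  show "D \<le> 0"
  proof (rule ccontr)
    assume "\<not> D \<le> 0"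
    then obtain e where e: "e > 0" "\<And>h. 0 < h \<Longrightarrow> h < e \<Longrightarrow> \<phi>' 0 < \<phi>' (0 + h)"
      using DERIV_pos_inc_right[OF d2] by (metis not_le)
    obtain t where "0 < t" "t < e/2" "\<phi> (e/2) - \<phi> 0 = (e/2 - 0) * \<phi>' t"
      using MVT2[of 0 "e/2" \<phi> \<phi>'] d e(1) by auto
    moreover have "0 < (e/2 - 0) * \<phi>' t"
      using e(1) e(2)[of t] z \<open>0 < t\<close> \<open>t < e/2\<close> by simp
    ultimately have "\<phi> (e/2) > \<phi> 0" by linarith
    then show False using mx[of "e/2"] by simp
  qed
qed

text \<open>The second-derivative test for \<open>(N t)^2 - K * (1 - q t) * exp (w (z t))\<close>,
  whose maximum 0 is attained at t = 0. Since \<open>q\<close> vanishes to first order there, it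
  contributes only \<open>q2\<close>, and \<open>K * exp (w (z 0))\<close> is replaced by
  \<open>(N 0)^2\<close>.\<close>

lemma weighted_maximum_test:
  fixes N q z w w1 :: "real \<Rightarrow> real"
  assumes N: "\<And>t. (N has_real_derivative N1 t) (at t)" "(N1 has_real_derivative N2) (at 0)"
    and q: "\<And>t. (q has_real_derivative q1 t) (at t)" "(q1 has_real_derivative q2) (at 0)"
    and z: "\<And>t. (z has_real_derivative z1 t) (at t)" "(z1 has_real_derivative z2) (at 0)"
    and z0: "\<And>t. z t \<ge> 0" and w: "\<And>t. t \<ge> 0 \<Longrightarrow> (w has_real_derivative w1 t) (at t)"
    and w2: "(w1 has_real_derivative w2) (at (z 0))"
    and q0: "q 0 = 0" "q1 0 = 0"
    and mx: "\<And>t. (N t)^2 \<le> K * (1 - q t) * exp (w (z t))"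
    and eq: "(N 0)^2 = K * exp (w (z 0))"
  shows "2 * N 0 * N1 0 = (N 0)^2 * w1 (z 0) * z1 0"
    and "2 * (N1 0)^2 + 2 * N 0 * N2 + (N 0)^2 * (q2 - ((w1 (z 0))^2 + w2) * (z1 0)^2 - w1 (z 0) * z2) \<le> 0"
proof -
  let ?E = "\<lambda>t. exp (w (z t))"
  define \<phi> where "\<phi> t = (N t)^2 - K * (1 - q t) * ?E t" for t
  define \<phi>' where "\<phi>' t = 2 * N t * N1 t - K * (- q1 t * ?E t + (1 - q t) * (?E t * (w1 (z t) * z1 t)))" for t
  have wz: "((\<lambda>t. w (z t)) has_real_derivative w1 (z t) * z1 t) (at t)" for t
    using DERIV_chain2[OF w[OF z0] z(1)] .
  have E: "(?E has_real_derivative ?E t * (w1 (z t) * z1 t)) (at t)" for t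
    using DERIV_chain2[OF DERIV_exp wz] .
  have w1z: "((\<lambda>t. w1 (z t)) has_real_derivative w2 * z1 0) (at 0)"
    using DERIV_chain2[OF w2 z(1)] .
  have "(\<phi> has_real_derivative \<phi>' t) (at t)" for t
    unfolding \<phi>_def[abs_def] \<phi>'_def
    by (auto intro!: derivative_eq_intros N(1) q(1) wz simp: algebra_simps)
  moreover have "(\<phi>' has_real_derivative
      2 * (N1 0)^2 + 2 * N 0 * N2 - K * (- q2 * ?E 0 + ?E 0 * ((w1 (z 0))^2 + w2) * (z1 0)^2 + ?E 0 * w1 (z 0) * z2)) (at 0)"
    unfolding \<phi>'_def[abs_def]
    by (auto intro!: derivative_eq_intros N q wz z w1z simp: algebra_simps power2_eq_square q0)
  moreover have "\<phi> t \<le> \<phi> 0" for t using mx[of t] eq by (simp add: \<phi>_def q0)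
  ultimately have "\<phi>' 0 = 0"
    "2 * (N1 0)^2 + 2 * N 0 * N2 - K * (- q2 * ?E 0 + ?E 0 * ((w1 (z 0))^2 + w2) * (z1 0)^2 + ?E 0 * w1 (z 0) * z2) \<le> 0"
    using second_derivative_test[of \<phi> \<phi>'] by blast+
  then show "2 * N 0 * N1 0 = (N 0)^2 * w1 (z 0) * z1 0"
    "2 * (N1 0)^2 + 2 * N 0 * N2 + (N 0)^2 * (q2 - ((w1 (z 0))^2 + w2) * (z1 0)^2 - w1 (z 0) * z2) \<le> 0"
    unfolding eq by (simp_all add: \<phi>'_def q0 algebra_simps)
qed

text \<open>Expand \<open>\<Sum> (S k j - a \<delta> k j - b x k x j / |x|^2)^2 \<ge> 0\<close> with \<open>b = \<lambda> - a\<close>.\<close>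

lemma sum_squares_lower_bound:
  fixes S :: "'n::finite \<Rightarrow> 'n \<Rightarrow> real" and x :: "real^'n"
  assumes "x \<noteq> 0" and l: "(\<Sum>k\<in>UNIV. \<Sum>j\<in>UNIV. x $ k * S k j * x $ j) = l * (x \<bullet> x)"
    and t: "(\<Sum>k\<in>UNIV. S k k) = t"
  shows "l^2 + 2 * a * (t - l) - (real CARD('n) - 1) * a^2 \<le> (\<Sum>k\<in>UNIV. \<Sum>j\<in>UNIV. (S k j)^2)"
proof -
  define r where "r = x \<bullet> x"
  have r: "r > 0" using assms(1) by (simp add: r_def)
  have xx: "(\<Sum>k\<in>UNIV. x $ k * x $ k) = r" by (simp add: r_def inner_vec_def)
  define b where "b = (l - a) / r"
  define d where "d k j = (if k = j then 1 else 0 :: real)" for k j :: 'n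
  have "0 \<le> (\<Sum>k\<in>UNIV. \<Sum>j\<in>UNIV. (S k j - a * d k j - b * (x $ k * x $ j))^2)"
    by (intro sum_nonneg) simp
  also have "\<dots> = (\<Sum>k\<in>UNIV. \<Sum>j\<in>UNIV. (S k j)^2) + a^2 * (\<Sum>k\<in>UNIV. \<Sum>j\<in>UNIV. d k j * d k j)
      + b^2 * (\<Sum>k\<in>UNIV. \<Sum>j\<in>UNIV. (x $ k * x $ k) * (x $ j * x $ j))
      - 2 * a * (\<Sum>k\<in>UNIV. \<Sum>j\<in>UNIV. S k j * d k j) - 2 * b * (\<Sum>k\<in>UNIV. \<Sum>j\<in>UNIV. x $ k * S k j * x $ j)
      + 2 * a * b * (\<Sum>k\<in>UNIV. \<Sum>j\<in>UNIV. (x $ k * x $ j) * d k j)"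
    by (simp add: power2_eq_square algebra_simps sum.distrib sum_subtractf sum_distrib_left)
  also have "(\<Sum>k\<in>UNIV. \<Sum>j\<in>UNIV. d k j * d k j) = real CARD('n)"
    by (simp add: d_def if_distrib cong: if_cong)
  also have "(\<Sum>k\<in>UNIV. \<Sum>j\<in>UNIV. (x $ k * x $ k) * (x $ j * x $ j)) = r * r"
    unfolding xx[symmetric] sum_product ..
  also have "(\<Sum>k\<in>UNIV. \<Sum>j\<in>UNIV. S k j * d k j) = t"
    unfolding t[symmetric] by (simp add: d_def if_distrib cong: if_cong)
  also have "(\<Sum>k\<in>UNIV. \<Sum>j\<in>UNIV. (x $ k * x $ j) * d k j) = r"
    unfolding xx[symmetric] by (simp add: d_def if_distrib cong: if_cong)
  also have "(\<Sum>k\<in>UNIV. \<Sum>j\<in>UNIV. x $ k * S k j * x $ j) = l * r" using l by (simp add: r_def)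
  finally have *: "0 \<le> (\<Sum>k\<in>UNIV. \<Sum>j\<in>UNIV. (S k j)^2) + a^2 * real CARD('n) + b^2 * (r * r)
      - 2 * a * t - 2 * b * (l * r) + 2 * a * b * r" .
  have br: "b * r = l - a" using r by (simp add: b_def)
  have "b^2 * (r * r) = (b * r)^2" "2 * b * (l * r) = 2 * l * (b * r)" "2 * a * b * r = 2 * a * (b * r)"
    by (simp_all add: power2_eq_square)
  with * show ?thesis unfolding br by (simp add: power2_eq_square algebra_simps)
qed

text \<open>Meant for the error of the Euclidean Laplacian at a flat point, where both height
  derivatives in the metric coefficient vanish.\<close>

lemma has_derivative_zero_product:
  fixes f g :: "'a::euclidean_space \<Rightarrow> 'b::euclidean_space"
  assumes "f differentiable (at x)" "g differentiable (at x)" "b differentiable (at x)" "f x = 0" "g x = 0"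
  shows "((\<lambda>y. (f y \<bullet> g y) * b y :: real) has_derivative (\<lambda>v. 0)) (at x)"
proof -
  have "((\<lambda>y. (f y \<bullet> g y) * b y) has_derivative
      (\<lambda>v. (f x \<bullet> g x) * dd v b x + (f x \<bullet> dd v g x + dd v f x \<bullet> g x) * b x)) (at x)"
    by (intro has_derivative_mult has_derivative_inner has_derivative_dd assms)
  then show ?thesis using assms(4,5) by simp
qed

lemma has_real_derivative_along_line:
  fixes f :: "'a::euclidean_space \<Rightarrow> real"
  assumes "smooth_on UNIV f"
  shows "((\<lambda>t. f (x + t *\<^sub>R v)) has_real_derivative dd v f (x + t *\<^sub>R v)) (at t)"
  using has_vector_derivative_along_line[OF smooth_on_differentiable[OF assms UNIV_I]]
  by (simp add: has_real_derivative_iff_has_vector_derivative)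

text \<open>Euler's relation makes Y(t x)/t constant for t > 0, so \<open>Y\<close> is a cone map;
  its limit at 0 identifies the constant with the derivative of \<open>Y\<close> at the origin,
  which is linear in \<open>x\<close>.\<close>

lemma linear_of_radial_derivative:
  fixes Y :: "'a::euclidean_space \<Rightarrow> 'b::euclidean_space"
  assumes sm: "smooth_on UNIV Y" and 0: "Y 0 = 0" and rad: "\<And>x. dd x Y x = Y x"
  shows "Y x = dd x Y 0"
proof -
  have d: "((\<lambda>t. Y (t *\<^sub>R x)) has_vector_derivative dd x Y (t *\<^sub>R x)) (at t)" for t
    using has_vector_derivative_along_line[of Y 0 t x, OF smooth_on_differentiable[OF sm UNIV_I]] by simp
  have "((\<lambda>t. inverse t *\<^sub>R Y (t *\<^sub>R x)) has_vector_derivative 0) (at t within {0::real<..})" if "t \<in> {0<..}" for t :: real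
  proof -
    have t: "t > 0" using that by simp
    have "t *\<^sub>R dd x Y (t *\<^sub>R x) = Y (t *\<^sub>R x)"
      using rad[of "t *\<^sub>R x"] linear_scale[OF linear_dd[OF smooth_on_differentiable[OF sm UNIV_I]]] by metis
    then have "dd x Y (t *\<^sub>R x) = inverse t *\<^sub>R Y (t *\<^sub>R x)"
      using t by (metis less_irrefl scaleR_scaleR left_inverse scaleR_one)
    then have z: "inverse t *\<^sub>R dd x Y (t *\<^sub>R x) + (- (inverse t * 1 * inverse t)) *\<^sub>R Y (t *\<^sub>R x) = 0"
      by simp
    have "((\<lambda>t::real. inverse t) has_real_derivative (- (inverse t * 1 * inverse t))) (at t)"
      using t by (auto intro!: derivative_eq_intros)
    from has_vector_derivative_scaleR[OF this d] show ?thesis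
      unfolding z by (rule has_vector_derivative_at_within)
  qed
  then obtain c where c: "\<And>t::real. t \<in> {0<..} \<Longrightarrow> inverse t *\<^sub>R Y (t *\<^sub>R x) = c"
    using has_vector_derivative_zero_constant[OF convex_real_interval(3)[of 0],
        of "\<lambda>t. inverse t *\<^sub>R Y (t *\<^sub>R x)"] by blast
  have Yc: "Y (t *\<^sub>R x) = t *\<^sub>R c" if "t \<in> {0..}" for t :: real
  proof (cases "t = 0")
    case False
    then have "t *\<^sub>R (inverse t *\<^sub>R Y (t *\<^sub>R x)) = t *\<^sub>R c" using c[of t] that by simp
    then show ?thesis using False by simp
  qed (simp add: 0)
  have "((\<lambda>t. t *\<^sub>R c) has_vector_derivative c) (at 0 within {0..})"
    by (auto intro!: derivative_eq_intros)
  then have "((\<lambda>t. Y (t *\<^sub>R x)) has_vector_derivative c) (at 0 within {0..})"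
    by (rule has_vector_derivative_transform[rotated 2]) (use Yc in auto)
  moreover have "((\<lambda>t. Y (t *\<^sub>R x)) has_vector_derivative dd x Y 0) (at 0 within {0..})"
    using has_vector_derivative_at_within[OF d[of 0]] by simp
  moreover have "{0..} - {0::real} = {0<..}" by auto
  then have "at (0::real) within {0..} \<noteq> bot"
    by (simp add: at_within_eq_bot_iff)
  ultimately have "c = dd x Y 0" by (metis vector_derivative_unique_within)
  then show ?thesis using c[of 1] by simp
qed

section \<open>Normal vectors and the pseudo-distance\<close>

lemma dd_inner_const:
  assumes "f differentiable (at x)"
  shows "dd v (\<lambda>y. c \<bullet> f y) x = c \<bullet> dd v f x"
  using dd_linear_compose[OF bounded_linear.linear[OF bounded_linear_inner_right] assms] .

lemma smooth_on_vec_nth: "smooth_on S (\<lambda>x :: real^'i. x $ j)"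
  by (rule smooth_on_linear[OF bounded_linear.linear[OF bounded_linear_vec_nth]])

lemma has_derivative_weighted_axis_sum:
  fixes g :: "'i::finite \<Rightarrow> real^'i \<Rightarrow> real"
  assumes "\<And>j. g j differentiable (at x)"
  shows "((\<lambda>x. \<Sum>j\<in>UNIV. x $ j * g j x) has_derivative
    (\<lambda>v. \<Sum>j\<in>UNIV. x $ j * dd v (g j) x + v $ j * g j x)) (at x)"
  by (intro has_derivative_sum has_derivative_mult has_derivative_dd assms
      linear_imp_has_derivative bounded_linear.linear[OF bounded_linear_vec_nth])

text \<open>\<open>E\<close> is the sum of the second-order tests over the axes and \<open>Q\<close>
  stands for |D^2 P|^2. After division by \<rho>^2, the terms in \<open>f1^2\<close> are 2 X + 2
  \<rho>^2 - 4 X times \<open>f1^2\<close>, which is -2 z \<open>f1^2\<close>.\<close>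

lemma maximum_test_arith:
  fixes n :: real
  assumes "\<rho> > 0" "n \<ge> 1" and X: "X = z + \<rho>^2"
    and E: "2 * (\<rho>^2 * f1^2 * X) + 2 * \<rho> * (\<rho> * f1 * X / 2 + \<rho> / 2)
      + \<rho>^2 * (2 * Q - (f1^2 + f2) * (4 * X) - f1 * (2 * n + \<rho>^2)) \<le> 0"
    and Q: "\<And>a. (- \<rho> * f1)^2 + 2 * a * (- \<rho> / 2 - (- \<rho> * f1)) - (n - 1) * a^2 \<le> Q"
  shows "1 + z * (f1 - 2 * f1^2 - 4 * f2) + \<rho>^2 * ((1 - 2 * f1)^2 / (2 * n) - 4 * f2) - 2 * n * f1 \<le> 0"
proof -
  define G where "G = (1 - 2 * f1)^2 / (2 * n)"
  \<comment> \<open>Close to the maximiser of the quadratic in \<open>a\<close> on the left of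
    \<open>Q\<close>; dividing by n in place of n - 1 keeps the case n = 1 uniform.\<close>
  define a where "a = - ((1 - 2 * f1) / (2 * n) * \<rho>)"
  have "\<rho>^2 * (2 * f1^2 * X + f1 * X + 1 + 2 * Q - (f1^2 + f2) * (4 * X) - f1 * (2 * n + \<rho>^2)) \<le> 0"
    using E by (simp add: power2_eq_square algebra_simps)
  then have E': "2 * f1^2 * X + f1 * X + 1 + 2 * Q - (f1^2 + f2) * (4 * X) - f1 * (2 * n + \<rho>^2) \<le> 0"
    using assms(1) by (simp add: mult_le_0_iff)
  have a1: "2 * a * (- \<rho> / 2 - (- \<rho> * f1)) = \<rho>^2 * G"
    using assms(2) by (simp add: a_def G_def power2_eq_square field_simps)
  have a2: "n * a^2 = \<rho>^2 * G / 2"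
    using assms(2) by (simp add: a_def G_def power2_eq_square field_simps)
  have "a^2 \<ge> 0" by simp
  moreover have "(n - 1) * a^2 = \<rho>^2 * G / 2 - a^2" using a2 by (simp add: algebra_simps)
  moreover have "(- \<rho> * f1)^2 = \<rho>^2 * f1^2" by (simp add: power_mult_distrib)
  ultimately have "2 * Q \<ge> 2 * (\<rho>^2 * f1^2) + \<rho>^2 * G"
    using Q[of a] unfolding a1 by linarith
  then show ?thesis
    using E' unfolding X G_def[symmetric] by (simp add: algebra_simps)
qed

context spacelike_chart
begin

section \<open>Properness of the pseudo-distance\<close>

lemma hor_S [simp]: "hor (S v) = fst v" and ver_S [simp]: "ver (S v) = snd v"
  by (simp_all add: hor_def ver_def)

lemma differentiable_height: "height differentiable (at x)" "dd v height differentiable (at x)"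
  using smooth_on_differentiable smooth_on_dd smooth_height by blast+

text \<open>The mean value theorem on the segment from the origin, where the height is 0, applied to
  the component of the height along its own final value; this keeps the strict slope bound.\<close>

lemma height_less_norm:
  assumes "x \<noteq> 0" shows "norm (height x) < norm x"
proof (cases "height x = 0")
  case True
  then show ?thesis using assms by simp
next
  case False
  define f where "f y = height x \<bullet> height y" for y
  have sm: "smooth_on UNIV f"
    unfolding f_def by (intro smooth_on_inner smooth_on_const smooth_height open_UNIV)
  have d: "((\<lambda>t. f (t *\<^sub>R x)) has_real_derivative dd x f (t *\<^sub>R x)) (at t)" for t
    using has_real_derivative_along_line[OF sm, where x = 0 and v = x and t = t] by simp
  have "\<exists>t>0. t < 1 \<and> f (1 *\<^sub>R x) - f (0 *\<^sub>R x) = (1 - 0) * dd x f (t *\<^sub>R x)"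
    by (rule MVT2[of 0 1 "\<lambda>t. f (t *\<^sub>R x)"]) (use d in auto)
  then obtain t where "f x - f 0 = dd x f (t *\<^sub>R x)" by auto
  then have "height x \<bullet> height x = height x \<bullet> dd x height (t *\<^sub>R x)"
    by (simp add: f_def[abs_def] height_0 dd_inner_const[OF differentiable_height(1)])
  also have "\<dots> \<le> norm (height x) * norm (dd x height (t *\<^sub>R x))"
    by (rule norm_cauchy_schwarz)
  also have "\<dots> < norm (height x) * norm x"
    using False dd_height_less[OF assms] by simp
  finally show ?thesis using False by (simp add: power2_norm_eq_inner[symmetric] power2_eq_square)
qed

lemma pseudo_distance_graph_map: "pseudo_distance (graph_map x) = x \<bullet> x - height x \<bullet> height x"
  by (simp add: pseudo_distance_def pseudo_inner_hor_ver hor_graph_map height_def)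

lemma pseudo_distance_nonneg: "pseudo_distance (graph_map x) \<ge> 0"
proof (cases "x = 0")
  case False
  then show ?thesis
    using height_less_norm[of x] by (simp add: pseudo_distance_graph_map norm_lt less_imp_le)
qed (simp add: pseudo_distance_graph_map height_0)

text \<open>By compactness |x| - |height x| is at least some \<delta> > 0 on the unit sphere, and
  the Lipschitz bound keeps this gap further out on each ray. The pseudo-distance is the gap times
  |x| + |height x|, hence grows at least linearly.\<close>

lemma pseudo_distance_proper:
  obtains \<delta> where "\<delta> > 0" "\<And>x. 1 \<le> norm x \<Longrightarrow> \<delta> * norm x \<le> pseudo_distance (graph_map x)"
proof -
  have "continuous_on (sphere 0 1) (\<lambda>x. norm (height x))"
    using smooth_on_continuous_on[OF smooth_height] continuous_on_subset
    by (intro continuous_on_norm) blast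
  then obtain u where u: "u \<in> sphere 0 1" "\<And>x. x \<in> sphere 0 1 \<Longrightarrow> norm (height x) \<le> norm (height u)"
    using continuous_attains_sup[OF compact_sphere, of "0 :: real^'n" 1 "\<lambda>x. norm (height x)"] by auto
  define \<delta> where "\<delta> = 1 - norm (height u)"
  have "u \<noteq> 0" using u(1) by auto
  then have \<delta>: "\<delta> > 0" using height_less_norm[of u] u(1) by (simp add: \<delta>_def)
  have "\<delta> * norm x \<le> pseudo_distance (graph_map x)" if x: "1 \<le> norm x" for x
  proof -
    have x0: "x \<noteq> 0" using x by auto
    define y where "y = (1 / norm x) *\<^sub>R x"
    have ny: "norm y = 1" using x by (auto simp: y_def)
    have "norm (x - y) = norm x - 1"
    proof -
      have "x - y = (1 - 1 / norm x) *\<^sub>R x" by (simp add: y_def algebra_simps)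
      moreover have "1 - 1 / norm x \<ge> 0" using x x0 by (simp add: divide_le_eq)
      ultimately have "norm (x - y) = (1 - 1 / norm x) * norm x" by simp
      also have "\<dots> = norm x - 1" using x0 by (simp add: left_diff_distrib)
      finally show ?thesis .
    qed
    then have "norm (height x - height y) \<le> norm x - 1"
      using section_lipschitz[OF open_UNIV convex_UNIV section_graph_map UNIV_I UNIV_I, of x y]
      by (simp add: height_def)
    moreover have "norm (height y) \<le> norm (height u)" using u(2) ny by simp
    moreover have "norm (height x) \<le> norm (height x - height y) + norm (height y)"
      by (metis norm_triangle_sub add.commute)
    ultimately have "norm x - norm (height x) \<ge> \<delta>" by (simp add: \<delta>_def)
    then have "\<delta> * norm x \<le> (norm x - norm (height x)) * (norm x + norm (height x))"
      using \<delta> by (intro mult_mono) auto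
    also have "\<dots> = pseudo_distance (graph_map x)"
      by (simp add: pseudo_distance_graph_map power2_norm_eq_inner[symmetric] power2_eq_square algebra_simps)
    finally show ?thesis .
  qed
  then show thesis using that \<delta> by blast
qed

text \<open>The normal vectors at \<open>graph_map x\<close> are the vectors \<open>S (conormal x c, c)\<close>, and \<open>support x c\<close> is the
  product of such a vector with the position vector.\<close>

definition conormal :: "real^'n \<Rightarrow> real^'m \<Rightarrow> real^'n" where
  "conormal x c = (\<chi> k. c \<bullet> dd (axis k 1) height x)"

lemma inner_conormal: "v \<bullet> conormal x c = c \<bullet> dd v height x"
proof -
  have "v \<bullet> conormal x c = (\<Sum>k\<in>UNIV. v $ k * (c \<bullet> dd (axis k 1) height x))"
    by (simp add: inner_vec_def[of v] conormal_def)
  also have "\<dots> = c \<bullet> dd v height x"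
    unfolding linear_expand_axis[OF linear_dd_height, of v x] by (simp add: inner_sum_right)
  finally show ?thesis .
qed

lemma conormal_0: "conormal x 0 = 0"
  by (simp add: conormal_def vec_eq_iff)

text \<open>\<open>conormal x\<close> is the adjoint of the derivative of the height, and the
  adjoint of a strict contraction is one.\<close>

lemma conormal_less:
  assumes "c \<noteq> 0" shows "norm (conormal x c) < norm c"
proof (cases "conormal x c = 0")
  case False
  have "conormal x c \<bullet> conormal x c = c \<bullet> dd (conormal x c) height x" by (rule inner_conormal)
  also have "\<dots> \<le> norm c * norm (dd (conormal x c) height x)" by (rule norm_cauchy_schwarz)
  also have "\<dots> < norm c * norm (conormal x c)"
    using assms dd_height_less[OF False] by simp
  finally show ?thesis using False by (simp add: power2_norm_eq_inner[symmetric] power2_eq_square)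
qed (use assms in simp)

lemma normal_space_iff: "w \<in> normal_space M (graph_map x) \<longleftrightarrow> hor w = conormal x (ver w)"
proof -
  have "w \<in> normal_space M (graph_map x) \<longleftrightarrow> (\<forall>v. v \<bullet> hor w = v \<bullet> conormal x (ver w))"
    by (auto simp: normal_space_def tangent_space_eq pseudo_inner_hor_ver inner_conormal inner_commute)
  then show ?thesis by (metis vector_eq_ldot)
qed

definition support :: "real^'n \<Rightarrow> real^'m \<Rightarrow> real" where
  "support x c = c \<bullet> (dd x height x - height x)"

lemma pseudo_inner_normal:
  assumes "w \<in> normal_space M (graph_map x)"
  shows "pseudo_inner (graph_map x) w = support x (ver w)"
    and "pseudo_inner w w = (norm (conormal x (ver w)))^2 - (norm (ver w))^2"
  using assms
  by (simp_all add: normal_space_iff support_def pseudo_inner_hor_ver hor_graph_map height_def[symmetric]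
      inner_conormal inner_diff_right inner_commute[of "height x"] power2_norm_eq_inner)

lemma normal_nonpos:
  assumes "p \<in> M" "w \<in> normal_space M p"
  shows "pseudo_inner w w \<le> 0" "w \<noteq> 0 \<Longrightarrow> pseudo_inner w w < 0"
proof -
  obtain x where x: "p = graph_map x" using assms(1) M_eq by blast
  have h: "hor w = conormal x (ver w)" using assms(2) by (simp add: x normal_space_iff)
  have lt: "pseudo_inner w w < 0" if "ver w \<noteq> 0"
    using conormal_less[OF that, of x] pseudo_inner_normal(2)[of w x] assms(2)
    by (simp add: x power_strict_mono)
  moreover have z: "w = 0" if "ver w = 0"
  proof -
    have "w = S 0" using S_hor_ver[of w] h that by (simp add: conormal_0 zero_prod_def)
    then show ?thesis using linear_0[OF linear_S] by simp
  qed
  ultimately show "pseudo_inner w w < 0" if "w \<noteq> 0" using that by blast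
  then show "pseudo_inner w w \<le> 0"
    by (cases "w = 0") (auto simp: pseudo_inner_def)
qed

text \<open>The usual argument with the metric negative definite on the normal space: the two
  changes of sign cancel, so the inequality keeps its familiar direction.\<close>

lemma normal_cauchy_schwarz:
  assumes p: "p \<in> M" and w: "w \<in> normal_space M p" "v \<in> normal_space M p"
  shows "(pseudo_inner w v)^2 \<le> pseudo_inner w w * pseudo_inner v v"
proof (cases "v = 0")
  case True then show ?thesis by (simp add: pseudo_inner_def)
next
  case False
  let ?v = "pseudo_inner v v" and ?m = "pseudo_inner w v"
  have v: "?v < 0" using normal_nonpos[OF p w(2)] False by blast
  define t where "t = ?m / ?v"
  have "w - t *\<^sub>R v \<in> normal_space M p"
    using w subspace_normal subspace_diff subspace_scale by blast
  then have "pseudo_inner (w - t *\<^sub>R v) (w - t *\<^sub>R v) \<le> 0" using normal_nonpos(1)[OF p] by blast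
  then have "pseudo_inner w w - 2 * t * ?m + t * t * ?v \<le> 0"
    by (simp add: pseudo_inner_diff_left pseudo_inner_diff_right pseudo_inner_scaleR_left
        pseudo_inner_scaleR_right pseudo_inner_commute[of v w] algebra_simps)
  moreover have "t * ?v = ?m" using v by (simp add: t_def)
  then have "t * t * ?v = t * ?m" by simp
  ultimately have "pseudo_inner w w \<le> t * ?m" by simp
  then have "(t * ?m) * ?v \<le> pseudo_inner w w * ?v" using v by (intro mult_right_mono_neg) auto
  moreover have "(t * ?m) * ?v = ?m^2" using \<open>t * ?v = ?m\<close> by (simp add: power2_eq_square algebra_simps)
  ultimately show ?thesis by simp
qed

text \<open>Only the normal part of \<open>p\<close>, which is -2 H, pairs with a normal vector;
  Cauchy-Schwarz in the normal space then produces the factor 4.\<close>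

lemma normal_component_bound:
  assumes "spacelike_self_shrinker M" "p \<in> M" "w \<in> normal_space M p"
  shows "(pseudo_inner p w)^2 \<le> 4 * mean_curvature_norm_sq M p * (- pseudo_inner w w)"
proof -
  let ?N = "normal_part M p p"
  note mem = normal_part_mem[OF assms(2), of p]
  have H: "mean_curvature M p = - (1/2) *\<^sub>R ?N"
    using assms(1,2) by (simp add: spacelike_self_shrinker_def)
  have "4 * mean_curvature_norm_sq M p = - pseudo_inner ?N ?N"
    unfolding mean_curvature_norm_sq_def H by (simp add: pseudo_inner_scaleR_left pseudo_inner_scaleR_right del: scaleR_minus_left)
  moreover have "pseudo_inner (p - ?N) w = 0"
    using mem(2) assms(3) by (simp add: normal_space_def)
  then have "pseudo_inner p w = pseudo_inner ?N w" by (simp add: pseudo_inner_diff_left)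
  ultimately show ?thesis
    using normal_cauchy_schwarz[OF assms(2) mem(1) assms(3)] by simp
qed

lemma support_bound:
  assumes "spacelike_self_shrinker M" "mean_curvature_norm_sq M (graph_map x) \<le> B"
  shows "(support x c)^2 \<le> 4 * B * ((norm c)^2 - (norm (conormal x c))^2)"
proof -
  let ?w = "S (conormal x c, c)"
  have w: "?w \<in> normal_space M (graph_map x)" by (simp add: normal_space_iff)
  have "(support x c)^2 \<le> 4 * mean_curvature_norm_sq M (graph_map x) * ((norm c)^2 - (norm (conormal x c))^2)"
    using normal_component_bound[OF assms(1) graph_map_mem w] pseudo_inner_normal[OF w] by simp
  also have "\<dots> \<le> 4 * B * ((norm c)^2 - (norm (conormal x c))^2)"
    using assms(2) conormal_less[of c x] by (cases "c = 0") (auto intro!: mult_right_mono power_mono simp: conormal_0)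
  finally show ?thesis .
qed

end

section \<open>The maximum principle\<close>

context spacelike_chart
begin

section \<open>Existence of a weighted maximum\<close>

lemma norm_conormal_sq: "(norm (conormal x c))^2 = (\<Sum>k\<in>UNIV. (c \<bullet> dd (axis k 1) height x)^2)"
  unfolding power2_norm_eq_inner inner_vec_def[of "conormal x c"] by (simp add: conormal_def power2_eq_square)

lemma radial_derivative_expand: "dd x height x = (\<Sum>k\<in>UNIV. x $ k *\<^sub>R dd (axis k 1) height x)"
  by (rule linear_expand_axis[OF linear_dd_height])

text \<open>The quotient \<theta> of the squared support by the square of the normal vector and the
  weight is invariant under scaling of \<open>c\<close>, so directions may be taken on the unit
  sphere. Far out it stays below its positive value at the given point, which leaves a compact set
  of pairs.\<close>

lemma weighted_support_maximum:
  assumes bound: "\<And>x c. (support x c)^2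
      \<le> 4 * exp (\<alpha> * pseudo_distance (graph_map x)) * ((norm c)^2 - (norm (conormal x c))^2)"
    and "\<alpha> < 1/8" "k > 0" "support x1 c1 \<noteq> 0"
  obtains K x0 c0 where "K > 0" "c0 \<noteq> 0"
    "(support x0 c0)^2 = K * ((norm c0)^2 - (norm (conormal x0 c0))^2) * exp (weight k (pseudo_distance (graph_map x0)))"
    "\<And>x c. (support x c)^2 \<le> K * ((norm c)^2 - (norm (conormal x c))^2) * exp (weight k (pseudo_distance (graph_map x)))"
proof -
  define z where "z x = pseudo_distance (graph_map x)" for x
  define D where "D x c = (norm c)^2 - (norm (conormal x c))^2" for x c
  define \<theta> where "\<theta> x c = (support x c)^2 / D x c * exp (- weight k (z x))" for x c
  have z0: "z x \<ge> 0" for x by (simp add: z_def pseudo_distance_nonneg)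
  have D: "D x c > 0" if "c \<noteq> 0" for x c
    using conormal_less[OF that, of x] by (simp add: D_def power_strict_mono)
  have bound: "(support x c)^2 \<le> 4 * exp (\<alpha> * z x) * D x c" for x c
    using bound[of x c] unfolding z_def D_def .
  have \<theta>_le: "\<theta> x c \<le> 4 * exp (\<alpha> * z x - weight k (z x))" if "c \<noteq> 0" for x c
  proof -
    have "(support x c)^2 / D x c \<le> 4 * exp (\<alpha> * z x)"
      using bound[of x c] D[OF that, of x] by (simp add: divide_le_eq)
    then have "\<theta> x c \<le> 4 * exp (\<alpha> * z x) * exp (- weight k (z x))"
      unfolding \<theta>_def by (intro mult_right_mono) auto
    then show ?thesis by (simp add: exp_diff exp_minus divide_inverse)
  qed
  have hom: "\<theta> x (r *\<^sub>R c) = \<theta> x c" if "r \<noteq> 0" for x r c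
  proof -
    have "support x (r *\<^sub>R c) = r * support x c" by (simp add: support_def)
    moreover have "conormal x (r *\<^sub>R c) = r *\<^sub>R conormal x c" by (simp add: conormal_def vec_eq_iff)
    then have "D x (r *\<^sub>R c) = r^2 * D x c" by (simp add: D_def power_mult_distrib algebra_simps)
    ultimately show ?thesis using that by (simp add: \<theta>_def power_mult_distrib)
  qed
  have "c1 \<noteq> 0" using assms(4) by (auto simp: support_def)
  define \<theta>1 where "\<theta>1 = \<theta> x1 c1"
  have \<theta>1: "\<theta>1 > 0" using assms(4) D[OF \<open>c1 \<noteq> 0\<close>, of x1] by (simp add: \<theta>1_def \<theta>_def)
  obtain \<epsilon> B where \<epsilon>: "\<epsilon> > 0" "\<And>t. t \<ge> 0 \<Longrightarrow> \<alpha> * t - weight k t \<le> B - \<epsilon> * t"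
    using weight_growth[OF assms(3,2)] by metis
  obtain \<delta> where \<delta>: "\<delta> > 0" "\<And>x. 1 \<le> norm x \<Longrightarrow> \<delta> * norm x \<le> z x"
    using pseudo_distance_proper unfolding z_def by metis
  \<comment> \<open>1 is the radius from which the linear growth of \<open>z\<close> holds,
    \<open>norm x1\<close> puts the comparison point into the ball, and beyond the last radius the
    bound \<open>4 * exp (B - \<epsilon> * z x)\<close> is at most \<theta>1.\<close>
  define R where "R = max 1 (max (norm x1) ((B - ln (\<theta>1 / 4)) / (\<epsilon> * \<delta>)))"
  have R: "1 \<le> R" "norm x1 \<le> R" "(B - ln (\<theta>1 / 4)) / (\<epsilon> * \<delta>) \<le> R" by (auto simp: R_def)
  have far: "\<theta> x c \<le> \<theta>1" if "c \<noteq> 0" "R \<le> norm x" for x c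
  proof -
    have "B - ln (\<theta>1 / 4) \<le> R * (\<epsilon> * \<delta>)" using R(3) \<epsilon>(1) \<delta>(1) by (simp add: divide_le_eq)
    also have "\<dots> \<le> norm x * (\<epsilon> * \<delta>)" using that \<epsilon>(1) \<delta>(1) by (intro mult_right_mono) auto
    also have "\<dots> \<le> \<epsilon> * z x"
      using mult_left_mono[OF \<delta>(2)[of x], of \<epsilon>] R(1) that \<epsilon>(1) by (simp add: ac_simps)
    finally have "\<alpha> * z x - weight k (z x) \<le> ln (\<theta>1 / 4)" using \<epsilon>(2)[OF z0, of x] by simp
    then have "exp (\<alpha> * z x - weight k (z x)) \<le> \<theta>1 / 4" using \<theta>1 by (simp add: ln_ge_iff)
    then show ?thesis using \<theta>_le[OF that(1), of x] by simp
  qed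
  have cdd: "continuous_on A (\<lambda>p. dd (axis j 1) height (fst p))" for A :: "((real^'n) \<times> (real^'m)) set" and j
    by (rule continuous_on_compose2[OF smooth_on_continuous_on[OF smooth_on_dd[OF smooth_height]]])
      (auto intro!: continuous_intros)
  have ch: "continuous_on A (\<lambda>p. height (fst p))" for A :: "((real^'n) \<times> (real^'m)) set"
    by (rule continuous_on_compose2[OF smooth_on_continuous_on[OF smooth_height]])
      (auto intro!: continuous_intros)
  have cw: "continuous_on {0..} (weight k)"
    by (rule DERIV_continuous_on[OF has_field_derivative_at_within[OF weight_deriv(1)[OF assms(3)]]]) simp
  have cz: "continuous_on A (\<lambda>p. z (fst p))" for A :: "((real^'n) \<times> (real^'m)) set"
    unfolding z_def pseudo_distance_graph_map by (intro continuous_intros ch)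
  have cwz: "continuous_on A (\<lambda>p. weight k (z (fst p)))" for A :: "((real^'n) \<times> (real^'m)) set"
    by (rule continuous_on_compose2[OF cw cz]) (use z0 in auto)
  have cont: "continuous_on (cball 0 R \<times> sphere 0 1) (\<lambda>p. \<theta> (fst p) (snd p))"
    unfolding \<theta>_def support_def radial_derivative_expand D_def
  proof (intro continuous_intros cwz ch cdd)
    show "\<forall>p\<in>cball 0 R \<times> sphere 0 1. (norm (snd p))^2 - (norm (conormal (fst p) (snd p)))^2 \<noteq> 0"
    proof
      fix p :: "(real^'n) \<times> (real^'m)" assume "p \<in> cball 0 R \<times> sphere 0 1"
      then have "snd p \<noteq> 0" by auto
      then show "(norm (snd p))^2 - (norm (conormal (fst p) (snd p)))^2 \<noteq> 0"
        using D[of "snd p" "fst p"] unfolding D_def by (intro less_imp_neq[THEN not_sym])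
    qed
    show "continuous_on (cball 0 R \<times> sphere 0 1) (\<lambda>p. conormal (fst p) (snd p))"
      unfolding conormal_def by (intro continuous_on_vec_lambda continuous_intros cdd)
  qed
  have ne: "x1 \<in> cball 0 R" "(1 / norm c1) *\<^sub>R c1 \<in> sphere 0 1" using R(2) \<open>c1 \<noteq> 0\<close> by auto
  then have nonempty: "cball 0 R \<times> sphere 0 1 \<noteq> ({} :: ((real^'n) \<times> (real^'m)) set)" by blast
  have "\<exists>p\<in>cball 0 R \<times> sphere 0 1. \<forall>q\<in>cball 0 R \<times> sphere 0 1. \<theta> (fst q) (snd q) \<le> \<theta> (fst p) (snd p)"
    by (rule continuous_attains_sup[OF compact_Times[OF compact_cball compact_sphere] nonempty cont])
  then obtain p where p: "p \<in> cball 0 R \<times> sphere 0 1"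
    "\<And>q. q \<in> cball 0 R \<times> sphere 0 1 \<Longrightarrow> \<theta> (fst q) (snd q) \<le> \<theta> (fst p) (snd p)"
    by (elim bexE) (use that in blast)
  define K where "K = \<theta> (fst p) (snd p)"
  have K1: "\<theta>1 \<le> K"
    using p(2)[of "(x1, (1 / norm c1) *\<^sub>R c1)"] ne hom[of "1 / norm c1" x1 c1] \<open>c1 \<noteq> 0\<close>
    by (simp add: K_def \<theta>1_def)
  have max: "\<theta> x c \<le> K" if "c \<noteq> 0" for x c
  proof (cases "R \<le> norm x")
    case True
    then show ?thesis using far[OF that, of x] K1 by simp
  next
    case False
    then show ?thesis
      using p(2)[of "(x, (1 / norm c) *\<^sub>R c)"] hom[of "1 / norm c" x c] that by (simp add: K_def)
  qed
  have eq: "(support x c)^2 = \<theta> x c * D x c * exp (weight k (z x))" if "c \<noteq> 0" for x c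
    using D[OF that, of x] by (simp add: \<theta>_def exp_minus)
  show thesis
  proof (rule that[of K "snd p" "fst p"])
    show "K > 0" using K1 \<theta>1 by simp
    show c0: "snd p \<noteq> 0" using p(1) by auto
    show "(support (fst p) (snd p))^2 = K * ((norm (snd p))^2 - (norm (conormal (fst p) (snd p)))^2)
        * exp (weight k (pseudo_distance (graph_map (fst p))))"
      using eq[OF c0, of "fst p"] by (simp add: K_def D_def z_def)
    show "(support x c)^2 \<le> K * ((norm c)^2 - (norm (conormal x c))^2) * exp (weight k (pseudo_distance (graph_map x)))" for x c
    proof (cases "c = 0")
      case False
      then have "\<theta> x c * D x c * exp (weight k (z x)) \<le> K * D x c * exp (weight k (z x))"
        using max[OF False, of x] D[OF False, of x] by (intro mult_right_mono) auto
      then show ?thesis using eq[OF False, of x] by (simp add: D_def z_def)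
    qed (simp add: support_def conormal_0)
  qed
qed

text \<open>At a point with horizontal tangent space the metric agrees with the Euclidean one up to second
  order, so the Euclidean Laplacian may replace the trace, also after one differentiation.\<close>

lemma differentiated_equation:
  assumes shrinker: "spacelike_self_shrinker M" and flat: "\<And>v. dd v height x0 = 0"
    and P: "P = (\<lambda>x. c \<bullet> height x)"
  shows "(\<Sum>k\<in>UNIV. dd (axis k 1) (dd (axis k 1) P) x0) = - P x0 / 2"
    and "(\<Sum>k\<in>UNIV. dd v (dd (axis k 1) (dd (axis k 1) P)) x0) = (\<Sum>j\<in>UNIV. x0 $ j * dd v (dd (axis j 1) P) x0) / 2"
proof -
  have smP: "smooth_on UNIV P"
    unfolding P by (intro smooth_on_inner smooth_on_const smooth_height open_UNIV)
  have dP: "dd v P = (\<lambda>x. c \<bullet> dd v height x)" for v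
    unfolding P by (rule ext) (rule dd_inner_const[OF differentiable_height(1)])
  have ddP: "dd v (dd w P) x = c \<bullet> dd v (dd w height) x" for v w x
    unfolding dP by (rule dd_inner_const[OF differentiable_height(2)])
  have diffP: "P differentiable (at x)" "dd v P differentiable (at x)" "dd v (dd w P) differentiable (at x)"
    "dd v (dd w (dd u P)) differentiable (at x)" for u v w x
    using smP by (meson smooth_on_dd smooth_on_differentiable UNIV_I)+
  obtain C :: "'n \<Rightarrow> real^'n \<Rightarrow> real^'n" where smC: "\<And>i. smooth_on UNIV (C i)"
    and C: "\<And>x i j. C i x \<bullet> C j x - dd (C i x) height x \<bullet> dd (C j x) height x = (if i = j then 1 else 0)"
    using orthonormal_field by metis
  define h where "h x = (\<Sum>k\<in>UNIV. dd (axis k 1) (dd (axis k 1) P) x)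
    - (1/2) * ((\<Sum>j\<in>UNIV. x $ j * dd (axis j 1) P x) - P x)" for x
  \<comment> \<open>The exact error when the metric trace is replaced by the Euclidean Laplacian.
    Its first bracket is a product of two factors that vanish at \<open>x0\<close>, so both
    \<open>h\<close> and its derivative are 0 there.\<close>
  define e where "e i k x = (dd (axis k 1) height x \<bullet> dd (C i x) height x) * dd (C i x) (dd (axis k 1) P) x" for i k x
  have he: "h x = - (\<Sum>i\<in>UNIV. \<Sum>k\<in>UNIV. e i k x)" for x
  proof -
    have "(\<Sum>k\<in>UNIV. dd (axis k 1) (dd (axis k 1) P) x) = (\<Sum>i\<in>UNIV. dd (C i x) (dd (C i x) P) x)
      - (\<Sum>i\<in>UNIV. \<Sum>k\<in>UNIV. (dd (axis k 1) height x \<bullet> dd (C i x) height x) *\<^sub>R dd (C i x) (dd (axis k 1) P) x)"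
      by (rule trace_standard_basis[of "\<lambda>v. dd v height x" "\<lambda>i. C i x" "\<lambda>v w. dd v (dd w P) x",
          OF linear_dd_height C linear_dd_dd(2)[OF smP] linear_dd_dd(1)[OF smP]])
    also have "(\<Sum>i\<in>UNIV. dd (C i x) (dd (C i x) P) x) = c \<bullet> (\<Sum>i\<in>UNIV. dd (C i x) (dd (C i x) height) x)"
      by (simp add: ddP inner_sum_right)
    also have "\<dots> = (1/2) * (dd x P x - P x)"
      unfolding self_shrinker_equation[OF shrinker C] by (simp add: dP inner_diff_right) (simp add: P)
    also have "dd x P x = (\<Sum>j\<in>UNIV. x $ j * dd (axis j 1) P x)"
      using linear_expand_axis[OF linear_dd[OF diffP(1)], of x x] by simp
    finally show ?thesis by (simp add: h_def e_def)
  qed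
  have dC: "(\<lambda>x. dd (C i x) height x) differentiable (at x0)" for i
  proof -
    have sm: "smooth_on UNIV (\<lambda>x. \<Sum>k\<in>UNIV. C i x $ k *\<^sub>R dd (axis k 1) height x)"
      by (intro smooth_on_sum smooth_on_scaleR smooth_on_nth smooth_on_dd smooth_height smC open_UNIV)
    have eq: "(\<lambda>x. dd (C i x) height x) = (\<lambda>x. \<Sum>k\<in>UNIV. C i x $ k *\<^sub>R dd (axis k 1) height x)"
      by (rule ext) (rule linear_expand_axis[OF linear_dd_height])
    show ?thesis
      unfolding eq by (rule smooth_on_differentiable[OF sm UNIV_I])
  qed
  have dCP: "(\<lambda>x. dd (C i x) (dd (axis k 1) P) x) differentiable (at x0)" for i k
  proof -
    have sm: "smooth_on UNIV (\<lambda>x. \<Sum>l\<in>UNIV. C i x $ l *\<^sub>R dd (axis l 1) (dd (axis k 1) P) x)"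
      by (intro smooth_on_sum smooth_on_scaleR smooth_on_nth smooth_on_dd smP smC open_UNIV)
    have eq: "(\<lambda>x. dd (C i x) (dd (axis k 1) P) x)
        = (\<lambda>x. \<Sum>l\<in>UNIV. C i x $ l *\<^sub>R dd (axis l 1) (dd (axis k 1) P) x)"
      by (rule ext) (rule linear_expand_axis[OF linear_dd[OF diffP(2)]])
    show ?thesis
      unfolding eq by (rule smooth_on_differentiable[OF sm UNIV_I])
  qed
  have "(e i k has_derivative (\<lambda>v. 0)) (at x0)" for i k
    unfolding e_def[abs_def]
    by (rule has_derivative_zero_product[OF differentiable_height(2) dC dCP]) (simp_all add: flat)
  then have "((\<lambda>x. - (\<Sum>i\<in>UNIV. \<Sum>k\<in>UNIV. e i k x)) has_derivative (\<lambda>v. - (\<Sum>i::'n\<in>UNIV. \<Sum>k::'n\<in>UNIV. 0))) (at x0)"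
    by (intro has_derivative_minus has_derivative_sum)
  then have h0: "(h has_derivative (\<lambda>v. 0)) (at x0)" by (simp add: he[abs_def])
  have "(h has_derivative (\<lambda>v. (\<Sum>k\<in>UNIV. dd v (dd (axis k 1) (dd (axis k 1) P)) x0)
      - (1/2) * ((\<Sum>j\<in>UNIV. x0 $ j * dd v (dd (axis j 1) P) x0 + v $ j * dd (axis j 1) P x0) - dd v P x0))) (at x0)"
    unfolding h_def[abs_def]
    by (intro has_derivative_diff has_derivative_sum has_derivative_mult_right
        has_derivative_weighted_axis_sum has_derivative_dd diffP)
  from has_derivative_unique[OF this h0]
  have "(\<Sum>k\<in>UNIV. dd v (dd (axis k 1) (dd (axis k 1) P)) x0)
      - (1/2) * ((\<Sum>j\<in>UNIV. x0 $ j * dd v (dd (axis j 1) P) x0 + v $ j * dd (axis j 1) P x0) - dd v P x0) = 0"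
    by meson
  then show "(\<Sum>k\<in>UNIV. dd v (dd (axis k 1) (dd (axis k 1) P)) x0) = (\<Sum>j\<in>UNIV. x0 $ j * dd v (dd (axis j 1) P) x0) / 2"
    by (simp add: dP flat)
  have "h x0 = 0" by (simp add: he e_def flat)
  then show "(\<Sum>k\<in>UNIV. dd (axis k 1) (dd (axis k 1) P) x0) = - P x0 / 2"
    by (simp add: h_def dP flat)
qed

text \<open>The bound is used for one constant \<open>c\<close>, the direction of the height at
  \<open>x0\<close>, where flatness turns \<open>eq\<close> into equality in the bound. The tests
  along all axes are summed, and third derivatives and traces are removed by the differentiated
  equation.\<close>

lemma flat_maximum_impossible:
  assumes shrinker: "spacelike_self_shrinker M" and flat: "\<And>v. dd v height x0 = 0"
    and "height x0 \<noteq> 0" and k: "k = 2 * (real CARD('n))^2"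
    and bound: "\<And>x c. (support x c)^2
      \<le> K * ((norm c)^2 - (norm (conormal x c))^2) * exp (weight k (pseudo_distance (graph_map x)))"
    and eq: "(norm (height x0))^2 = K * exp (weight k (pseudo_distance (graph_map x0)))"
  shows False
proof -
  define \<rho> where "\<rho> = norm (height x0)"
  define c where "c = (1 / \<rho>) *\<^sub>R height x0"
  have \<rho>: "\<rho> > 0" using assms(3) by (simp add: \<rho>_def)
  have c: "norm c = 1" "height x0 = \<rho> *\<^sub>R c" using \<rho> by (simp_all add: c_def \<rho>_def)
  have k0: "k > 0" by (simp add: k)
  define P where "P = (\<lambda>x. c \<bullet> height x)"
  define ax where "ax j = (axis j 1 :: real^'n)" for j
  have smP: "smooth_on UNIV P"
    unfolding P_def by (intro smooth_on_inner smooth_on_const smooth_height open_UNIV)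
  have dP: "dd v P = (\<lambda>x. c \<bullet> dd v height x)" for v
    unfolding P_def by (rule ext) (rule dd_inner_const[OF differentiable_height(1)])
  have diffP: "P differentiable (at x)" "dd v P differentiable (at x)" "dd v (dd w P) differentiable (at x)" for v w x
    using smP by (meson smooth_on_dd smooth_on_differentiable UNIV_I)+
  have P0: "P x0 = \<rho>" using c by (simp add: P_def power2_norm_eq_inner[symmetric])
  \<comment> \<open>Up to sign this is \<open>support x c\<close>; likewise \<open>q\<close> is the
    squared norm of \<open>conormal x c\<close> and \<open>z\<close> the pseudo-distance, written
    out in derivatives of \<open>P\<close>.\<close>
  define N where "N x = P x - (\<Sum>j\<in>UNIV. x $ j * dd (ax j) P x)" for x
  define q where "q x = (\<Sum>j\<in>UNIV. dd (ax j) P x * dd (ax j) P x)" for x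
  define z where "z x = x \<bullet> x - height x \<bullet> height x" for x
  have smN: "smooth_on UNIV N"
    unfolding N_def
    by (intro smooth_on_diff smooth_on_sum smooth_on_mult smooth_on_vec_nth smooth_on_dd smP open_UNIV)
  have smq: "smooth_on UNIV q"
    unfolding q_def by (intro smooth_on_sum smooth_on_mult smooth_on_dd smP open_UNIV)
  have smz: "smooth_on UNIV z"
    unfolding z_def
    by (intro smooth_on_diff smooth_on_inner smooth_height smooth_on_linear open_UNIV linear_ident)
  define S where "S i j = dd (ax i) (dd (ax j) P) x0" for i j
  have dN: "dd v N = (\<lambda>x. - (\<Sum>j\<in>UNIV. x $ j * dd v (dd (ax j) P) x))" for v
  proof
    fix x
    have "(N has_derivative (\<lambda>v. dd v P x - (\<Sum>j\<in>UNIV. x $ j * dd v (dd (ax j) P) x + v $ j * dd (ax j) P x))) (at x)"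
      unfolding N_def[abs_def]
      by (intro has_derivative_diff has_derivative_weighted_axis_sum has_derivative_dd diffP)
    moreover have "dd v P x = (\<Sum>j\<in>UNIV. v $ j * dd (ax j) P x)"
      using linear_expand_axis[OF linear_dd[OF diffP(1)], of v x] by (simp add: ax_def)
    ultimately show "dd v N x = - (\<Sum>j\<in>UNIV. x $ j * dd v (dd (ax j) P) x)"
      using dd_eq by (fastforce simp: sum.distrib)
  qed
  have ddN: "dd (ax i) (dd (ax i) N) x0 = - (\<Sum>j\<in>UNIV. x0 $ j * dd (ax i) (dd (ax i) (dd (ax j) P)) x0) - S i i" for i
  proof -
    have "((\<lambda>x. - (\<Sum>j\<in>UNIV. x $ j * dd (ax i) (dd (ax j) P) x)) has_derivative
        (\<lambda>v. - (\<Sum>j\<in>UNIV. x0 $ j * dd v (dd (ax i) (dd (ax j) P)) x0 + v $ j * dd (ax i) (dd (ax j) P) x0))) (at x0)"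
      by (intro has_derivative_minus has_derivative_weighted_axis_sum diffP)
    then have "dd (ax i) (dd (ax i) N) x0
        = - (\<Sum>j\<in>UNIV. x0 $ j * dd (ax i) (dd (ax i) (dd (ax j) P)) x0 + ax i $ j * S i j)"
      unfolding dN S_def by (rule dd_eq)
    also have "(\<Sum>j\<in>UNIV. ax i $ j * S i j) = S i i"
      by (simp add: ax_def axis_def if_distrib if_distribR cong: if_cong)
    then have "- (\<Sum>j\<in>UNIV. x0 $ j * dd (ax i) (dd (ax i) (dd (ax j) P)) x0 + ax i $ j * S i j)
        = - (\<Sum>j\<in>UNIV. x0 $ j * dd (ax i) (dd (ax i) (dd (ax j) P)) x0) - S i i"
      by (simp add: sum.distrib)
    finally show ?thesis .
  qed
  have dq: "dd v q = (\<lambda>x. \<Sum>j\<in>UNIV. 2 * (dd (ax j) P x * dd v (dd (ax j) P) x))" for v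
  proof
    fix x
    have "(q has_derivative (\<lambda>v. \<Sum>j\<in>UNIV. dd (ax j) P x * dd v (dd (ax j) P) x + dd v (dd (ax j) P) x * dd (ax j) P x)) (at x)"
      unfolding q_def[abs_def]
      by (intro has_derivative_sum has_derivative_mult has_derivative_dd diffP)
    from dd_eq[OF this] show "dd v q x = (\<Sum>j\<in>UNIV. 2 * (dd (ax j) P x * dd v (dd (ax j) P) x))"
      by (simp add: mult.commute)
  qed
  have ddq: "dd (ax i) (dd (ax i) q) x0 = (\<Sum>j\<in>UNIV. 2 * (S i j)^2)" for i
  proof -
    have "((\<lambda>x. \<Sum>j\<in>UNIV. 2 * (dd (ax j) P x * dd (ax i) (dd (ax j) P) x)) has_derivative
        (\<lambda>v. \<Sum>j\<in>UNIV. 2 * (dd (ax j) P x0 * dd v (dd (ax i) (dd (ax j) P)) x0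
          + dd v (dd (ax j) P) x0 * dd (ax i) (dd (ax j) P) x0))) (at x0)"
      by (intro has_derivative_sum has_derivative_mult_right has_derivative_mult has_derivative_dd diffP)
    from dd_eq[OF this, of "ax i"] show ?thesis
      unfolding dq by (simp add: dP flat S_def power2_eq_square)
  qed
  have dz: "dd v z = (\<lambda>x. 2 * (x \<bullet> v) - 2 * (height x \<bullet> dd v height x))" for v
  proof
    fix x
    have "(z has_derivative (\<lambda>v. (x \<bullet> v + v \<bullet> x) - (height x \<bullet> dd v height x + dd v height x \<bullet> height x))) (at x)"
      unfolding z_def[abs_def]
      by (intro has_derivative_diff has_derivative_inner has_derivative_ident has_derivative_dd differentiable_height)
    from dd_eq[OF this] show "dd v z x = 2 * (x \<bullet> v) - 2 * (height x \<bullet> dd v height x)"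
      by (simp add: inner_commute)
  qed
  \<comment> \<open>Here the choice of \<open>c\<close> matters: the whole height at
    \<open>x0\<close> points along \<open>c\<close>, so the second derivatives of \<open>z\<close>
    involve only those of the scalar \<open>P\<close>.\<close>
  have hS: "height x0 \<bullet> dd v (dd w height) x0 = \<rho> * dd v (dd w P) x0" for v w
    unfolding dP using dd_inner_const[OF differentiable_height(2), of v c w x0] by (simp add: c(2))
  have ddz: "dd (ax i) (dd (ax i) z) x0 = 2 - 2 * \<rho> * S i i" for i
  proof -
    have "((\<lambda>x. 2 * (x \<bullet> ax i) - 2 * (height x \<bullet> dd (ax i) height x)) has_derivative
        (\<lambda>v. 2 * (v \<bullet> ax i) - 2 * (height x0 \<bullet> dd v (dd (ax i) height) x0 + dd v height x0 \<bullet> dd (ax i) height x0))) (at x0)"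
      by (intro has_derivative_diff has_derivative_mult_right has_derivative_inner has_derivative_inner_left
          has_derivative_ident has_derivative_dd differentiable_height)
    from dd_eq[OF this, of "ax i"] show ?thesis
      unfolding dz by (simp add: flat hS S_def) (simp add: ax_def inner_axis_axis)
  qed
  have zp: "z x = pseudo_distance (graph_map x)" for x
    by (simp add: z_def pseudo_distance_graph_map)
  have z_nonneg: "z x \<ge> 0" for x by (simp add: zp pseudo_distance_nonneg)
  define f1 where "f1 = z x0 / (8 * (z x0 + k))"
  define f2 where "f2 = k / (8 * (z x0 + k)^2)"
  have NP: "(N x)^2 \<le> K * (1 - q x) * exp (weight k (z x))" for x
  proof -
    have "N x = - support x c"
      unfolding N_def support_def radial_derivative_expand dP
      by (simp add: P_def ax_def inner_diff_right inner_sum_right)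
    moreover have "q x = (norm (conormal x c))^2"
      unfolding q_def norm_conormal_sq dP ax_def by (simp add: power2_eq_square)
    ultimately show ?thesis using bound[of x c] by (simp add: c(1) zp)
  qed
  have N0: "N x0 = \<rho>" by (simp add: N_def P0 dP flat)
  have test: "2 * \<rho> * dd (ax i) N x0 = \<rho>^2 * f1 * dd (ax i) z x0"
    "2 * (dd (ax i) N x0)^2 + 2 * \<rho> * dd (ax i) (dd (ax i) N) x0
      + \<rho>^2 * (dd (ax i) (dd (ax i) q) x0 - (f1^2 + f2) * (dd (ax i) z x0)^2 - f1 * dd (ax i) (dd (ax i) z) x0) \<le> 0" for i
  proof -
    let ?l = "\<lambda>t. x0 + t *\<^sub>R ax i"
    have l: "((\<lambda>t. f (?l t)) has_real_derivative dd (ax i) f (?l t)) (at t)" if "smooth_on UNIV f" for f t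
      using has_real_derivative_along_line[OF that] .
    have l2: "((\<lambda>t. dd (ax i) f (?l t)) has_real_derivative dd (ax i) (dd (ax i) f) x0) (at 0)"
      if "smooth_on UNIV f" for f :: "real^'n \<Rightarrow> real"
      using l[of "dd (ax i) f" 0, OF smooth_on_dd[OF that]] by simp
    have w2: "((\<lambda>t. t / (8 * (t + k))) has_real_derivative f2) (at (z (?l 0)))"
      using weight_deriv(2)[OF k0 z_nonneg[of x0]] by (simp add: f2_def)
    have q0: "q (?l 0) = 0" "dd (ax i) q (?l 0) = 0" by (simp_all add: q_def dq dP flat)
    have e0: "(N (?l 0))^2 = K * exp (weight k (z (?l 0)))" using eq by (simp add: N0 zp \<rho>_def)
    note t = weighted_maximum_test[of "\<lambda>t. N (?l t)" "\<lambda>t. dd (ax i) N (?l t)" "dd (ax i) (dd (ax i) N) x0"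
        "\<lambda>t. q (?l t)" "\<lambda>t. dd (ax i) q (?l t)" "dd (ax i) (dd (ax i) q) x0"
        "\<lambda>t. z (?l t)" "\<lambda>t. dd (ax i) z (?l t)" "dd (ax i) (dd (ax i) z) x0" "weight k" "\<lambda>t. t / (8 * (t + k))",
        OF l[OF smN] l2[OF smN] l[OF smq] l2[OF smq] l[OF smz] l2[OF smz] z_nonneg weight_deriv(1)[OF k0] w2 q0 NP e0]
    show "2 * \<rho> * dd (ax i) N x0 = \<rho>^2 * f1 * dd (ax i) z x0"
      using t(1) by (simp add: N0 f1_def)
    show "2 * (dd (ax i) N x0)^2 + 2 * \<rho> * dd (ax i) (dd (ax i) N) x0
      + \<rho>^2 * (dd (ax i) (dd (ax i) q) x0 - (f1^2 + f2) * (dd (ax i) z x0)^2 - f1 * dd (ax i) (dd (ax i) z) x0) \<le> 0"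
      using t(2) by (simp add: N0 f1_def)
  qed
  define X where "X = x0 \<bullet> x0"
  have Xs: "X = (\<Sum>i\<in>UNIV. (x0 $ i)^2)" by (simp add: X_def inner_vec_def power2_eq_square)
  have Xz: "X = z x0 + \<rho>^2" by (simp add: X_def z_def \<rho>_def power2_norm_eq_inner)
  have "X > 0" using z_nonneg[of x0] \<rho> by (simp add: Xz add_nonneg_pos)
  then have x0: "x0 \<noteq> 0" by (auto simp: X_def)
  have z1: "dd (ax i) z x0 = 2 * x0 $ i" for i
    by (simp add: dz flat ax_def inner_axis)
  have N1: "dd (ax i) N x0 = \<rho> * f1 * x0 $ i" for i
    using test(1)[of i] \<rho> by (simp add: z1 power2_eq_square)
  \<comment> \<open>The first-order conditions along the axes combined: \<open>x0\<close> is an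
    eigenvector of the Hessian of \<open>P\<close> with eigenvalue
    \<open>- \<rho> * f1\<close>.\<close>
  have Sx: "(\<Sum>j\<in>UNIV. x0 $ j * S i j) = - \<rho> * f1 * x0 $ i" for i
    using N1[of i] unfolding dN S_def by linarith
  have Sxx: "(\<Sum>i\<in>UNIV. \<Sum>j\<in>UNIV. x0 $ i * S i j * x0 $ j) = - \<rho> * f1 * X"
  proof -
    have "(\<Sum>j\<in>UNIV. x0 $ i * S i j * x0 $ j) = - \<rho> * f1 * (x0 $ i)^2" for i
    proof -
      have "(\<Sum>j\<in>UNIV. x0 $ i * S i j * x0 $ j) = x0 $ i * (\<Sum>j\<in>UNIV. x0 $ j * S i j)"
        by (simp add: sum_distrib_left ac_simps)
      then show ?thesis unfolding Sx by (simp add: power2_eq_square)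
    qed
    then show ?thesis by (simp add: Xs sum_distrib_left)
  qed
  have tr: "(\<Sum>i\<in>UNIV. S i i) = - \<rho> / 2"
    using differentiated_equation(1)[OF shrinker flat P_def] P0 by (simp add: S_def ax_def)
  \<comment> \<open>Commuting derivatives moves \<open>ax j\<close> outside the Laplacian; the
    differentiated equation then leaves the Hessian applied to \<open>x0\<close>, known from the
    eigenvector relation.\<close>
  have D: "(\<Sum>i\<in>UNIV. dd (ax i) (dd (ax i) (dd (ax j) P)) x0) = - \<rho> * f1 * x0 $ j / 2" for j
  proof -
    have "dd (ax i) (dd (ax i) (dd (ax j) P)) x0 = dd (ax j) (dd (ax i) (dd (ax i) P)) x0" for i
    proof -
      have "dd (ax i) (dd (ax j) P) = dd (ax j) (dd (ax i) P)"
        using dd_commute_real[OF open_UNIV UNIV_I smP] by blast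
      then show ?thesis
        using dd_commute_real[OF open_UNIV UNIV_I smooth_on_dd[OF smP], of "ax i" "ax j" "ax i" x0] by simp
    qed
    then have "(\<Sum>i\<in>UNIV. dd (ax i) (dd (ax i) (dd (ax j) P)) x0) = (\<Sum>i\<in>UNIV. dd (ax j) (dd (ax i) (dd (ax i) P)) x0)"
      by simp
    also have "\<dots> = (\<Sum>l\<in>UNIV. x0 $ l * S j l) / 2"
      using differentiated_equation(2)[OF shrinker flat P_def, of "ax j"] by (simp add: S_def ax_def)
    finally show ?thesis unfolding Sx by simp
  qed
  have N2: "(\<Sum>i\<in>UNIV. dd (ax i) (dd (ax i) N) x0) = \<rho> * f1 * X / 2 + \<rho> / 2"
  proof -
    have "(\<Sum>i\<in>UNIV. \<Sum>j\<in>UNIV. x0 $ j * dd (ax i) (dd (ax i) (dd (ax j) P)) x0)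
        = (\<Sum>j\<in>UNIV. x0 $ j * (\<Sum>i\<in>UNIV. dd (ax i) (dd (ax i) (dd (ax j) P)) x0))"
      by (subst sum.swap) (simp add: sum_distrib_left)
    also have "\<dots> = - \<rho> * f1 * X / 2"
      unfolding D Xs by (simp add: sum_distrib_left sum_divide_distrib power2_eq_square sum_negf ac_simps)
    finally show ?thesis
      unfolding ddN by (simp add: sum_subtractf sum_negf tr)
  qed
  define Q where "Q = (\<Sum>i\<in>UNIV. \<Sum>j\<in>UNIV. (S i j)^2)"
  have "(\<Sum>i\<in>UNIV. 2 * (dd (ax i) N x0)^2 + 2 * \<rho> * dd (ax i) (dd (ax i) N) x0
      + \<rho>^2 * (dd (ax i) (dd (ax i) q) x0 - (f1^2 + f2) * (dd (ax i) z x0)^2 - f1 * dd (ax i) (dd (ax i) z) x0)) \<le> 0"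
    using test(2) by (intro sum_nonpos) auto
  also have "(\<Sum>i\<in>UNIV. 2 * (dd (ax i) N x0)^2 + 2 * \<rho> * dd (ax i) (dd (ax i) N) x0
      + \<rho>^2 * (dd (ax i) (dd (ax i) q) x0 - (f1^2 + f2) * (dd (ax i) z x0)^2 - f1 * dd (ax i) (dd (ax i) z) x0))
    = 2 * (\<Sum>i\<in>UNIV. (dd (ax i) N x0)^2) + 2 * \<rho> * (\<Sum>i\<in>UNIV. dd (ax i) (dd (ax i) N) x0)
      + \<rho>^2 * ((\<Sum>i\<in>UNIV. dd (ax i) (dd (ax i) q) x0) - (f1^2 + f2) * (\<Sum>i\<in>UNIV. (dd (ax i) z x0)^2)
        - f1 * (\<Sum>i\<in>UNIV. dd (ax i) (dd (ax i) z) x0))"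
    by (simp only: sum.distrib sum_subtractf sum_distrib_left[symmetric])
  also have "(\<Sum>i\<in>UNIV. (dd (ax i) N x0)^2) = \<rho>^2 * f1^2 * X"
    by (simp add: N1 Xs sum_distrib_left power_mult_distrib)
  also have "(\<Sum>i\<in>UNIV. (dd (ax i) z x0)^2) = 4 * X"
    by (simp add: z1 Xs sum_distrib_left power_mult_distrib)
  also have "(\<Sum>i\<in>UNIV. dd (ax i) (dd (ax i) q) x0) = 2 * Q"
    by (simp add: ddq Q_def sum_distrib_left)
  also have "(\<Sum>i\<in>UNIV. dd (ax i) (dd (ax i) z) x0) = 2 * real CARD('n) + \<rho>^2"
    unfolding ddz sum_subtractf sum_distrib_left[symmetric] tr by (simp add: power2_eq_square)
  also note N2
  finally have E: "2 * (\<rho>^2 * f1^2 * X) + 2 * \<rho> * (\<rho> * f1 * X / 2 + \<rho> / 2)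
      + \<rho>^2 * (2 * Q - (f1^2 + f2) * (4 * X) - f1 * (2 * real CARD('n) + \<rho>^2)) \<le> 0" .
  have n1: "real CARD('n) \<ge> 1"
    using one_le_card_finite[where 'a = 'n] by linarith
  have "(- \<rho> * f1)^2 + 2 * a * (- \<rho> / 2 - (- \<rho> * f1)) - (real CARD('n) - 1) * a^2 \<le> Q" for a
    unfolding Q_def
    by (rule sum_squares_lower_bound[of x0 S "- \<rho> * f1" "- \<rho> / 2", OF x0 Sxx[unfolded X_def] tr])
  from maximum_test_arith[OF \<rho> n1 Xz E this]
    weight_inequality[OF n1 z_nonneg _ k f1_def f2_def, of "\<rho>^2"]
  show False by simp
qed

text \<open>The tangent vectors \<open>e i\<close> and normal vectors \<nu> at the point,
  orthonormalised for the metric and its negative respectively, form a pseudo-orthonormal basis.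
  Sending the standard basis to it defines the isometry \<open>S'\<close>.\<close>

lemma boosted_chart:
  obtains T' S' where "spacelike_chart M T' S'" "\<And>v. v \<in> tangent_space M (graph_map x0) \<Longrightarrow> snd (T' v) = 0"
proof -
  let ?A = "\<lambda>v. dd v height x0"
  obtain C :: "'n \<Rightarrow> real^'n \<Rightarrow> real^'n" where
    C': "\<And>x i j. C i x \<bullet> C j x - dd (C i x) height x \<bullet> dd (C j x) height x = (if i = j then 1 else 0)"
    using orthonormal_field by metis
  define c where "c i = C i x0" for i
  have c: "c i \<bullet> c j - ?A (c i) \<bullet> ?A (c j) = (if i = j then 1 else 0)" for i j
    unfolding c_def by (rule C')
  have linB: "linear (conormal x0)"
    by (rule linearI) (simp_all add: conormal_def vec_eq_iff inner_add_left)
  \<comment> \<open>A single form is orthonormalised by viewing it as a constant family over the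
    reals and evaluating the result at 0.\<close>
  let ?g = "\<lambda>(_::real) k l. (axis k 1 :: real^'m) \<bullet> axis l 1 - conormal x0 (axis k 1) \<bullet> conormal x0 (axis l 1)"
  obtain d where d: "d a \<bullet> d b - conormal x0 (d a) \<bullet> conormal x0 (d b) = (if a = b then 1 else 0)" for a b :: 'm
  proof (rule smooth_gram_schmidt[OF open_UNIV, of ?g])
    show "smooth_on UNIV (\<lambda>x. ?g x k l)" for k l by (rule smooth_on_const)
    show "?g x k l = ?g x l k" for x k l by (simp add: inner_commute)
    show "0 < gram_form (?g x) v v" if "v \<noteq> 0" for x v
      using conormal_less[OF that, of x0] by (simp add: gram_form_diff_inner[OF linB] norm_lt)
    fix D :: "'m \<Rightarrow> real \<Rightarrow> real^'m"
    assume "\<And>x i j. x \<in> UNIV \<Longrightarrow> gram_form (?g x) (D i x) (D j x) = (if i = j then 1 else 0)"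
    then have "D i 0 \<bullet> D j 0 - conormal x0 (D i 0) \<bullet> conormal x0 (D j 0) = (if i = j then 1 else 0)" for i j
      unfolding gram_form_diff_inner[OF linB] by blast
    then show thesis by (rule that)
  qed
  define e where "e i = S (c i, ?A (c i))" for i
  define \<nu> where "\<nu> a = S (conormal x0 (d a), d a)" for a
  have ee: "pseudo_inner (e i) (e j) = (if i = j then 1 else 0)" for i j
    using c[of i j] unfolding e_def pseudo_inner_S by (simp add: pseudo_inner_def)
  have nn: "pseudo_inner (\<nu> a) (\<nu> b) = (if a = b then - 1 else 0)" for a b
    using d[of a b] unfolding \<nu>_def pseudo_inner_S by (simp add: pseudo_inner_def split: if_splits)
  have en: "pseudo_inner (e i) (\<nu> a) = 0" for i a
    unfolding \<nu>_def e_def pseudo_inner_S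
    by (simp add: pseudo_inner_def inner_conormal inner_commute)
  define S' where "S' v = (\<Sum>i\<in>UNIV. fst v $ i *\<^sub>R e i) + (\<Sum>a\<in>UNIV. snd v $ a *\<^sub>R \<nu> a)" for v
  have linS': "linear S'"
    unfolding S'_def
    by (rule linearI) (simp_all add: scaleR_add_left sum.distrib scaleR_sum_right scaleR_add_right)
  note lin = linear_sum[OF linear_pseudo_inner_left] linear_add[OF linear_pseudo_inner_left]
  have Se: "pseudo_inner (S' v) (e j) = fst v $ j" for v j
    unfolding S'_def lin pseudo_inner_scaleR_left
    by (simp add: ee en pseudo_inner_commute[of "\<nu> _"] if_distrib cong: if_cong)
  have Sn: "pseudo_inner (S' v) (\<nu> b) = - (snd v $ b)" for v b
    unfolding S'_def lin pseudo_inner_scaleR_left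
    by (simp add: nn en if_distrib cong: if_cong)
  have SS: "pseudo_inner (S' v) (S' w) = pseudo_inner v w" for v w
  proof -
    have "pseudo_inner (S' v) (S' w) = pseudo_inner (S' w) (S' v)" by (rule pseudo_inner_commute)
    also have "\<dots> = (\<Sum>i\<in>UNIV. fst w $ i * pseudo_inner (S' v) (e i)) + (\<Sum>a\<in>UNIV. snd w $ a * pseudo_inner (S' v) (\<nu> a))"
      unfolding S'_def[of w] lin pseudo_inner_scaleR_left by (simp only: pseudo_inner_commute)
    also have "\<dots> = pseudo_inner v w"
      unfolding Se Sn by (simp add: pseudo_inner_def inner_vec_def sum_negf mult.commute)
    finally show ?thesis .
  qed
  have "inj S'"
    unfolding linear_injective_0[OF linS']
  proof (intro allI impI)
    fix v assume "S' v = 0"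
    \<comment> \<open>Reversing the vertical part of the second argument turns the indefinite
      product into the Euclidean square of \<open>v\<close>.\<close>
    then have "pseudo_inner v (fst v, - snd v) = 0"
      using SS[of v "(fst v, - snd v)"] by (simp add: pseudo_inner_def[of 0])
    then have "fst v \<bullet> fst v + snd v \<bullet> snd v = 0" by (simp add: pseudo_inner_def)
    then have "v \<bullet> v = 0" by (simp add: inner_prod_def)
    then show "v = 0" by simp
  qed
  then obtain T' where T': "linear T'" "\<And>v. T' (S' v) = v" "\<And>v. S' (T' v) = v"
    using linear_injective_isomorphism[OF linS'] by blast
  have "spacelike_chart M T' S'"
  proof (rule spacelike_chart.intro)
    show "pseudo_inner (T' v) (T' w) = pseudo_inner v w" for v w
      using SS[of "T' v" "T' w"] T' by simp
  qed (use spacelike closed zero_mem linS' T' in auto)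
  moreover have "snd (T' u) = 0" if u: "u \<in> tangent_space M (graph_map x0)" for u
  proof -
    obtain \<xi> where \<xi>: "u = S (\<xi>, ?A \<xi>)" using u tangent_space_eq by blast
    have "pseudo_inner u (\<nu> b) = 0" for b
      unfolding \<xi> \<nu>_def pseudo_inner_S by (simp add: pseudo_inner_def inner_conormal inner_commute)
    then have "snd (T' u) $ b = 0" for b
      using Sn[of "T' u" b] T' by simp
    then show ?thesis by (simp add: vec_eq_iff)
  qed
  ultimately show thesis using that by blast
qed

end

text \<open>Phrased with normal vectors of \<open>M\<close> instead of \<open>support\<close>, so
  that bound and equality carry over from the original chart to the boosted one.\<close>

lemma no_weighted_maximum:
  fixes M :: "('n::finite, 'm::finite) pseudo_space set"
  assumes "spacelike_self_shrinker M" "p \<in> M" "\<nu> \<in> normal_space M p" "\<nu> \<noteq> 0" "K > 0"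
    and chart: "spacelike_chart M T S" and k: "k = 2 * (real CARD('n))^2"
    and bound: "\<And>p \<nu>. p \<in> M \<Longrightarrow> \<nu> \<in> normal_space M p \<Longrightarrow>
      (pseudo_inner p \<nu>)^2 \<le> K * (- pseudo_inner \<nu> \<nu>) * exp (weight k (pseudo_distance p))"
    and eq: "(pseudo_inner p \<nu>)^2 = K * (- pseudo_inner \<nu> \<nu>) * exp (weight k (pseudo_distance p))"
  shows False
proof -
  interpret C: spacelike_chart M T S by (rule chart)
  obtain x1 where "p = C.graph_map x1" using C.M_eq assms(2) by blast
  then obtain T' S' where chart': "spacelike_chart M T' S'" and flat: "\<And>v. v \<in> tangent_space M p \<Longrightarrow> snd (T' v) = 0"
    using C.boosted_chart by metis
  interpret B: spacelike_chart M T' S' by (rule chart')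
  obtain x where x: "p = B.graph_map x" using B.M_eq assms(2) by blast
  have flat': "dd v B.height x = 0" for v
    using flat[of "S' (v, dd v B.height x)"] by (auto simp: x B.tangent_space_eq)
  have con: "B.conormal x c = 0" for c
    by (simp add: B.conormal_def flat' vec_eq_iff)
  have sup: "B.support x c = - (c \<bullet> B.height x)" for c
    by (simp add: B.support_def flat')
  have b: "(B.support y c)^2 \<le> K * ((norm c)^2 - (norm (B.conormal y c))^2) * exp (weight k (pseudo_distance (B.graph_map y)))" for y c
  proof -
    have n: "S' (B.conormal y c, c) \<in> normal_space M (B.graph_map y)" by (simp add: B.normal_space_iff)
    show ?thesis
      using bound[OF B.graph_map_mem n] B.pseudo_inner_normal[OF n] by simp
  qed
  let ?E = "K * exp (weight k (pseudo_distance p))"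
  define c where "c = B.ver \<nu>"
  have \<nu>: "\<nu> = S' (0, c)"
    using assms(3) B.S_hor_ver[of \<nu>] by (simp add: x B.normal_space_iff con c_def)
  then have "c \<noteq> 0" using assms(4) linear_0[OF B.linear_S] by (auto simp: zero_prod_def)
  have "(c \<bullet> B.height x)^2 = ?E * (norm c)^2"
    using eq B.pseudo_inner_normal[of \<nu> x] assms(3) sup by (simp add: x con c_def ac_simps)
  \<comment> \<open>Equality was given for \<nu>, but is wanted for the direction of the height.
    Cauchy-Schwarz bounds \<open>?E\<close> by the squared height, and the general bound with
    \<open>c\<close> equal to the height gives the converse.\<close>
  moreover have "(c \<bullet> B.height x)^2 \<le> (norm c)^2 * (norm (B.height x))^2"
    using Cauchy_Schwarz_ineq[of c "B.height x"] by (simp add: power2_norm_eq_inner)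
  ultimately have "?E * (norm c)^2 \<le> (norm (B.height x))^2 * (norm c)^2" by (simp add: ac_simps)
  then have le: "?E \<le> (norm (B.height x))^2" using \<open>c \<noteq> 0\<close> by simp
  have "?E > 0" using assms(5) by simp
  then have h: "B.height x \<noteq> 0" using le by auto
  have "((norm (B.height x))^2)^2 \<le> ?E * (norm (B.height x))^2"
    using b[of x "B.height x"] by (simp add: sup con power2_norm_eq_inner x ac_simps)
  then have "(norm (B.height x))^2 \<le> ?E" using h by (simp add: power2_eq_square)
  with le have "(norm (B.height x))^2 = K * exp (weight k (pseudo_distance (B.graph_map x)))" by (simp add: x)
  from B.flat_maximum_impossible[OF assms(1) flat' h k b this] show False .
qed

theorem theorem1p1:
  fixes M :: "('n::finite, 'm::finite) pseudo_space set" and \<alpha> :: real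
  assumes "spacelike_self_shrinker M"
    and "0 \<in> M"
    and "closed M"
    and "\<alpha> < 1/8"
    and "\<forall>p\<in>M. mean_curvature_norm_sq M p \<le> exp (\<alpha> * pseudo_distance p)"
  shows "affine M \<and> aff_dim M = int CARD('n)"
proof -
  have chart: "spacelike_chart M (\<lambda>v. v) (\<lambda>v. v)"
    using assms(1-3) by (intro spacelike_chart.intro) (simp_all add: spacelike_self_shrinker_def linear_ident)
  interpret spacelike_chart M "\<lambda>v. v" "\<lambda>v. v" by (rule chart)
  define k where "k = 2 * (real CARD('n))^2"
  have k0: "k > 0" by (simp add: k_def)
  have bound: "(support x c)^2
      \<le> 4 * exp (\<alpha> * pseudo_distance (graph_map x)) * ((norm c)^2 - (norm (conormal x c))^2)" for x c
    using support_bound[OF assms(1)] assms(5) graph_map_mem by blast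
  have zero: "support x c = 0" for x c
  proof (rule ccontr)
    assume "support x c \<noteq> 0"
    then obtain K x0 c0 where K: "K > 0" "c0 \<noteq> 0"
      "(support x0 c0)^2 = K * ((norm c0)^2 - (norm (conormal x0 c0))^2) * exp (weight k (pseudo_distance (graph_map x0)))"
      "\<And>x c. (support x c)^2 \<le> K * ((norm c)^2 - (norm (conormal x c))^2) * exp (weight k (pseudo_distance (graph_map x)))"
      by (rule weighted_support_maximum[OF bound assms(4) k0]) (rule that)
    have n: "(conormal x0 c0, c0) \<in> normal_space M (graph_map x0)"
      by (simp add: normal_space_iff hor_def ver_def)
    show False
    proof (rule no_weighted_maximum[OF assms(1) graph_map_mem n _ K(1) chart k_def])
      show "(conormal x0 c0, c0) \<noteq> 0" using K(2) by (simp add: zero_prod_def)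
      show "(pseudo_inner (graph_map x0) (conormal x0 c0, c0))^2
          = K * (- pseudo_inner (conormal x0 c0, c0) (conormal x0 c0, c0)) * exp (weight k (pseudo_distance (graph_map x0)))"
        using K(3) pseudo_inner_normal[OF n] by (simp add: ver_def)
      show "(pseudo_inner p \<nu>)^2 \<le> K * (- pseudo_inner \<nu> \<nu>) * exp (weight k (pseudo_distance p))"
        if p: "p \<in> M" and \<nu>: "\<nu> \<in> normal_space M p" for p \<nu>
      proof -
        obtain y where y: "p = graph_map y" using p M_eq by blast
        show ?thesis
          using K(4)[of y "ver \<nu>"] pseudo_inner_normal[of \<nu> y] \<nu> by (simp add: y)
      qed
    qed
  qed
  \<comment> \<open>With all supports zero the position vector is tangent everywhere, which for the
    height is Euler's relation of degree 1.\<close>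
  have "dd x height x = height x" for x
    using zero[of x "dd x height x - height x"] by (simp add: support_def)
  then have lin: "height x = dd x height 0" for x
    by (rule linear_of_radial_derivative[OF smooth_height height_0])
  define L where "L x = (x, dd x height 0)" for x
  have L: "linear L"
    unfolding L_def
    by (rule linearI) (simp_all add: linear_add[OF linear_dd_height] linear_scale[OF linear_dd_height])
  have "graph_map x = L x" for x
    using graph_map_eq[of x] by (simp only: L_def lin[of x])
  then have "range graph_map = range L" by (rule image_cong[OF refl])
  with M_eq have M: "M = range L" by (rule trans)
  have "subspace (range L)" by (rule linear_subspace_image[OF L subspace_UNIV])
  then have "subspace M" by (simp only: M)
  moreover have "inj L" by (rule injI) (simp add: L_def)
  then have "dim (range L) = CARD('n)"
    using dim_image_eq[OF L, of UNIV] by simp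
  then have "dim M = CARD('n)" by (simp only: M)
  ultimately show ?thesis
    by (simp add: subspace_imp_affine aff_dim_subspace)
qed

end
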